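(* Let $\mathcal{H}$ be a complex Hilbert space and let $B\in B(\mathcal{H})$ be an (orthogonal) projection of rank one. Up to isometries of $B(\mathcal{H})$, the operators $A\in B(\mathcal{H})$ with $\|A\|=1$ and $A\perp_P B$ are exactly the norm one operators which, relative to the decomposition $\mathcal{H}=B\mathcal{H}\oplus\ker B$ (with $B\mathcal{H}$ identified with $\mathbb{C}$), are of the form $$\begin{bmatrix}0&a^*\\ b&C\end{bmatrix},\qquad (\ast)$$ where $a,b\in\ker B$ and $C\in B(\ker B)$ satisfy $\|a\|^2+\|b\|^2=1$, $C\ge 0$, and $Cb=UT^{1/2}a$ for some self-adjoint unitary $U\in B(\ker B)$ satisfying $UT=TU$ and $U[C^*(T)T^{1/2}a]\perp[C^*(T)a]$, where $T:=I-aa^*-C^2$. That is: (i) if $A$ has norm $1$ and is of the form $(\ast)$ with $a,b,C$ as just described, then $A\perp_P B$; (ii) if $A\in B(\mathcal{H})$, $\|A\|=1$ and $A\perp_P B$, then there is a linear isometry $\Phi:B(\mathcal{H})\to B(\mathcal{H})$ with $\Phi(B)=B$ such that $\Phi(A)$ is of the form $(\ast)$ with $a,b,C$ as just described. In particular, for a norm one operator of the form $(\ast)$ with $a,b\in\ker B$, $\|a\|^2+\|b\|^2=1$, $C\ge 0$ and $T=I-aa^*-C^2$, the two families of conditions $$a^*T^nC^*b=0\quad\text{and}\quad b^*CT^nC^*b=a^*T^{n+1}a\qquad(n=0,1,2,\dots)$$ together are equivalent to $$(a^*+\overline{\lambda}\,b^*C)(I+|\lambda|^2T)^{-1}(a+\lambda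 C^*b)=\|a\|^2\qquad\text{for all }\lambda\in\mathbb{C}.$$
   Context: $B(\mathcal{H})$ denotes the bounded linear operators on $\mathcal{H}$ with the operator norm. For vectors $x,y$ in a complex normed space, $x\perp_P y$ (Pythagoras orthogonality) means that there exists a linear isometry $f$ from the linear span of $\{x,y\}$ into a Hilbert space such that $f(x)$ and $f(y)$ are orthogonal. Equivalently, $\|\alpha x+\beta y\|^2=|\alpha|^2\|x\|^2+|\beta|^2\|y\|^2$ for all $\alpha,\beta\in\mathbb{C}$. Linear isometries of $B(\mathcal{H})$ (not required to be surjective) include $X\mapsto UXV$ where $U$ and $V^*$ are isometries on $\mathcal{H}$, and transposition $X\mapsto X^t$. A vector $b\in\ker B$ is regarded as the operator $\mathbb{C}\to\ker B$, $\alpha\mapsto\alpha b$, and $a^*:\ker B\to\mathbb{C}$ is the functional $a^*(\zeta)=\langle\zeta,a\rangle$ (inner product linear in the first variable), so $aa^*$ is the operator $\zeta\mapsto\langle\zeta,a\rangle a$ on $\ker B$. The contractivity of the second column of $(\ast)$ (a consequence of the norm being $1$) gives $T\ge 0$, so $T^{1/2}$ makes sense. $C^*(T)$ denotes the C$^*$-algebra generated by $T$, i.e. the norm closure of the polynomials in $T$ (including constants), and $[C^*(T)x]$ is the closed linear span of $\{Sx: S\in C^*(T)\}$. *)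

theory Defs
  imports "HOL-Analysis.Analysis"
begin

section \<open>Complex normed spaces and complex Hilbert spaces\<close>

class complex_normed_vector = real_normed_vector +
  fixes scaleC :: "complex \<Rightarrow> 'a \<Rightarrow> 'a" (infixr \<open>*\<^sub>C\<close> 75)
  assumes scaleC_add_right: "c *\<^sub>C (x + y) = c *\<^sub>C x + c *\<^sub>C y"
    and scaleC_add_left: "(c + d) *\<^sub>C x = c *\<^sub>C x + d *\<^sub>C x"
    and scaleC_scaleC: "c *\<^sub>C d *\<^sub>C x = (c * d) *\<^sub>C x"
    and scaleR_scaleC: "r *\<^sub>R x = complex_of_real r *\<^sub>C x"
    and norm_scaleC: "norm (c *\<^sub>C x) = cmod c * norm x"
begin

lemma scaleC_one [simp]: "1 *\<^sub>C x = x"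
  using scaleR_scaleC[of 1 x] by (metis of_real_1 scaleR_one)

end

abbreviation cspan :: "'a::complex_normed_vector set \<Rightarrow> 'a set"
  where "cspan \<equiv> module.span scaleC"

lemma vector_space_scaleC:
  "vector_space (scaleC :: complex \<Rightarrow> 'a \<Rightarrow> 'a::complex_normed_vector)"
  by standard (simp_all add: scaleC_add_right scaleC_add_left scaleC_scaleC)

interpretation complex_vector:
  vector_space "scaleC :: complex \<Rightarrow> 'a \<Rightarrow> 'a::complex_normed_vector"
  by (rule vector_space_scaleC)

text \<open>
  The complex inner product is linear in the first variable. The underlying real Hilbert space
  structure, with inner product the real part of \<open>cinner\<close>, is part of the class,
  so that the norm is the one coming from \<open>cinner\<close> (lemma \<open>cinner_self\<close>).
\<close>

class chilbert_space = complex_normed_vector + real_inner + complete_space +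
  fixes cinner :: "'a \<Rightarrow> 'a \<Rightarrow> complex"
  assumes cinner_commute: "cinner x y = cnj (cinner y x)"
    and cinner_add_left: "cinner (x + y) z = cinner x z + cinner y z"
    and cinner_scaleC_left: "cinner (c *\<^sub>C x) y = c * cinner x y"
    and inner_eq_Re_cinner: "inner x y = Re (cinner x y)"

lemma cinner_add_right: "cinner x (y + z) = cinner x y + cinner x z"
  by (metis cinner_add_left cinner_commute complex_cnj_add)

lemma cinner_scaleC_right: "cinner x (c *\<^sub>C y) = cnj c * cinner x y"
  by (metis cinner_scaleC_left cinner_commute complex_cnj_mult)

lemma cinner_self: "cinner x x = complex_of_real ((norm x)\<^sup>2)"
proof -
  have "Im (cinner x x) = 0"
    using cinner_commute[of x x] by (metis complex_cnj_cancel_iff cnj.simps(2) equal_neg_zero)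
  moreover have "Re (cinner x x) = (norm x)\<^sup>2"
    by (simp add: inner_eq_Re_cinner[symmetric] power2_norm_eq_inner)
  ultimately show ?thesis by (simp add: complex_eq_iff)
qed

lemma cinner_zero_left [simp]: "cinner 0 x = 0"
  using cinner_add_left[of 0 0 x] by simp

lemma cinner_zero_right [simp]: "cinner x 0 = 0"
  using cinner_add_right[of x 0 0] by simp

lemma cinner_minus_left: "cinner (- x) y = - cinner x y"
proof -
  have "cinner x y + cinner (- x) y = 0" using cinner_add_left[of x "- x" y] by simp
  then show ?thesis by (rule minus_unique[symmetric])
qed

lemma cinner_minus_right: "cinner x (- y) = - cinner x y"
  by (metis cinner_minus_left cinner_commute complex_cnj_minus)

lemma cinner_diff_left: "cinner (x - y) z = cinner x z - cinner y z"
  using cinner_add_left[of x "- y" z] by (simp add: cinner_minus_left)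

lemma cinner_diff_right: "cinner x (y - z) = cinner x y - cinner x z"
  using cinner_add_right[of x y "- z"] by (simp add: cinner_minus_right)

lemma cinner_Cauchy_Schwarz: "cmod (cinner x y) \<le> norm x * norm y"
proof (cases "cinner x y = 0")
  case False
  define u where "u = cnj (cinner x y) / cmod (cinner x y)"
  have u: "cmod u = 1" using False by (simp add: u_def norm_divide)
  have "cinner (u *\<^sub>C x) y = complex_of_real (cmod (cinner x y))"
  proof -
    have "cnj (cinner x y) * cinner x y = complex_of_real (cmod (cinner x y)) * cmod (cinner x y)"
      using complex_norm_square[of "cinner x y"] by (simp add: power2_eq_square mult.commute)
    then show ?thesis using False by (simp add: cinner_scaleC_left u_def)
  qed
  then have "cmod (cinner x y) = inner (u *\<^sub>C x) y"
    by (simp add: inner_eq_Re_cinner)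
  also have "\<dots> \<le> norm (u *\<^sub>C x) * norm y"
    by (rule norm_cauchy_schwarz)
  finally show ?thesis by (simp add: norm_scaleC u)
qed simp

instantiation complex :: chilbert_space
begin
definition scaleC_complex :: "complex \<Rightarrow> complex \<Rightarrow> complex" where "scaleC_complex c x = c * x"
definition cinner_complex :: "complex \<Rightarrow> complex \<Rightarrow> complex" where "cinner_complex x y = x * cnj y"
instance
proof
  fix c d x y z :: complex and r :: real
  show "c *\<^sub>C (x + y) = c *\<^sub>C x + c *\<^sub>C y" "(c + d) *\<^sub>C x = c *\<^sub>C x + d *\<^sub>C x"
    "c *\<^sub>C d *\<^sub>C x = (c * d) *\<^sub>C x" "norm (c *\<^sub>C x) = cmod c * norm x"
    by (simp_all add: scaleC_complex_def distrib_left distrib_right norm_mult)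
  show "r *\<^sub>R x = complex_of_real r *\<^sub>C x"
    by (simp add: scaleC_complex_def scaleR_conv_of_real)
  show "cinner x y = cnj (cinner y x)" "cinner (x + y) z = cinner x z + cinner y z"
    "cinner (c *\<^sub>C x) y = c * cinner x y" "inner x y = Re (cinner x y)"
    by (simp_all add: scaleC_complex_def cinner_complex_def distrib_right inner_complex_def)
qed
end

instantiation prod :: (complex_normed_vector, complex_normed_vector) complex_normed_vector
begin
definition scaleC_prod :: "complex \<Rightarrow> 'a \<times> 'b \<Rightarrow> 'a \<times> 'b"
  where "scaleC_prod c x = (c *\<^sub>C fst x, c *\<^sub>C snd x)"
instance
proof
  fix c :: complex and x :: "'a \<times> 'b"
  have "norm (c *\<^sub>C x) = sqrt ((cmod c)\<^sup>2 * ((norm (fst x))\<^sup>2 + (norm (snd x))\<^sup>2))"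
    by (simp add: scaleC_prod_def norm_prod_def norm_scaleC power_mult_distrib distrib_left)
  then show "norm (c *\<^sub>C x) = cmod c * norm x"
    by (simp add: norm_prod_def real_sqrt_mult)
qed (simp_all add: scaleC_prod_def scaleC_add_right scaleC_add_left scaleC_scaleC scaleR_scaleC
      prod_eq_iff)
end

instantiation prod :: (chilbert_space, chilbert_space) chilbert_space
begin
definition cinner_prod :: "'a \<times> 'b \<Rightarrow> 'a \<times> 'b \<Rightarrow> complex"
  where "cinner_prod x y = cinner (fst x) (fst y) + cinner (snd x) (snd y)"
instance
proof
  fix x y z :: "'a \<times> 'b" and c
  show "cinner x y = cnj (cinner y x)"
    unfolding cinner_prod_def
    by (metis cinner_commute complex_cnj_add)
  show "cinner (x + y) z = cinner x z + cinner y z"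
    by (simp add: cinner_prod_def cinner_add_left)
  show "cinner (c *\<^sub>C x) y = c * cinner x y"
    by (simp add: cinner_prod_def scaleC_prod_def cinner_scaleC_left distrib_left)
  show "inner x y = Re (cinner x y)"
    by (simp add: cinner_prod_def inner_prod_def inner_eq_Re_cinner)
qed
end


section \<open>Pythagoras orthogonality\<close>

text \<open>
  HOL cannot quantify existentially over all Hilbert spaces, so the target space is fixed to be
  the two-dimensional Hilbert space \<open>complex \<times> complex\<close>. This loses nothing since the image of
  \<open>cspan {x, y}\<close> is at most two-dimensional: by \<open>pythagoras_orth_if_isometry\<close>, an isometry into
  an arbitrary Hilbert space is enough.
\<close>

definition pythagoras_orth ::
    "'a::complex_normed_vector \<Rightarrow> 'a \<Rightarrow> bool" (infix \<open>\<bottom>\<^sub>P\<close> 50)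
  where "x \<bottom>\<^sub>P y \<longleftrightarrow>
    (\<exists>f :: 'a \<Rightarrow> complex \<times> complex.
      (\<forall>u\<in>cspan {x, y}. \<forall>v\<in>cspan {x, y}. f (u + v) = f u + f v) \<and>
      (\<forall>c. \<forall>u\<in>cspan {x, y}. f (c *\<^sub>C u) = c *\<^sub>C f u) \<and>
      (\<forall>u\<in>cspan {x, y}. norm (f u) = norm u) \<and>
      cinner (f x) (f y) = 0)"

lemma cspan_pair:
  "cspan {x, y :: 'a::complex_normed_vector} = {a *\<^sub>C x + b *\<^sub>C y |a b. True}"
proof -
  have "u \<in> cspan {x, y} \<longleftrightarrow> (\<exists>a b. u = a *\<^sub>C x + b *\<^sub>C y)" for u
    by (simp add: complex_vector.span_insert[of x] complex_vector.span_singleton image_iff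
        diff_eq_eq add.commute)
  then show ?thesis by blast
qed

lemma norm_add_sq_orth:
  fixes u v :: "'k::chilbert_space"
  assumes "cinner u v = 0"
  shows "(norm (a *\<^sub>C u + b *\<^sub>C v))\<^sup>2 = (cmod a)\<^sup>2 * (norm u)\<^sup>2 + (cmod b)\<^sup>2 * (norm v)\<^sup>2"
proof -
  have "inner (a *\<^sub>C u) (b *\<^sub>C v) = 0"
    by (simp add: inner_eq_Re_cinner cinner_scaleC_left cinner_scaleC_right assms)
  then have "(norm (a *\<^sub>C u + b *\<^sub>C v))\<^sup>2 = (norm (a *\<^sub>C u))\<^sup>2 + (norm (b *\<^sub>C v))\<^sup>2"
    by (simp add: power2_norm_eq_inner inner_add_left inner_add_right inner_commute)
  then show ?thesis by (simp add: norm_scaleC power_mult_distrib)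
qed

lemma norm_identity_if_isometry:
  fixes x y :: "'a::complex_normed_vector" and f :: "'a \<Rightarrow> 'k::chilbert_space"
  assumes add: "\<And>u v. u \<in> cspan {x, y} \<Longrightarrow> v \<in> cspan {x, y} \<Longrightarrow> f (u + v) = f u + f v"
    and scale: "\<And>c u. u \<in> cspan {x, y} \<Longrightarrow> f (c *\<^sub>C u) = c *\<^sub>C f u"
    and norm: "\<And>u. u \<in> cspan {x, y} \<Longrightarrow> norm (f u) = norm u"
    and orth: "cinner (f x) (f y) = 0"
  shows "(norm (a *\<^sub>C x + b *\<^sub>C y))\<^sup>2 = (cmod a)\<^sup>2 * (norm x)\<^sup>2 + (cmod b)\<^sup>2 * (norm y)\<^sup>2"
proof -
  have xy: "x \<in> cspan {x, y}" "y \<in> cspan {x, y}"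
    by (auto intro: complex_vector.span_base)
  then have sc: "a *\<^sub>C x \<in> cspan {x, y}" "b *\<^sub>C y \<in> cspan {x, y}"
    by (auto intro: complex_vector.span_scale)
  then have "a *\<^sub>C x + b *\<^sub>C y \<in> cspan {x, y}"
    by (rule complex_vector.span_add)
  then have "norm (a *\<^sub>C x + b *\<^sub>C y) = norm (a *\<^sub>C f x + b *\<^sub>C f y)"
    using norm[of "a *\<^sub>C x + b *\<^sub>C y"] add[OF sc] scale[OF xy(1), of a] scale[OF xy(2), of b]
    by simp
  then show ?thesis
    using norm_add_sq_orth[OF orth] norm[OF xy(1)] norm[OF xy(2)] by simp
qed

lemma pythagoras_orth_iff:
  fixes x y :: "'a::complex_normed_vector"
  shows "x \<bottom>\<^sub>P y \<longleftrightarrow> (\<forall>a b. (norm (a *\<^sub>C x + b *\<^sub>C y))\<^sup>2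
            = (cmod a)\<^sup>2 * (norm x)\<^sup>2 + (cmod b)\<^sup>2 * (norm y)\<^sup>2)"
    (is "?L \<longleftrightarrow> ?R")
proof
  assume ?L
  then obtain f :: "'a \<Rightarrow> complex \<times> complex" where
    "\<forall>u\<in>cspan {x, y}. \<forall>v\<in>cspan {x, y}. f (u + v) = f u + f v"
    "\<forall>c. \<forall>u\<in>cspan {x, y}. f (c *\<^sub>C u) = c *\<^sub>C f u"
    "\<forall>u\<in>cspan {x, y}. norm (f u) = norm u"
    "cinner (f x) (f y) = 0"
    unfolding pythagoras_orth_def by blast
  then show ?R using norm_identity_if_isometry[of x y f] by auto
next
  assume R: ?R
  define g :: "complex \<Rightarrow> complex \<Rightarrow> complex \<times> complex"
    where "g a b = (a * norm x, b * norm y)" for a b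
  define f where "f u = (SOME p. \<exists>a b. u = a *\<^sub>C x + b *\<^sub>C y \<and> p = g a b)" for u
  have ng: "norm (g a b) = norm (a *\<^sub>C x + b *\<^sub>C y)" for a b
  proof -
    have "(norm (g a b))\<^sup>2 = (norm (a *\<^sub>C x + b *\<^sub>C y))\<^sup>2"
      by (simp add: R g_def norm_prod_def norm_mult power_mult_distrib)
    then show ?thesis by simp
  qed
  have f: "f (a *\<^sub>C x + b *\<^sub>C y) = g a b" for a b
  proof -
    have "\<exists>p. \<exists>a' b'. a *\<^sub>C x + b *\<^sub>C y = a' *\<^sub>C x + b' *\<^sub>C y \<and> p = g a' b'" by blast
    from someI_ex[OF this] obtain a' b' where
      eq: "a *\<^sub>C x + b *\<^sub>C y = a' *\<^sub>C x + b' *\<^sub>C y" and p: "f (a *\<^sub>C x + b *\<^sub>C y) = g a' b'"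
      unfolding f_def by blast
    have "norm (g (a - a') (b - b')) = 0"
      using eq by (simp add: ng complex_vector.scale_left_diff_distrib algebra_simps)
    then have "g a b = g a' b'" by (simp add: g_def algebra_simps zero_prod_def)
    then show ?thesis using p by simp
  qed
  have "f (u + v) = f u + f v" if uv: "u \<in> cspan {x, y}" "v \<in> cspan {x, y}" for u v
  proof -
    obtain a b a' b' where u: "u = a *\<^sub>C x + b *\<^sub>C y" and v: "v = a' *\<^sub>C x + b' *\<^sub>C y"
      using uv unfolding cspan_pair by blast
    have "u + v = (a + a') *\<^sub>C x + (b + b') *\<^sub>C y"
      by (simp add: u v scaleC_add_left algebra_simps)
    then have "f (u + v) = g (a + a') (b + b')" by (simp only: f)
    also have "\<dots> = f u + f v" by (simp add: u v f) (simp add: g_def distrib_right)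
    finally show ?thesis .
  qed
  moreover have "f (c *\<^sub>C u) = c *\<^sub>C f u" if u: "u \<in> cspan {x, y}" for c u
  proof -
    obtain a b where u: "u = a *\<^sub>C x + b *\<^sub>C y"
      using u unfolding cspan_pair by blast
    have "c *\<^sub>C u = (c * a) *\<^sub>C x + (c * b) *\<^sub>C y"
      by (simp add: u scaleC_add_right scaleC_scaleC)
    then have "f (c *\<^sub>C u) = g (c * a) (c * b)" by (simp only: f)
    also have "\<dots> = c *\<^sub>C f u"
      by (simp add: u f) (simp add: g_def scaleC_prod_def scaleC_complex_def)
    finally show ?thesis .
  qed
  moreover have "norm (f u) = norm u" if u: "u \<in> cspan {x, y}" for u
    using u f ng unfolding cspan_pair by force
  moreover have "cinner (f x) (f y) = 0"
    using f[of 1 0] f[of 0 1] by (simp add: g_def cinner_prod_def cinner_complex_def)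
  ultimately show ?L unfolding pythagoras_orth_def by blast
qed

lemma pythagoras_orth_if_isometry:
  fixes x y :: "'a::complex_normed_vector" and f :: "'a \<Rightarrow> 'k::chilbert_space"
  assumes "\<And>u v. u \<in> cspan {x, y} \<Longrightarrow> v \<in> cspan {x, y} \<Longrightarrow> f (u + v) = f u + f v"
    and "\<And>c u. u \<in> cspan {x, y} \<Longrightarrow> f (c *\<^sub>C u) = c *\<^sub>C f u"
    and "\<And>u. u \<in> cspan {x, y} \<Longrightarrow> norm (f u) = norm u"
    and "cinner (f x) (f y) = 0"
  shows "x \<bottom>\<^sub>P y"
  unfolding pythagoras_orth_iff using norm_identity_if_isometry[of x y f] assms by blast


section \<open>Bounded operators\<close>

typedef (overloaded) ('a, 'b) cblinfun (\<open>(_ \<Rightarrow>\<^sub>C\<^sub>L /_)\<close> [22, 21] 21) =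
  "{f :: 'a::complex_normed_vector \<Rightarrow> 'b::complex_normed_vector.
      bounded_linear f \<and> (\<forall>c x. f (c *\<^sub>C x) = c *\<^sub>C f x)}"
  morphisms cblinfun_apply CBlinfun
  by (rule exI[of _ "\<lambda>_. 0"]) (auto intro: bounded_linear_zero)

notation cblinfun_apply (infixr \<open>*\<^sub>V\<close> 75)

setup_lifting type_definition_cblinfun

lemma cblinfun_eqI: "(\<And>x. A *\<^sub>V x = A' *\<^sub>V x) \<Longrightarrow> A = A'"
  by transfer auto

lemma bounded_linear_scaleC: "bounded_linear (\<lambda>x :: 'a::complex_normed_vector. c *\<^sub>C x)"
  by (rule bounded_linear_intro[where K = "cmod c"])
    (auto simp: scaleC_add_right scaleR_scaleC scaleC_scaleC norm_scaleC mult.commute)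

lemma onorm_scaleC_le:
  fixes f :: "'a::real_normed_vector \<Rightarrow> 'b::complex_normed_vector"
  assumes "bounded_linear f"
  shows "onorm (\<lambda>x. c *\<^sub>C f x) \<le> cmod c * onorm f"
proof (rule onorm_bound)
  show "0 \<le> cmod c * onorm f" by (simp add: onorm_pos_le assms)
  show "norm (c *\<^sub>C f x) \<le> cmod c * onorm f * norm x" for x
    using mult_left_mono[OF onorm[OF assms, of x], of "cmod c"]
    by (simp add: norm_scaleC mult.assoc)
qed

lemma onorm_scaleC:
  fixes f :: "'a::real_normed_vector \<Rightarrow> 'b::complex_normed_vector"
  assumes f: "bounded_linear f"
  shows "onorm (\<lambda>x. c *\<^sub>C f x) = cmod c * onorm f"
proof (cases "c = 0")
  case False
  have "onorm (\<lambda>x. inverse c *\<^sub>C (c *\<^sub>C f x)) \<le> cmod (inverse c) * onorm (\<lambda>x. c *\<^sub>C f x)"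
    by (intro onorm_scaleC_le bounded_linear_compose[OF bounded_linear_scaleC f])
  then have "cmod c * onorm f \<le> onorm (\<lambda>x. c *\<^sub>C f x)"
    using False by (simp add: scaleC_scaleC norm_divide field_simps)
  then show ?thesis using onorm_scaleC_le[OF f, of c] by simp
qed (simp add: onorm_zero)

text \<open>The norm of \<open>A :: 'a \<Rightarrow>\<^sub>C\<^sub>L 'b\<close> is the operator norm \<open>onorm\<close>.\<close>

instantiation cblinfun :: (complex_normed_vector, complex_normed_vector) complex_normed_vector
begin

lift_definition norm_cblinfun :: "'a \<Rightarrow>\<^sub>C\<^sub>L 'b \<Rightarrow> real" is onorm .

lift_definition zero_cblinfun :: "'a \<Rightarrow>\<^sub>C\<^sub>L 'b" is "\<lambda>_. 0"
  by (simp add: bounded_linear_zero)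

lift_definition plus_cblinfun :: "'a \<Rightarrow>\<^sub>C\<^sub>L 'b \<Rightarrow> 'a \<Rightarrow>\<^sub>C\<^sub>L 'b \<Rightarrow> 'a \<Rightarrow>\<^sub>C\<^sub>L 'b"
  is "\<lambda>f g x. f x + g x"
  by (simp add: bounded_linear_add scaleC_add_right)

lift_definition minus_cblinfun :: "'a \<Rightarrow>\<^sub>C\<^sub>L 'b \<Rightarrow> 'a \<Rightarrow>\<^sub>C\<^sub>L 'b \<Rightarrow> 'a \<Rightarrow>\<^sub>C\<^sub>L 'b"
  is "\<lambda>f g x. f x - g x"
  by (simp add: bounded_linear_sub complex_vector.scale_right_diff_distrib)

lift_definition uminus_cblinfun :: "'a \<Rightarrow>\<^sub>C\<^sub>L 'b \<Rightarrow> 'a \<Rightarrow>\<^sub>C\<^sub>L 'b"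
  is "\<lambda>f x. - f x"
  by (simp add: bounded_linear_minus)

lift_definition scaleC_cblinfun :: "complex \<Rightarrow> 'a \<Rightarrow>\<^sub>C\<^sub>L 'b \<Rightarrow> 'a \<Rightarrow>\<^sub>C\<^sub>L 'b"
  is "\<lambda>c f x. c *\<^sub>C f x"
  by (auto intro: bounded_linear_compose[OF bounded_linear_scaleC]
      simp: scaleC_scaleC mult.commute)

definition scaleR_cblinfun :: "real \<Rightarrow> 'a \<Rightarrow>\<^sub>C\<^sub>L 'b \<Rightarrow> 'a \<Rightarrow>\<^sub>C\<^sub>L 'b"
  where "scaleR_cblinfun r A = complex_of_real r *\<^sub>C A"

definition sgn_cblinfun :: "'a \<Rightarrow>\<^sub>C\<^sub>L 'b \<Rightarrow> 'a \<Rightarrow>\<^sub>C\<^sub>L 'b"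
  where "sgn_cblinfun A = inverse (norm A) *\<^sub>R A"

definition dist_cblinfun :: "'a \<Rightarrow>\<^sub>C\<^sub>L 'b \<Rightarrow> 'a \<Rightarrow>\<^sub>C\<^sub>L 'b \<Rightarrow> real"
  where "dist_cblinfun A A' = norm (A - A')"

definition uniformity_cblinfun :: "(('a \<Rightarrow>\<^sub>C\<^sub>L 'b) \<times> ('a \<Rightarrow>\<^sub>C\<^sub>L 'b)) filter"
  where "uniformity_cblinfun = (INF e\<in>{0 <..}. principal {(x, y). dist x y < e})"

definition open_cblinfun :: "('a \<Rightarrow>\<^sub>C\<^sub>L 'b) set \<Rightarrow> bool"
  where "open_cblinfun S = (\<forall>x\<in>S. \<forall>\<^sub>F (x', y) in uniformity. x' = x \<longrightarrow> y \<in> S)"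

instance
proof
  fix A A' A'' :: "'a \<Rightarrow>\<^sub>C\<^sub>L 'b" and r s :: real and c d :: complex
  show "A + A' + A'' = A + (A' + A'')" "A + A' = A' + A" "0 + A = A" "- A + A = 0"
    "A - A' = A + - A'"
    by (transfer; simp add: algebra_simps)+
  have scale: "c *\<^sub>C (A + A') = c *\<^sub>C A + c *\<^sub>C A'" "(c + d) *\<^sub>C A = c *\<^sub>C A + d *\<^sub>C A"
      "c *\<^sub>C d *\<^sub>C A = (c * d) *\<^sub>C A" 
    for c d and A A' :: "'a \<Rightarrow>\<^sub>C\<^sub>L 'b"
    by (transfer; simp add: scaleC_add_right scaleC_add_left scaleC_scaleC)+
  show "c *\<^sub>C (A + A') = c *\<^sub>C A + c *\<^sub>C A'" "(c + d) *\<^sub>C A = c *\<^sub>C A + d *\<^sub>C A"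
      "c *\<^sub>C d *\<^sub>C A = (c * d) *\<^sub>C A"
    by (rule scale)+
  have norm: "norm (c *\<^sub>C A) = cmod c * norm A" for c and A :: "'a \<Rightarrow>\<^sub>C\<^sub>L 'b"
    by transfer (simp add: onorm_scaleC)
  then show "norm (c *\<^sub>C A) = cmod c * norm A" .
  from norm show "norm (r *\<^sub>R A) = \<bar>r\<bar> * norm A"
    by (simp add: scaleR_cblinfun_def)
  show "r *\<^sub>R (A + A') = r *\<^sub>R A + r *\<^sub>R A'" "(r + s) *\<^sub>R A = r *\<^sub>R A + s *\<^sub>R A"
    "r *\<^sub>R s *\<^sub>R A = (r * s) *\<^sub>R A" "r *\<^sub>R A = complex_of_real r *\<^sub>C A"
    by (simp_all add: scaleR_cblinfun_def scale)
  show "1 *\<^sub>R A = A"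
    unfolding scaleR_cblinfun_def by transfer simp
  show "norm A = 0 \<longleftrightarrow> A = 0"
    by transfer (auto simp: onorm_eq_0)
  show "norm (A + A') \<le> norm A + norm A'"
    by transfer (simp add: onorm_triangle)
qed (auto simp: sgn_cblinfun_def dist_cblinfun_def uniformity_cblinfun_def open_cblinfun_def)

end

lift_definition id_cblinfun :: "'a::complex_normed_vector \<Rightarrow>\<^sub>C\<^sub>L 'a" is "\<lambda>x. x"
  by simp

lift_definition cblinfun_compose ::
    "'b::complex_normed_vector \<Rightarrow>\<^sub>C\<^sub>L 'c::complex_normed_vector \<Rightarrow> 'a::complex_normed_vector \<Rightarrow>\<^sub>C\<^sub>L 'b \<Rightarrow> 'a \<Rightarrow>\<^sub>C\<^sub>L 'c"
    (infixl \<open>o\<^sub>C\<^sub>L\<close> 67)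
  is "\<lambda>f g x. f (g x)"
  by (simp add: bounded_linear_compose)

text \<open>\<open>self_outer a\<close> is the operator \<open>aa\<^sup>*\<close>.\<close>

lift_definition self_outer :: "'a::chilbert_space \<Rightarrow> 'a \<Rightarrow>\<^sub>C\<^sub>L 'a"
  is "\<lambda>a z. cinner z a *\<^sub>C a"
proof (intro conjI allI)
  fix a :: 'a
  show "bounded_linear (\<lambda>z. cinner z a *\<^sub>C a)"
  proof (rule bounded_linear_intro[where K = "norm a * norm a"])
    fix x y :: 'a and r :: real
    show "cinner (x + y) a *\<^sub>C a = cinner x a *\<^sub>C a + cinner y a *\<^sub>C a"
      by (simp add: cinner_add_left scaleC_add_left)
    show "cinner (r *\<^sub>R x) a *\<^sub>C a = r *\<^sub>R cinner x a *\<^sub>C a"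
      by (simp add: scaleR_scaleC cinner_scaleC_left scaleC_scaleC)
    show "norm (cinner x a *\<^sub>C a) \<le> norm x * (norm a * norm a)"
      using mult_right_mono[OF cinner_Cauchy_Schwarz[of x a], of "norm a"]
      by (simp add: norm_scaleC mult.assoc)
  qed
  show "cinner (c *\<^sub>C x) a *\<^sub>C a = c *\<^sub>C cinner x a *\<^sub>C a" for c and x :: 'a
    by (simp add: cinner_scaleC_left scaleC_scaleC)
qed

definition linear_isometry :: "('a::complex_normed_vector \<Rightarrow> 'b::complex_normed_vector) \<Rightarrow> bool"
  where "linear_isometry \<Phi> \<longleftrightarrow>
    Vector_Spaces.linear scaleC scaleC \<Phi> \<and> (\<forall>x. norm (\<Phi> x) = norm x)"

definition adj :: "'a::chilbert_space \<Rightarrow>\<^sub>C\<^sub>L 'a \<Rightarrow> 'a \<Rightarrow>\<^sub>C\<^sub>L 'a"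
  where "adj A = (THE A'. \<forall>x y. cinner (A *\<^sub>V x) y = cinner x (A' *\<^sub>V y))"

definition selfadjoint :: "'a::chilbert_space \<Rightarrow>\<^sub>C\<^sub>L 'a \<Rightarrow> bool"
  where "selfadjoint A \<longleftrightarrow> adj A = A"

definition positive_op :: "'a::chilbert_space \<Rightarrow>\<^sub>C\<^sub>L 'a \<Rightarrow> bool"
  where "positive_op A \<longleftrightarrow> (\<forall>x. cinner (A *\<^sub>V x) x \<in> \<real>\<^sub>\<ge>\<^sub>0)"

definition pos_sqrt :: "'a::chilbert_space \<Rightarrow>\<^sub>C\<^sub>L 'a \<Rightarrow> 'a \<Rightarrow>\<^sub>C\<^sub>L 'a"
  where "pos_sqrt T = (THE R. positive_op R \<and> R o\<^sub>C\<^sub>L R = T)"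

definition orth_projection :: "'a::chilbert_space \<Rightarrow>\<^sub>C\<^sub>L 'a \<Rightarrow> bool"
  where "orth_projection P \<longleftrightarrow> P o\<^sub>C\<^sub>L P = P \<and> selfadjoint P"

definition rank_one :: "'a::complex_normed_vector \<Rightarrow>\<^sub>C\<^sub>L 'a \<Rightarrow> bool"
  where "rank_one A \<longleftrightarrow> (\<exists>v. v \<noteq> 0 \<and> range (cblinfun_apply A) = cspan {v})"

definition ker :: "'a::complex_normed_vector \<Rightarrow>\<^sub>C\<^sub>L 'a \<Rightarrow> 'a set"
  where "ker A = {x. A *\<^sub>V x = 0}"

lemma cinner_eqI:
  fixes u v :: "'a::chilbert_space"
  assumes "\<And>x. cinner x u = cinner x v"
  shows "u = v"
proof -
  have "cinner (u - v) (u - v) = 0" using assms by (simp add: cinner_diff_right)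
  then show ?thesis by (simp add: cinner_self)
qed

lemma cblinfun_add: "A *\<^sub>V (x + y) = A *\<^sub>V x + A *\<^sub>V y"
  by transfer (blast intro: linear_add bounded_linear.linear)

lemma cblinfun_diff: "A *\<^sub>V (x - y) = A *\<^sub>V x - A *\<^sub>V y"
  by transfer (blast intro: linear_diff bounded_linear.linear)

lemma cblinfun_scaleC: "A *\<^sub>V (c *\<^sub>C x) = c *\<^sub>C A *\<^sub>V x"
  by transfer simp

lemma norm_cblinfun: "norm (A *\<^sub>V x) \<le> norm A * norm x"
  by transfer (simp add: onorm)

lemma adj_eqI:
  assumes "\<And>x y. cinner (A *\<^sub>V x) y = cinner x (A' *\<^sub>V y)"
  shows "adj A = A'"
  unfolding adj_def
proof (rule the_equality)
  show "\<forall>x y. cinner (A *\<^sub>V x) y = cinner x (A' *\<^sub>V y)" using assms by blast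
  fix A'' assume A'': "\<forall>x y. cinner (A *\<^sub>V x) y = cinner x (A'' *\<^sub>V y)"
  have "A'' *\<^sub>V y = A' *\<^sub>V y" for y
    by (rule cinner_eqI) (simp add: A''[rule_format, symmetric] assms[symmetric])
  then show "A'' = A'" by (rule cblinfun_eqI)
qed

lemma riesz_representation:
  fixes \<phi> :: "'a::chilbert_space \<Rightarrow> complex"
  assumes bl: "bounded_linear \<phi>" and sc: "\<And>c x. \<phi> (c *\<^sub>C x) = c * \<phi> x"
  shows "\<exists>w. \<forall>x. \<phi> x = cinner x w"
proof (cases "\<forall>x. \<phi> x = 0")
  case True
  then show ?thesis by (intro exI[of _ 0]) simp
next
  case False
  interpret bounded_linear \<phi> by (rule bl)
  define S where "S = {x. \<phi> x = 1}"
  define d where "d = Inf (norm ` S)"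
  obtain x0 where x0: "\<phi> x0 \<noteq> 0" using False by blast
  have "inverse (\<phi> x0) *\<^sub>C x0 \<in> S" using x0 by (simp add: S_def sc)
  then have ne: "norm ` S \<noteq> {}" by blast
  have bdd: "bdd_below (norm ` S)" by (rule bdd_belowI[of _ 0]) auto
  have d_le: "d \<le> norm s" if "s \<in> S" for s
    unfolding d_def using bdd that by (simp add: cInf_lower)
  have d0: "0 \<le> d" unfolding d_def by (rule cInf_greatest[OF ne]) auto
  have "\<exists>s\<in>S. norm s < d + 1 / real (Suc n)" for n
    using cInf_lessD[OF ne, of "d + 1 / real (Suc n)"] unfolding d_def by auto
  then obtain s where sS: "\<And>n. s n \<in> S" and s_less: "\<And>n. norm (s n) < d + 1 / real (Suc n)"
    by metis
  have "Cauchy s"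
  proof (rule CauchyI)
    fix e :: real assume e: "0 < e"
    have "(\<lambda>n. 4 * ((d + 1 / real (Suc n))\<^sup>2 - d\<^sup>2)) \<longlonglongrightarrow> 4 * ((d + 0)\<^sup>2 - d\<^sup>2)"
      by (intro tendsto_intros LIMSEQ_Suc[OF lim_1_over_n])
    then have "\<forall>\<^sub>F n in sequentially. 4 * ((d + 1 / real (Suc n))\<^sup>2 - d\<^sup>2) < e\<^sup>2"
      using e by (intro order_tendstoD(2)) auto
    then obtain N where N: "4 * ((d + 1 / real (Suc N))\<^sup>2 - d\<^sup>2) < e\<^sup>2"
      by (auto simp: eventually_sequentially)
    show "\<exists>M. \<forall>m\<ge>M. \<forall>n\<ge>M. norm (s m - s n) < e"
    proof (intro exI[of _ N] allI impI)
      fix m n assume mn: "N \<le> m" "N \<le> n"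
      have sq: "(norm (s k))\<^sup>2 \<le> (d + 1 / real (Suc N))\<^sup>2" if "N \<le> k" for k
      proof (rule power_mono)
        have "1 / real (Suc k) \<le> 1 / real (Suc N)" using that by (simp add: frac_le)
        then show "norm (s k) \<le> d + 1 / real (Suc N)" using s_less[of k] by linarith
      qed simp
      have "(1/2 :: real) *\<^sub>R (s m + s n) \<in> S"
        using sS[of m] sS[of n] by (simp add: S_def add scaleR scaleR_conv_of_real)
      from d_le[OF this] have "2 * d \<le> norm (s m + s n)" by simp
      then have "(2 * d)\<^sup>2 \<le> (norm (s m + s n))\<^sup>2" using d0 by (intro power_mono) auto
      moreover have "(norm (s m - s n))\<^sup>2 + (norm (s m + s n))\<^sup>2
          = 2 * (norm (s m))\<^sup>2 + 2 * (norm (s n))\<^sup>2"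
        by (simp add: power2_norm_eq_inner inner_add_left inner_add_right inner_diff_left
            inner_diff_right inner_commute)
      ultimately have "(norm (s m - s n))\<^sup>2 \<le> 4 * ((d + 1 / real (Suc N))\<^sup>2 - d\<^sup>2)"
        using sq[OF mn(1)] sq[OF mn(2)] by (simp add: power_mult_distrib algebra_simps)
      then have "(norm (s m - s n))\<^sup>2 < e\<^sup>2" using N by linarith
      then show "norm (s m - s n) < e" using e by (simp add: power_less_imp_less_base)
    qed
  qed
  then obtain y where y: "s \<longlonglongrightarrow> y"
    using Cauchy_convergent_iff convergent_def by blast
  have "(\<lambda>n. \<phi> (s n)) \<longlonglongrightarrow> \<phi> y" by (rule tendsto[OF y])
  moreover have "\<phi> (s n) = 1" for n using sS[of n] by (simp add: S_def)
  ultimately have \<phi>y: "\<phi> y = 1" by (simp add: LIMSEQ_const_iff)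
  have "(\<lambda>n. d + 1 / real (Suc n)) \<longlonglongrightarrow> d + 0"
    by (intro tendsto_intros LIMSEQ_Suc[OF lim_1_over_n])
  then have "norm y \<le> d + 0"
    using s_less by (intro LIMSEQ_le[OF tendsto_norm[OF y]]) (auto intro: less_imp_le)
  then have min: "norm y \<le> norm t" if "t \<in> S" for t using d_le[OF that] by simp
  have y0: "y \<noteq> 0" using \<phi>y zero by auto
  have orth: "cinner z y = 0" if z: "\<phi> z = 0" for z
  proof (cases "z = 0")
    case nz: False
    define t where "t = cinner y z / complex_of_real ((norm z)\<^sup>2)"
    have "cinner (y - t *\<^sub>C z) (t *\<^sub>C z) = 0"
      using nz by (simp add: cinner_diff_left cinner_scaleC_left cinner_scaleC_right cinner_self
          t_def power2_eq_square)
    then have "(norm (1 *\<^sub>C (y - t *\<^sub>C z) + 1 *\<^sub>C (t *\<^sub>C z)))\<^sup>2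
        = (norm (y - t *\<^sub>C z))\<^sup>2 + (norm (t *\<^sub>C z))\<^sup>2"
      by (subst norm_add_sq_orth) auto
    moreover have "y - t *\<^sub>C z \<in> S" by (simp add: S_def diff sc z \<phi>y)
    then have "(norm y)\<^sup>2 \<le> (norm (y - t *\<^sub>C z))\<^sup>2" by (intro power_mono min) auto
    ultimately have "(norm (t *\<^sub>C z))\<^sup>2 \<le> 0" by simp
    then have "cinner y z = 0" using nz by (auto simp: norm_scaleC t_def)
    then show ?thesis using cinner_commute[of z y] by simp
  qed simp
  show ?thesis
  proof (intro exI allI)
    fix x
    have "cinner (x - \<phi> x *\<^sub>C y) y = 0" by (rule orth) (simp add: diff sc \<phi>y)
    then show "\<phi> x = cinner x (complex_of_real (1 / (norm y)\<^sup>2) *\<^sub>C y)"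
      using y0 by (simp add: cinner_diff_left cinner_scaleC_left cinner_scaleC_right cinner_self
          field_simps)
  qed
qed

lemma cinner_adj: "cinner (A *\<^sub>V x) y = cinner x (adj A *\<^sub>V y)"
proof -
  have "\<exists>w. \<forall>x. cinner (A *\<^sub>V x) y = cinner x w" for y
  proof (rule riesz_representation)
    show "bounded_linear (\<lambda>x. cinner (A *\<^sub>V x) y)"
    proof (rule bounded_linear_intro[where K = "norm A * norm y"])
      show "norm (cinner (A *\<^sub>V x) y) \<le> norm x * (norm A * norm y)" for x
        using cinner_Cauchy_Schwarz[of "A *\<^sub>V x" y]
          mult_right_mono[OF norm_cblinfun[of A x], of "norm y"]
        by (simp add: mult_ac)
    qed (simp_all add: cblinfun_add cinner_add_left scaleR_scaleC cblinfun_scaleC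
        cinner_scaleC_left scaleC_complex_def)
  qed (simp add: cblinfun_scaleC cinner_scaleC_left)
  then obtain g where g: "\<And>x y. cinner (A *\<^sub>V x) y = cinner x (g y)" by metis
  have g_add: "g (u + v) = g u + g v" for u v
    by (rule cinner_eqI) (simp add: g[symmetric] cinner_add_right)
  have g_scale: "g (c *\<^sub>C u) = c *\<^sub>C g u" for c u
    by (rule cinner_eqI) (simp add: g[symmetric] cinner_scaleC_right)
  have g_norm: "norm (g u) \<le> norm u * norm A" for u
  proof (cases "g u = 0")
    case False
    have "(norm (g u))\<^sup>2 = cmod (cinner (g u) (g u))"
      by (simp only: cinner_self norm_of_real) simp
    also have "\<dots> = cmod (cinner (A *\<^sub>V g u) u)" by (simp add: g)
    also have "\<dots> \<le> norm (A *\<^sub>V g u) * norm u" by (rule cinner_Cauchy_Schwarz)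
    also have "\<dots> \<le> norm A * norm (g u) * norm u" by (simp add: mult_right_mono norm_cblinfun)
    finally show ?thesis using False by (simp add: power2_eq_square mult_ac)
  qed simp
  have "bounded_linear g"
    by (rule bounded_linear_intro[where K = "norm A"])
      (simp_all add: g_add g_scale g_norm scaleR_scaleC)
  then have "CBlinfun g *\<^sub>V y = g y" for y
    by (simp add: CBlinfun_inverse g_scale)
  then have "adj A = CBlinfun g"
    by (intro adj_eqI) (simp add: g)
  then show ?thesis using g \<open>\<And>y. CBlinfun g *\<^sub>V y = g y\<close> by simp
qed


section \<open>Operators on the kernel of a projection\<close>

text \<open>
  Let \<open>E\<close> be an orthogonal projection with range \<open>K\<close>. The algebra of bounded operators on the
  Hilbert space \<open>K\<close> is represented by the corner \<open>E B(H) E\<close>: an operator on \<open>K\<close> is identified with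
  its extension by \<open>0\<close> on the orthogonal complement of \<open>K\<close>. This identification respects
  sums, products, adjoints, norms, positivity and positive square roots; the identity operator
  of \<open>K\<close> becomes \<open>E\<close>, so the notions involving the identity take \<open>E\<close> as an argument.
\<close>

definition corner :: "'a::chilbert_space \<Rightarrow>\<^sub>C\<^sub>L 'a \<Rightarrow> ('a \<Rightarrow>\<^sub>C\<^sub>L 'a) set"
  where "corner E = {C. E o\<^sub>C\<^sub>L C o\<^sub>C\<^sub>L E = C}"

definition corner_unitary :: "'a::chilbert_space \<Rightarrow>\<^sub>C\<^sub>L 'a \<Rightarrow> 'a \<Rightarrow>\<^sub>C\<^sub>L 'a \<Rightarrow> bool"
  where "corner_unitary E U \<longleftrightarrow> U \<in> corner E \<and> adj U o\<^sub>C\<^sub>L U = E \<and> U o\<^sub>C\<^sub>L adj U = E"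

definition corner_power :: "'a::chilbert_space \<Rightarrow>\<^sub>C\<^sub>L 'a \<Rightarrow> 'a \<Rightarrow>\<^sub>C\<^sub>L 'a \<Rightarrow> nat \<Rightarrow> 'a \<Rightarrow>\<^sub>C\<^sub>L 'a"
  where "corner_power E T n = ((o\<^sub>C\<^sub>L) T ^^ n) E"

definition corner_inverse :: "'a::chilbert_space \<Rightarrow>\<^sub>C\<^sub>L 'a \<Rightarrow> 'a \<Rightarrow>\<^sub>C\<^sub>L 'a \<Rightarrow> 'a \<Rightarrow>\<^sub>C\<^sub>L 'a"
  where "corner_inverse E S = (THE R. R \<in> corner E \<and> R o\<^sub>C\<^sub>L S = E \<and> S o\<^sub>C\<^sub>L R = E)"

text \<open>\<open>C\<^sup>*(T)\<close> for a self-adjoint \<open>T\<close>, and the cyclic subspace \<open>[C\<^sup>*(T)x]\<close>.\<close>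

definition cstar_gen :: "'a::chilbert_space \<Rightarrow>\<^sub>C\<^sub>L 'a \<Rightarrow> 'a \<Rightarrow>\<^sub>C\<^sub>L 'a \<Rightarrow> ('a \<Rightarrow>\<^sub>C\<^sub>L 'a) set"
  where "cstar_gen E T = closure {\<Sum>i\<le>n. c i *\<^sub>C corner_power E T i |(c :: nat \<Rightarrow> complex) n. True}"

definition cyclic_subspace :: "'a::chilbert_space \<Rightarrow>\<^sub>C\<^sub>L 'a \<Rightarrow> 'a \<Rightarrow>\<^sub>C\<^sub>L 'a \<Rightarrow> 'a \<Rightarrow> 'a set"
  where "cyclic_subspace E T x = closure (cspan ((\<lambda>S. S *\<^sub>V x) ` cstar_gen E T))"


section \<open>The block form\<close>

text \<open>
  \<open>B\<close> is a rank one projection and \<open>e\<close> a unit vector in its range, which is identified with the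
  complex numbers via \<open>\<alpha> \<mapsto> \<alpha>e\<close>. The matrix has rows \<open>0, a\<^sup>*\<close> and \<open>b, C\<close>, with respect to
  the decomposition of the space into the range and the kernel of \<open>B\<close>.
\<close>

abbreviation ker_id :: "'a::chilbert_space \<Rightarrow>\<^sub>C\<^sub>L 'a \<Rightarrow> 'a \<Rightarrow>\<^sub>C\<^sub>L 'a"
  where "ker_id B \<equiv> id_cblinfun - B"

definition block_form ::
    "'a::chilbert_space \<Rightarrow>\<^sub>C\<^sub>L 'a \<Rightarrow> 'a \<Rightarrow> 'a \<Rightarrow>\<^sub>C\<^sub>L 'a \<Rightarrow> 'a \<Rightarrow> 'a \<Rightarrow> 'a \<Rightarrow>\<^sub>C\<^sub>L 'a \<Rightarrow> bool"
  where "block_form B e A a b C \<longleftrightarrow>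
    a \<in> ker B \<and> b \<in> ker B \<and> C \<in> corner (ker_id B) \<and>
    (\<forall>\<alpha>. \<forall>z\<in>ker B. A *\<^sub>V (\<alpha> *\<^sub>C e + z) = cinner z a *\<^sub>C e + (\<alpha> *\<^sub>C b + C *\<^sub>V z))"

definition block_defect :: "'a::chilbert_space \<Rightarrow>\<^sub>C\<^sub>L 'a \<Rightarrow> 'a \<Rightarrow> 'a \<Rightarrow>\<^sub>C\<^sub>L 'a \<Rightarrow> 'a \<Rightarrow>\<^sub>C\<^sub>L 'a"
  where "block_defect B a C = ker_id B - self_outer a - C o\<^sub>C\<^sub>L C"

definition block_conditions ::
    "'a::chilbert_space \<Rightarrow>\<^sub>C\<^sub>L 'a \<Rightarrow> 'a \<Rightarrow> 'a \<Rightarrow> 'a \<Rightarrow>\<^sub>C\<^sub>L 'a \<Rightarrow> bool"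
  where "block_conditions B a b C \<longleftrightarrow>
    (norm a)\<^sup>2 + (norm b)\<^sup>2 = 1 \<and> positive_op C \<and>
    (let E = ker_id B; T = block_defect B a C; R = pos_sqrt T in
      \<exists>U. corner_unitary E U \<and> selfadjoint U \<and> C *\<^sub>V b = U *\<^sub>V R *\<^sub>V a \<and> U o\<^sub>C\<^sub>L T = T o\<^sub>C\<^sub>L U \<and>
        (\<forall>x \<in> cyclic_subspace E T (R *\<^sub>V a). \<forall>y \<in> cyclic_subspace E T a.
          cinner (U *\<^sub>V x) y = 0))"

end

theory Submission
  imports Defs
begin

text \<open>
  Comparing \<open>\<parallel>(\<mu>A + B)x\<parallel>\<^sup>2\<close> with \<open>(1 + |\<mu>|\<^sup>2)\<parallel>x\<parallel>\<^sup>2\<close> on \<open>x = \<alpha>e + z\<close> gives a quadratic form in \<open>(\<alpha>, z)\<close>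
  whose Schur complement vanishes exactly when \<open>\<parallel>\<mu>A + B\<parallel>\<^sup>2 = 1 + |\<mu>|\<^sup>2\<close>. For all \<open>\<mu>\<close> together this
  is the resolvent identity with constant \<open>1 - \<parallel>b\<parallel>\<^sup>2\<close>; the limit \<open>\<mu> \<rightarrow> 0\<close> yields \<open>\<parallel>a\<parallel>\<^sup>2 + \<parallel>b\<parallel>\<^sup>2 = 1\<close>, and
  averaging over the phase of \<open>\<mu>\<close> and expanding at \<open>0\<close> yields the moment conditions. Given these, the
  vectors \<open>x = T\<^sup>1\<^sup>/\<^sup>2a\<close> and \<open>y = Cb\<close> have the same moments and generate orthogonal cyclic subspaces, so the
  reflection \<open>U = I - 2P\<close>, with \<open>P\<close> the projection onto \<open>[C\<^sup>*(T)(x - y)]\<close>, exchanges them.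

  To make \<open>C\<close> positive, \<open>|C| \<mapsto> C\<close> is extended to a maximal isometry between subspaces. It is total or
  onto, so that an isometry \<open>J\<close> with \<open>C = J|C|\<close> or \<open>JC = |C|\<close> results, and \<open>\<Phi>\<close> is \<open>X \<mapsto> XJ\<^sup>*\<close> or
  \<open>X \<mapsto> JX\<close>. Transposition is not needed.
\<close>

section \<open>Bounded operators\<close>

text \<open>Functional calculus enters only through two norm-convergent iterations inside
  \<open>cstar_gen\<close>, one for the square root and one for the inverse of I + tT; all other
  facts about C*(T) are linear, closed conditions checked on powers of T. Operators on the kernel of
  B are operators on the whole space, so the unit of their algebra is the projection E, and
  commuting with E becomes a genuine condition. The inverse depends on \<mu> only through |\<mu>|^2.
  The phase of \<mu> is confined to the vector a + \<mu>Cb, which is why averaging over phases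
  separates the two families of moments. Because I + tT is invertible for t > 0, the norm of \<mu>A
  + B is attained when the Schur complement vanishes, although a norm in infinite dimension need not
  be. The obstacle to a positive C is that the polar decomposition gives only a partial isometry,
  and multiplication by a proper partial isometry does not preserve operator norms. It may have no
  isometric extension at all; then its adjoint has one. Working with graphs treats both cases alike
  and avoids comparing dimensions of complements.\<close>

lemmas cblinfun_apply_simps =
  plus_cblinfun.rep_eq minus_cblinfun.rep_eq uminus_cblinfun.rep_eq zero_cblinfun.rep_eq
  scaleC_cblinfun.rep_eq id_cblinfun.rep_eq cblinfun_compose.rep_eq self_outer.rep_eq

declare cblinfun_apply_simps [simp]

lemma cblinfun_zero_right [simp]: "A *\<^sub>V 0 = 0"
  using cblinfun_diff[of A 0 0] by simp

lemma cblinfun_compose_assoc: "(A o\<^sub>C\<^sub>L A') o\<^sub>C\<^sub>L A'' = A o\<^sub>C\<^sub>L (A' o\<^sub>C\<^sub>L A'')"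
  by (rule cblinfun_eqI) simp

lemma norm_cblinfun_le:
  assumes "0 \<le> k" and "\<And>x. norm (A *\<^sub>V x) \<le> k * norm x"
  shows "norm A \<le> k"
  using assms by transfer (rule onorm_bound)

lemma norm_cblinfun_compose: "norm (A o\<^sub>C\<^sub>L A') \<le> norm A * norm A'"
proof (rule norm_cblinfun_le)
  fix x
  have "norm (A *\<^sub>V A' *\<^sub>V x) \<le> norm A * (norm A' * norm x)"
    by (rule order_trans[OF norm_cblinfun]) (simp add: mult_left_mono norm_cblinfun)
  then show "norm ((A o\<^sub>C\<^sub>L A') *\<^sub>V x) \<le> norm A * norm A' * norm x"
    by (simp add: mult.assoc)
qed simp

lemma bounded_bilinear_cblinfun_apply: "bounded_bilinear (\<lambda>A x. A *\<^sub>V x)"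
proof
  show "\<exists>K. \<forall>(a::'a \<Rightarrow>\<^sub>C\<^sub>L 'b) b. norm (a *\<^sub>V b) \<le> norm a * norm b * K"
    by (rule exI[of _ 1]) (simp add: norm_cblinfun)
qed (simp_all add: cblinfun_add scaleR_scaleC cblinfun_scaleC)

lemma bounded_bilinear_cblinfun_compose:
  "bounded_bilinear (\<lambda>(A :: 'b::complex_normed_vector \<Rightarrow>\<^sub>C\<^sub>L 'c::complex_normed_vector)
     (A' :: 'a::complex_normed_vector \<Rightarrow>\<^sub>C\<^sub>L 'b). A o\<^sub>C\<^sub>L A')"
proof
  show "\<exists>K. \<forall>(a :: 'b \<Rightarrow>\<^sub>C\<^sub>L 'c) (b :: 'a \<Rightarrow>\<^sub>C\<^sub>L 'b). norm (a o\<^sub>C\<^sub>L b) \<le> norm a * norm b * K"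
    by (rule exI[of _ 1]) (simp add: norm_cblinfun_compose)
qed (rule cblinfun_eqI; simp add: cblinfun_add scaleR_scaleC cblinfun_scaleC)+

lemma bounded_bilinear_cinner: "bounded_bilinear (\<lambda>(x :: 'a::chilbert_space) y. cinner x y)"
proof
  show "\<exists>K. \<forall>(a :: 'a) b. norm (cinner a b) \<le> norm a * norm b * K"
    by (rule exI[of _ 1]) (simp add: cinner_Cauchy_Schwarz)
qed (simp_all add: cinner_add_left cinner_add_right scaleR_scaleC cinner_scaleC_left
    cinner_scaleC_right scaleC_complex_def)

lemmas tendsto_cblinfun_apply [tendsto_intros] =
  bounded_bilinear.tendsto[OF bounded_bilinear_cblinfun_apply]
lemmas tendsto_cblinfun_compose [tendsto_intros] =
  bounded_bilinear.tendsto[OF bounded_bilinear_cblinfun_compose]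
lemmas tendsto_cinner [tendsto_intros] =
  bounded_bilinear.tendsto[OF bounded_bilinear_cinner]
lemmas tendsto_scaleC [tendsto_intros] = bounded_linear.tendsto[OF bounded_linear_scaleC]

lemmas continuous_on_cblinfun_apply [continuous_intros] =
  bounded_bilinear.continuous_on[OF bounded_bilinear_cblinfun_apply]
lemmas continuous_on_cblinfun_compose [continuous_intros] =
  bounded_bilinear.continuous_on[OF bounded_bilinear_cblinfun_compose]
lemmas continuous_on_cinner [continuous_intros] =
  bounded_bilinear.continuous_on[OF bounded_bilinear_cinner]
lemmas continuous_on_scaleC [continuous_intros] =
  bounded_linear.continuous_on[OF bounded_linear_scaleC]

\<comment> \<open>Completeness of the operator space and convergence by majorants\<close>
subclass (in chilbert_space) banach ..

text \<open>Pointwise limits give the candidate; letting one index of the Cauchy estimate tend to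
  infinity upgrades pointwise convergence to convergence in norm.\<close>

instance cblinfun :: (complex_normed_vector, chilbert_space) banach
proof
  fix X :: "nat \<Rightarrow> 'a \<Rightarrow>\<^sub>C\<^sub>L 'b"
  assume X: "Cauchy X"
  have "Cauchy (\<lambda>n. X n *\<^sub>V x)" for x
    by (rule bounded_linear.Cauchy[OF
          bounded_bilinear.bounded_linear_left[OF bounded_bilinear_cblinfun_apply] X])
  then have "\<exists>y. (\<lambda>n. X n *\<^sub>V x) \<longlonglongrightarrow> y" for x
    using Cauchy_convergent_iff convergent_def by blast
  then obtain g where g: "\<And>x. (\<lambda>n. X n *\<^sub>V x) \<longlonglongrightarrow> g x" by metis
  obtain K where K: "\<And>n. norm (X n) \<le> K"
    using Cauchy_Bseq[OF X] by (auto simp: Bseq_def)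
  have g_add: "g (x + y) = g x + g y" for x y
    by (rule LIMSEQ_unique[OF g]) (simp add: cblinfun_add tendsto_add g)
  have g_scale: "g (c *\<^sub>C x) = c *\<^sub>C g x" for c x
    by (rule LIMSEQ_unique[OF g]) (simp add: cblinfun_scaleC tendsto_scaleC g)
  have g_norm: "norm (g x) \<le> norm x * K" for x
  proof (rule LIMSEQ_le_const2[OF tendsto_norm[OF g]])
    have "norm (X n *\<^sub>V x) \<le> norm x * K" for n
      using norm_cblinfun[of "X n" x] mult_right_mono[OF K[of n], of "norm x"]
      by (simp add: mult.commute)
    then show "\<exists>N. \<forall>n\<ge>N. norm (X n *\<^sub>V x) \<le> norm x * K" by blast
  qed
  have "bounded_linear g"
    by (rule bounded_linear_intro[where K = K]) (simp_all add: g_add g_scale g_norm scaleR_scaleC)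
  then have G: "CBlinfun g *\<^sub>V x = g x" for x
    by (simp add: CBlinfun_inverse g_scale)
  have "X \<longlonglongrightarrow> CBlinfun g"
  proof (rule LIMSEQ_I)
    fix r :: real assume r: "0 < r"
    then obtain N where N: "\<And>m n. m \<ge> N \<Longrightarrow> n \<ge> N \<Longrightarrow> norm (X m - X n) < r / 2"
      using CauchyD[OF X, of "r / 2"] by auto
    have "norm (X n - CBlinfun g) < r" if n: "n \<ge> N" for n
    proof -
      have "norm (X n - CBlinfun g) \<le> r / 2"
      proof (rule norm_cblinfun_le)
        fix x
        have "(\<lambda>m. norm (X n *\<^sub>V x - X m *\<^sub>V x)) \<longlonglongrightarrow> norm (X n *\<^sub>V x - g x)"
          by (intro tendsto_intros g)
        moreover have "norm (X n *\<^sub>V x - X m *\<^sub>V x) \<le> r / 2 * norm x" if "m \<ge> N" for m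
          using norm_cblinfun[of "X n - X m" x]
            mult_right_mono[OF less_imp_le[OF N[OF n that]], of "norm x"] by simp
        ultimately have "norm (X n *\<^sub>V x - g x) \<le> r / 2 * norm x"
          by (intro LIMSEQ_le_const2) auto
        then show "norm ((X n - CBlinfun g) *\<^sub>V x) \<le> r / 2 * norm x" by (simp add: G)
      qed (use r in simp)
      then show ?thesis using r by simp
    qed
    then show "\<exists>no. \<forall>n\<ge>no. norm (X n - CBlinfun g) < r" by blast
  qed
  then show "convergent X" by (rule convergentI)
qed

text \<open>Method of majorants: the scalar increments telescope to a convergent series that
  dominates the series of vector increments. Both operator iterations below converge by
  this.\<close>

lemma convergent_if_increments_bounded:
  fixes X :: "nat \<Rightarrow> 'a::banach" and x :: "nat \<Rightarrow> real"
  assumes "convergent x" and "\<And>n. norm (X (Suc n) - X n) \<le> x (Suc n) - x n"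
  shows "convergent X"
proof -
  obtain l where "x \<longlonglongrightarrow> l" using assms(1) by (auto simp: convergent_def)
  then have "summable (\<lambda>n. x (Suc n) - x n)" by (rule telescope_summable)
  then have "summable (\<lambda>n. X (Suc n) - X n)"
    by (rule summable_comparison_test') (rule assms(2))
  then have "convergent (\<lambda>n. \<Sum>k<n. X (Suc k) - X k)" by (simp add: summable_iff_convergent)
  then have "convergent (\<lambda>n. X n - X 0)" by (simp add: sum_lessThan_telescope)
  then show ?thesis by (simp add: convergent_diff_const_right_iff)
qed

subsection \<open>Adjoints and positive operators\<close>

lemma selfadjoint_iff: "selfadjoint A \<longleftrightarrow> (\<forall>x y. cinner (A *\<^sub>V x) y = cinner x (A *\<^sub>V y))"
  unfolding selfadjoint_def by (metis adj_eqI cinner_adj)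

lemma selfadjointD: "selfadjoint A \<Longrightarrow> cinner (A *\<^sub>V x) y = cinner x (A *\<^sub>V y)"
  by (simp add: selfadjoint_iff)

lemma positive_op_iff:
  "positive_op A \<longleftrightarrow> (\<forall>x. Im (cinner (A *\<^sub>V x) x) = 0 \<and> 0 \<le> Re (cinner (A *\<^sub>V x) x))"
  by (auto simp: positive_op_def complex_nonneg_Reals_iff)

text \<open>Polarisation: the vector x + y compares the imaginary parts of
  \<open>cinner (A *\<^sub>V x) y\<close> and \<open>cinner (A *\<^sub>V y) x\<close>, and x + iy
  compares their real parts.\<close>

lemma selfadjoint_if_numerical_range_real:
  fixes A :: "'a::chilbert_space \<Rightarrow>\<^sub>C\<^sub>L 'a"
  assumes "\<And>x. Im (cinner (A *\<^sub>V x) x) = 0"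
  shows "selfadjoint A"
  unfolding selfadjoint_iff
proof (intro allI)
  fix x y
  have 1: "Im (cinner (A *\<^sub>V (x + y)) (x + y)) = 0"
    "Im (cinner (A *\<^sub>V (x + \<i> *\<^sub>C y)) (x + \<i> *\<^sub>C y)) = 0" by (rule assms)+
  have "Im (cinner (A *\<^sub>V x) y) = - Im (cinner (A *\<^sub>V y) x)"
    "Re (cinner (A *\<^sub>V x) y) = Re (cinner (A *\<^sub>V y) x)"
    using 1 assms[of x] assms[of y]
    by (simp_all add: cblinfun_add cblinfun_scaleC cinner_add_left cinner_add_right
        cinner_scaleC_left cinner_scaleC_right algebra_simps)
  then have "cinner (A *\<^sub>V x) y = cnj (cinner (A *\<^sub>V y) x)" by (simp add: complex_eq_iff)
  then show "cinner (A *\<^sub>V x) y = cinner x (A *\<^sub>V y)" by (metis cinner_commute)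
qed

lemma selfadjoint_if_positive_op: "positive_op A \<Longrightarrow> selfadjoint A"
  by (simp add: positive_op_iff selfadjoint_if_numerical_range_real)

lemma Im_cinner_selfadjoint: "selfadjoint A \<Longrightarrow> Im (cinner (A *\<^sub>V x) x) = 0"
  using cinner_commute[of "A *\<^sub>V x" x] selfadjointD[of A x x]
  by (metis cnj.simps(2) equal_neg_zero)

lemma positive_opI:
  "selfadjoint A \<Longrightarrow> (\<And>x. 0 \<le> Re (cinner (A *\<^sub>V x) x)) \<Longrightarrow> positive_op A"
  by (simp add: positive_op_iff Im_cinner_selfadjoint)

lemma cinner_positive_op:
  "positive_op A \<Longrightarrow> cinner (A *\<^sub>V x) x = complex_of_real (Re (cinner (A *\<^sub>V x) x))"
  by (simp add: positive_op_iff complex_eq_iff)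

lemma norm_add_sq: "(norm (x + y :: 'a::chilbert_space))\<^sup>2
    = (norm x)\<^sup>2 + 2 * Re (cinner x y) + (norm y)\<^sup>2"
  by (simp add: power2_norm_eq_inner inner_add_left inner_add_right inner_commute
      inner_eq_Re_cinner[symmetric])

text \<open>Restricting to real multiples r of c leaves a real quadratic in r. For p > 0 its minimum
  lies at r = 1/p; for p = 0 it is affine and would become negative unless c = 0.\<close>

lemma hermitian_form_discriminant:
  fixes c :: complex and p s :: real
  assumes "0 \<le> p" and nonneg: "\<And>z :: complex. 0 \<le> p * (cmod z)\<^sup>2 - 2 * Re (cnj z * c) + s"
  shows "(cmod c)\<^sup>2 \<le> p * s"
proof -
  have *: "0 \<le> p * r\<^sup>2 * (cmod c)\<^sup>2 - 2 * r * (cmod c)\<^sup>2 + s" for r :: real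
  proof -
    have "Re (cnj (complex_of_real r * c) * c) = r * (cmod c)\<^sup>2"
      unfolding cmod_power2 by (simp add: algebra_simps power2_eq_square)
    then show ?thesis
      using nonneg[of "complex_of_real r * c"] by (simp add: norm_mult power_mult_distrib)
  qed
  show ?thesis
  proof (cases "p = 0")
    case True
    have "(cmod c)\<^sup>2 = 0"
    proof (rule ccontr)
      assume "(cmod c)\<^sup>2 \<noteq> 0"
      \<comment> \<open>This r is chosen so that the affine function takes the value -1.\<close>
      then have "0 \<le> - 2 * (s + 1) / 2 + s"
        using *[of "(s + 1) / (2 * (cmod c)\<^sup>2)"] True by (simp add: field_simps)
      then show False by (simp add: field_simps)
    qed
    then show ?thesis using True by simp
  next
    case False
    have "0 \<le> p * (1/p)\<^sup>2 * (cmod c)\<^sup>2 - 2 * (1/p) * (cmod c)\<^sup>2 + s" by (rule *)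
    also have "\<dots> = s - (cmod c)\<^sup>2 / p" using False by (simp add: field_simps power2_eq_square)
    finally show ?thesis using False assms(1) by (simp add: field_simps)
  qed
qed

text \<open>The form of A is a semi-inner product; the discriminant bound is applied to its value at
  x - zy.\<close>

lemma positive_op_Cauchy_Schwarz:
  assumes A: "positive_op A"
  shows "(cmod (cinner (A *\<^sub>V x) y))\<^sup>2 \<le> Re (cinner (A *\<^sub>V x) x) * Re (cinner (A *\<^sub>V y) y)"
proof -
  have sa: "selfadjoint A" by (rule selfadjoint_if_positive_op[OF A])
  have "0 \<le> Re (cinner (A *\<^sub>V y) y) * (cmod z)\<^sup>2 - 2 * Re (cnj z * cinner (A *\<^sub>V x) y)
      + Re (cinner (A *\<^sub>V x) x)" for z
  proof -
    have "0 \<le> Re (cinner (A *\<^sub>V (x - z *\<^sub>C y)) (x - z *\<^sub>C y))"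
      using A by (simp add: positive_op_iff)
    moreover have "cinner (A *\<^sub>V y) x = cnj (cinner (A *\<^sub>V x) y)"
      by (metis cinner_commute sa selfadjointD)
    moreover have "Im (cinner (A *\<^sub>V y) y) = 0" using A by (simp add: positive_op_iff)
    ultimately show ?thesis
      by (simp add: cblinfun_diff cblinfun_scaleC cinner_diff_left cinner_diff_right
          cinner_scaleC_left cinner_scaleC_right cmod_power2)
        (simp add: algebra_simps power2_eq_square)
  qed
  from hermitian_form_discriminant[OF _ this] A show ?thesis
    by (simp add: positive_op_iff mult.commute)
qed

text \<open>Cauchy-Schwarz for the form of A at the pair x, Ax bounds the fourth power of the norm
  of Ax by a product of two values of the form. So a bound on the form is already a bound on the
  norm.\<close>

lemma norm_positive_op_le:
  assumes A: "positive_op A" and le: "\<And>x. Re (cinner (A *\<^sub>V x) x) \<le> q * (norm x)\<^sup>2" and q: "0 \<le> q"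
  shows "norm A \<le> q"
proof (rule norm_cblinfun_le[OF q])
  fix x
  have "((norm (A *\<^sub>V x))\<^sup>2)\<^sup>2 = (cmod (cinner (A *\<^sub>V x) (A *\<^sub>V x)))\<^sup>2"
    by (simp only: cinner_self norm_of_real) simp
  also have "\<dots> \<le> Re (cinner (A *\<^sub>V x) x) * Re (cinner (A *\<^sub>V A *\<^sub>V x) (A *\<^sub>V x))"
    by (rule positive_op_Cauchy_Schwarz[OF A])
  also have "\<dots> \<le> (q * (norm x)\<^sup>2) * (q * (norm (A *\<^sub>V x))\<^sup>2)"
    using A q by (intro mult_mono le) (auto simp: positive_op_iff)
  finally have "(norm (A *\<^sub>V x))\<^sup>2 * (norm (A *\<^sub>V x))\<^sup>2 \<le> (q * norm x)\<^sup>2 * (norm (A *\<^sub>V x))\<^sup>2"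
    by (simp add: power2_eq_square mult_ac)
  then have "A *\<^sub>V x = 0 \<or> (norm (A *\<^sub>V x))\<^sup>2 \<le> (q * norm x)\<^sup>2"
    unfolding mult_le_cancel_right by (metis norm_eq_zero not_less zero_less_power2)
  then show "norm (A *\<^sub>V x) \<le> q * norm x"
    using q by (auto intro: power2_le_imp_le)
qed

lemma positive_op_eq_0:
  assumes "positive_op A" and "Re (cinner (A *\<^sub>V x) x) = 0"
  shows "A *\<^sub>V x = 0"
  using positive_op_Cauchy_Schwarz[OF assms(1), of x "A *\<^sub>V x"] assms(2)
  by (simp add: cinner_self)

subsection \<open>The algebra generated by an operator on a corner\<close>

lemma cblinfun_compose_linear:
  "A o\<^sub>C\<^sub>L (X + Y) = A o\<^sub>C\<^sub>L X + A o\<^sub>C\<^sub>L Y" "(X + Y) o\<^sub>C\<^sub>L A' = X o\<^sub>C\<^sub>L A' + Y o\<^sub>C\<^sub>L A'"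
  "A o\<^sub>C\<^sub>L (X - Y) = A o\<^sub>C\<^sub>L X - A o\<^sub>C\<^sub>L Y" "(X - Y) o\<^sub>C\<^sub>L A' = X o\<^sub>C\<^sub>L A' - Y o\<^sub>C\<^sub>L A'"
  "A o\<^sub>C\<^sub>L (c *\<^sub>C X) = c *\<^sub>C (A o\<^sub>C\<^sub>L X)" "(c *\<^sub>C X) o\<^sub>C\<^sub>L A' = c *\<^sub>C (X o\<^sub>C\<^sub>L A')"
  "A o\<^sub>C\<^sub>L 0 = 0" "0 o\<^sub>C\<^sub>L A' = 0"
  by (rule cblinfun_eqI; simp add: cblinfun_add cblinfun_diff cblinfun_scaleC)+

lemma closure_subspace:
  assumes "complex_vector.subspace V"
  shows "complex_vector.subspace (closure V)"
proof (rule complex_vector.subspaceI)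
  show "0 \<in> closure V"
    using closure_subset complex_vector.subspace_0[OF assms] by blast
next
  fix x y assume "x \<in> closure V" "y \<in> closure V"
  then obtain f g where "\<And>n. f n \<in> V" "f \<longlonglongrightarrow> x" "\<And>n. g n \<in> V" "g \<longlonglongrightarrow> y"
    unfolding closure_sequential by blast
  then have "(\<lambda>n. f n + g n) \<longlonglongrightarrow> x + y" "\<And>n. f n + g n \<in> V"
    by (auto intro!: tendsto_intros complex_vector.subspace_add[OF assms])
  then show "x + y \<in> closure V" unfolding closure_sequential by (intro exI conjI allI)
next
  fix c x assume "x \<in> closure V"
  then obtain f where "\<And>n. f n \<in> V" "f \<longlonglongrightarrow> x" unfolding closure_sequential by blast
  then have "(\<lambda>n. c *\<^sub>C f n) \<longlonglongrightarrow> c *\<^sub>C x" "\<And>n. c *\<^sub>C f n \<in> V"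
    by (auto intro!: tendsto_intros complex_vector.subspace_scale[OF assms])
  then show "c *\<^sub>C x \<in> closure V" unfolding closure_sequential by (intro exI conjI allI)
qed

section \<open>Projections, corners and the closed algebra generated in a corner\<close>

lemma orth_projectionD:
  assumes "orth_projection E"
  shows "E o\<^sub>C\<^sub>L E = E" and "selfadjoint E" and "E *\<^sub>V E *\<^sub>V x = E *\<^sub>V x"
  using assms unfolding orth_projection_def by (blast, blast, metis cblinfun_compose.rep_eq)

lemma cinner_orth_projection:
  "orth_projection E \<Longrightarrow> cinner (E *\<^sub>V x) x = complex_of_real ((norm (E *\<^sub>V x))\<^sup>2)"
  by (metis cinner_self orth_projectionD(2,3) selfadjointD)

lemma norm_orth_projection_le:
  assumes "orth_projection E" shows "norm (E *\<^sub>V x) \<le> norm x"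
proof -
  have "(norm (E *\<^sub>V x))\<^sup>2 = cmod (cinner (E *\<^sub>V x) x)"
    by (simp only: cinner_orth_projection[OF assms] norm_of_real) simp
  also have "\<dots> \<le> norm (E *\<^sub>V x) * norm x" by (rule cinner_Cauchy_Schwarz)
  finally show ?thesis
    unfolding power2_eq_square by (metis mult_le_cancel_left_pos norm_ge_zero order_le_less)
qed

lemma cornerD:
  assumes "orth_projection E" and "T \<in> corner E"
  shows "E o\<^sub>C\<^sub>L T = T" and "T o\<^sub>C\<^sub>L E = T" and "E *\<^sub>V T *\<^sub>V x = T *\<^sub>V x" and "T *\<^sub>V E *\<^sub>V x = T *\<^sub>V x"
proof -
  have T: "E o\<^sub>C\<^sub>L T o\<^sub>C\<^sub>L E = T" using assms(2) by (simp add: corner_def)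
  have EE: "E o\<^sub>C\<^sub>L E = E" by (rule orth_projectionD[OF assms(1)])
  show 1: "E o\<^sub>C\<^sub>L T = T" using T EE by (metis cblinfun_compose_assoc)
  show 2: "T o\<^sub>C\<^sub>L E = T" using T EE by (metis cblinfun_compose_assoc)
  show "E *\<^sub>V T *\<^sub>V x = T *\<^sub>V x" "T *\<^sub>V E *\<^sub>V x = T *\<^sub>V x"
    using 1 2 by (metis cblinfun_compose.rep_eq)+
qed

lemma cornerI:
  assumes "E o\<^sub>C\<^sub>L T = T" and "T o\<^sub>C\<^sub>L E = T" shows "T \<in> corner E"
  using assms by (simp add: corner_def)

lemma corner_power_0 [simp]: "corner_power E T 0 = E"
  and corner_power_Suc [simp]: "corner_power E T (Suc n) = T o\<^sub>C\<^sub>L corner_power E T n"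
  by (simp_all add: corner_power_def)

context
  fixes E T :: "'a::chilbert_space \<Rightarrow>\<^sub>C\<^sub>L 'a"
  assumes E: "orth_projection E" and T: "T \<in> corner E"
begin

lemma corner_power_corner: "E o\<^sub>C\<^sub>L corner_power E T n = corner_power E T n"
    "corner_power E T n o\<^sub>C\<^sub>L E = corner_power E T n"
proof (induction n)
  case (Suc n)
  { case 1 show ?case by (simp add: cblinfun_compose_assoc[symmetric] cornerD[OF E T]) }
  { case 2 show ?case by (simp add: cblinfun_compose_assoc Suc) }
qed (simp_all add: orth_projectionD[OF E])

lemma corner_power_add:
  "corner_power E T m o\<^sub>C\<^sub>L corner_power E T n = corner_power E T (m + n)"
  by (induction m) (simp_all add: cblinfun_compose_assoc corner_power_corner)

lemma corner_power_1: "corner_power E T (Suc 0) = T"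
  by (simp add: cornerD[OF E T])

lemma corner_power_selfadjoint:
  assumes sa: "selfadjoint T" shows "selfadjoint (corner_power E T n)"
proof (induction n)
  case (Suc n)
  have "T o\<^sub>C\<^sub>L corner_power E T n = corner_power E T n o\<^sub>C\<^sub>L T"
    using corner_power_add[of "Suc 0" n] corner_power_add[of n "Suc 0"]
    unfolding corner_power_1 by simp
  then have "T *\<^sub>V corner_power E T n *\<^sub>V x = corner_power E T n *\<^sub>V T *\<^sub>V x" for x
    by (metis cblinfun_compose.rep_eq)
  then show ?case using Suc sa by (simp add: selfadjoint_iff)
qed (simp add: orth_projectionD[OF E])

text \<open>As the closure of a span the algebra is visibly a closed subspace, which the explicit
  polynomials of the definition hide.\<close>

lemma cstar_gen_eq: "cstar_gen E T = closure (cspan (range (corner_power E T)))"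
proof -
  let ?P = "{\<Sum>i\<le>n. c i *\<^sub>C corner_power E T i |(c :: nat \<Rightarrow> complex) n. True}"
  have "p \<in> ?P" if "p \<in> cspan (range (corner_power E T))" for p
    using that
  proof (induction rule: complex_vector.span_induct_alt)
    case base
    then show ?case by (auto intro!: exI[of _ "\<lambda>_. 0"])
  next
    case (step c x y)
    from step obtain k where x: "x = corner_power E T k" by blast
    from step obtain d :: "nat \<Rightarrow> complex" and n where
      y: "y = (\<Sum>i\<le>n. d i *\<^sub>C corner_power E T i)" by blast
    let ?m = "max n k"
    \<comment> \<open>Both summands are padded with zero coefficients to the common degree
      \<open>max n k\<close>.\<close>
    have "y = (\<Sum>i\<le>?m. (if i \<le> n then d i else 0) *\<^sub>C corner_power E T i)"
      unfolding y by (rule sum.mono_neutral_cong_left) auto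
    moreover have "c *\<^sub>C x = (\<Sum>i\<le>?m. (if i = k then c else 0) *\<^sub>C corner_power E T i)"
      unfolding x using sum.delta[of "{..?m}" k "\<lambda>i. c *\<^sub>C corner_power E T i"]
      by (auto simp: if_distrib[of "\<lambda>a. a *\<^sub>C _"] cong: if_cong)
    ultimately have "c *\<^sub>C x + y
        = (\<Sum>i\<le>?m. ((if i = k then c else 0) + (if i \<le> n then d i else 0)) *\<^sub>C corner_power E T i)"
      by (simp add: scaleC_add_left sum.distrib)
    then show ?case by (intro CollectI exI conjI TrueI)
  qed
  moreover have "?P \<subseteq> cspan (range (corner_power E T))"
    by (clarify, intro complex_vector.span_sum complex_vector.span_scale complex_vector.span_base rangeI)
  ultimately have "?P = cspan (range (corner_power E T))" by blast
  then show ?thesis by (simp add: cstar_gen_def)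
qed

lemma cstar_gen_closed: "closed (cstar_gen E T)"
  by (simp add: cstar_gen_def)

lemma cstar_gen_subspace: "complex_vector.subspace (cstar_gen E T)"
  unfolding cstar_gen_eq by (intro closure_subspace complex_vector.subspace_span)

lemmas cstar_gen_add = complex_vector.subspace_add[OF cstar_gen_subspace]
  and cstar_gen_diff = complex_vector.subspace_diff[OF cstar_gen_subspace]
  and cstar_gen_scale = complex_vector.subspace_scale[OF cstar_gen_subspace]
  and cstar_gen_zero = complex_vector.subspace_0[OF cstar_gen_subspace]

lemma corner_power_in_cstar_gen: "corner_power E T n \<in> cstar_gen E T"
  unfolding cstar_gen_eq
  by (rule subsetD[OF closure_subset]) (auto intro: complex_vector.span_base)

lemma id_in_cstar_gen: "E \<in> cstar_gen E T"
  using corner_power_in_cstar_gen[of 0] by simp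

lemma generator_in_cstar_gen: "T \<in> cstar_gen E T"
  using corner_power_in_cstar_gen[of "Suc 0"] unfolding corner_power_1 .

text \<open>Acts as the induction rule for the algebra: V is taken to be the set of operators with
  the desired property, and only powers of T remain to be checked.\<close>

lemma cstar_gen_subset:
  assumes "complex_vector.subspace V" and "closed V" and "\<And>n. corner_power E T n \<in> V"
  shows "cstar_gen E T \<subseteq> V"
  unfolding cstar_gen_eq
  by (intro closure_minimal complex_vector.span_minimal) (use assms in auto)

text \<open>Two inductions: first the left factor varies against a fixed power, then the right
  factor varies against a fixed element of the algebra.\<close>

lemma cstar_gen_compose:
  assumes X: "X \<in> cstar_gen E T" and Y: "Y \<in> cstar_gen E T"
  shows "X o\<^sub>C\<^sub>L Y \<in> cstar_gen E T"
proof -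
  have closed: "closed {X. f X \<in> cstar_gen E T}"
    if "continuous_on UNIV f" for f :: "('a \<Rightarrow>\<^sub>C\<^sub>L 'a) \<Rightarrow> ('a \<Rightarrow>\<^sub>C\<^sub>L 'a)"
    using closed_vimage[OF cstar_gen_closed that] by (simp add: vimage_def)
  have 1: "cstar_gen E T \<subseteq> {X. X o\<^sub>C\<^sub>L corner_power E T n \<in> cstar_gen E T}" for n
    by (intro cstar_gen_subset complex_vector.subspaceI closed continuous_intros)
      (auto simp: cblinfun_compose_linear corner_power_add corner_power_in_cstar_gen
        intro: cstar_gen_add cstar_gen_scale cstar_gen_zero)
  have "cstar_gen E T \<subseteq> {Y. X o\<^sub>C\<^sub>L Y \<in> cstar_gen E T}"
    using 1 X by (intro cstar_gen_subset complex_vector.subspaceI closed continuous_intros)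
      (auto simp: cblinfun_compose_linear intro: cstar_gen_add cstar_gen_scale cstar_gen_zero)
  then show ?thesis using Y by blast
qed

text \<open>Commuting with E is a separate hypothesis because the zeroth power is E and not the
  identity of the whole space.\<close>

lemma cstar_gen_commute:
  assumes X: "X \<in> cstar_gen E T" and Y: "Y o\<^sub>C\<^sub>L T = T o\<^sub>C\<^sub>L Y" "Y o\<^sub>C\<^sub>L E = E o\<^sub>C\<^sub>L Y"
  shows "Y o\<^sub>C\<^sub>L X = X o\<^sub>C\<^sub>L Y"
proof -
  have "Y o\<^sub>C\<^sub>L corner_power E T n = corner_power E T n o\<^sub>C\<^sub>L Y" for n
    by (induction n) (simp_all add: Y cblinfun_compose_assoc[symmetric], simp add: cblinfun_compose_assoc)
  then have "cstar_gen E T \<subseteq> {X. Y o\<^sub>C\<^sub>L X = X o\<^sub>C\<^sub>L Y}"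
    by (intro cstar_gen_subset complex_vector.subspaceI closed_Collect_eq continuous_intros)
      (auto simp: cblinfun_compose_linear)
  then show ?thesis using X by blast
qed

lemma cstar_gen_corner: "X \<in> cstar_gen E T \<Longrightarrow> X \<in> corner E"
proof -
  assume X: "X \<in> cstar_gen E T"
  have "cstar_gen E T \<subseteq> {X. E o\<^sub>C\<^sub>L X o\<^sub>C\<^sub>L E = X}"
    by (intro cstar_gen_subset complex_vector.subspaceI closed_Collect_eq continuous_intros)
      (auto simp: cblinfun_compose_linear corner_power_corner)
  then show ?thesis using X by (auto simp: corner_def)
qed

subsection \<open>Positive square roots and inverses\<close>

text \<open>The bound is by the norm of Ex rather than of x, so that multiples of E minus multiples
  of T can be positive although E is not the identity.\<close>

lemma cinner_positive_corner_le:
  assumes "positive_op T"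
  shows "Re (cinner (T *\<^sub>V x) x) \<le> norm T * (norm (E *\<^sub>V x))\<^sup>2"
proof -
  have "cinner (T *\<^sub>V x) x = cinner (T *\<^sub>V E *\<^sub>V x) (E *\<^sub>V x)"
    by (metis cornerD(3,4)[OF E T] selfadjointD[OF orth_projectionD(2)[OF E]])
  then have "Re (cinner (T *\<^sub>V x) x) \<le> cmod (cinner (T *\<^sub>V E *\<^sub>V x) (E *\<^sub>V x))"
    by (simp add: complex_Re_le_cmod)
  also have "\<dots> \<le> norm (T *\<^sub>V E *\<^sub>V x) * norm (E *\<^sub>V x)" by (rule cinner_Cauchy_Schwarz)
  also have "\<dots> \<le> norm T * norm (E *\<^sub>V x) * norm (E *\<^sub>V x)"
    by (intro mult_right_mono norm_cblinfun) simp
  finally show ?thesis by (simp add: power2_eq_square mult.assoc)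
qed

text \<open>With \<open>S = E - T/c\<close> the square root is \<open>\<surd>c (E - L)\<close>, where \<open>L\<close> is the limit of
  \<open>X\<^sub>n\<^sub>+\<^sub>1 = (S + X\<^sub>n\<^sup>2)/2\<close>; the increments of \<open>X\<close> are majorised by those of the scalar iteration
  \<open>x\<^sub>n\<^sub>+\<^sub>1 = (1 + x\<^sub>n\<^sup>2)/2\<close>, which increases to \<open>1\<close>.\<close>

lemma ex_positive_sqrt:
  assumes pos: "positive_op T"
  shows "\<exists>R\<in>cstar_gen E T. positive_op R \<and> R o\<^sub>C\<^sub>L R = T"
proof -
  \<comment> \<open>Any positive c not below the norm of T makes S lie between 0 and the identity;
    the added 1 covers T = 0.\<close>
  define c where "c = norm T + 1"
  have c: "0 < c" by (simp add: c_def add_nonneg_pos)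
  define S where "S = E - complex_of_real (1/c) *\<^sub>C T"
  have S: "S \<in> cstar_gen E T"
    unfolding S_def by (intro cstar_gen_diff cstar_gen_scale id_in_cstar_gen generator_in_cstar_gen)
  have saE: "selfadjoint E" by (rule orth_projectionD[OF E])
  have saS: "selfadjoint S"
    using saE selfadjoint_if_positive_op[OF pos] unfolding selfadjoint_iff
    by (simp add: S_def cinner_diff_left cinner_diff_right cinner_scaleC_left cinner_scaleC_right)
  have S_form: "Re (cinner (S *\<^sub>V x) x) = (norm (E *\<^sub>V x))\<^sup>2 - Re (cinner (T *\<^sub>V x) x) / c" for x
    by (simp add: S_def cinner_diff_left cinner_scaleC_left cinner_orth_projection[OF E])
  have T_le: "Re (cinner (T *\<^sub>V x) x) / c \<le> (norm (E *\<^sub>V x))\<^sup>2" for x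
  proof -
    have "Re (cinner (T *\<^sub>V x) x) \<le> c * (norm (E *\<^sub>V x))\<^sup>2"
      using cinner_positive_corner_le[OF pos, of x] by (simp add: c_def distrib_right add_increasing2)
    then show ?thesis using c by (simp add: field_simps)
  qed
  have "positive_op S"
    by (rule positive_opI[OF saS]) (use T_le in \<open>simp add: S_form\<close>)
  moreover have "Re (cinner (S *\<^sub>V x) x) \<le> 1 * (norm x)\<^sup>2" for x
  proof -
    have "0 \<le> Re (cinner (T *\<^sub>V x) x) / c" using pos c by (simp add: positive_op_iff)
    moreover have "(norm (E *\<^sub>V x))\<^sup>2 \<le> (norm x)\<^sup>2"
      by (intro power_mono norm_orth_projection_le E) simp
    ultimately show ?thesis unfolding S_form by linarith
  qed
  ultimately have S1: "norm S \<le> 1" by (rule norm_positive_op_le) simp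
  define x :: "nat \<Rightarrow> real" where "x = rec_nat 0 (\<lambda>_ r. (1 + r\<^sup>2) / 2)"
  define X where "X = rec_nat 0 (\<lambda>_ Y. complex_of_real (1/2) *\<^sub>C (S + Y o\<^sub>C\<^sub>L Y))"
  have x_rec: "x 0 = 0" "x (Suc n) = (1 + (x n)\<^sup>2) / 2" for n by (simp_all add: x_def)
  have X_rec: "X 0 = 0" "X (Suc n) = complex_of_real (1/2) *\<^sub>C (S + X n o\<^sub>C\<^sub>L X n)" for n
    by (simp_all add: X_def)
  have x01: "0 \<le> x n \<and> x n \<le> 1" for n
  proof (induction n)
    case (Suc n)
    then have "(x n)\<^sup>2 \<le> 1" by (simp add: power_le_one)
    then show ?case by (simp add: x_rec)
  qed (simp add: x_rec)
  have x_inc: "x n \<le> x (Suc n)" for n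
    using sum_squares_bound[of "x n" 1] by (simp add: x_rec)
  have "convergent x"
    using incseq_convergent[OF incseq_SucI[of x, OF x_inc], of 1] x01 unfolding convergent_def by metis
  have X_norm: "norm (X n) \<le> x n" for n
  proof (induction n)
    case (Suc n)
    have "norm (S + X n o\<^sub>C\<^sub>L X n) \<le> 1 + x n * x n"
    proof (rule order_trans[OF norm_triangle_ineq])
      have "norm (X n o\<^sub>C\<^sub>L X n) \<le> x n * x n"
        by (rule order_trans[OF norm_cblinfun_compose]) (use Suc x01 in \<open>simp add: mult_mono\<close>)
      then show "norm S + norm (X n o\<^sub>C\<^sub>L X n) \<le> 1 + x n * x n" using S1 by linarith
    qed
    then show ?case by (simp add: X_rec x_rec norm_scaleC power2_eq_square)
  qed (simp add: X_rec x_rec)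
  have X_step: "norm (X (Suc n) - X n) \<le> x (Suc n) - x n" for n
  proof (induction n)
    case 0
    show ?case using S1 by (simp add: X_rec x_rec norm_scaleC cblinfun_compose_linear)
  next
    case (Suc n)
    let ?A = "X (Suc n)" and ?B = "X n" and ?a = "x (Suc n)" and ?b = "x n"
    have "X (Suc (Suc n)) - ?A
        = complex_of_real (1/2) *\<^sub>C (S + ?A o\<^sub>C\<^sub>L ?A) - complex_of_real (1/2) *\<^sub>C (S + ?B o\<^sub>C\<^sub>L ?B)"
      by (intro arg_cong2[of _ _ _ _ "(-)"] X_rec(2))
    \<comment> \<open>The identity AA - BB = A(A - B) + (A - B)B holds without commutation, and its
      scalar analogue gives the increment of x exactly.\<close>
    then have "X (Suc (Suc n)) - ?A
        = complex_of_real (1/2) *\<^sub>C (?A o\<^sub>C\<^sub>L (?A - ?B) + (?A - ?B) o\<^sub>C\<^sub>L ?B)"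
      by (simp add: cblinfun_compose_linear complex_vector.scale_right_diff_distrib[symmetric])
    moreover have "norm (?A o\<^sub>C\<^sub>L (?A - ?B) + (?A - ?B) o\<^sub>C\<^sub>L ?B) \<le> ?a * (?a - ?b) + (?a - ?b) * ?b"
      by (intro order_trans[OF norm_triangle_ineq] add_mono order_trans[OF norm_cblinfun_compose]
          mult_mono X_norm Suc) (use x01[of n] x01[of "Suc n"] x_inc[of n] in auto)
    ultimately have "norm (X (Suc (Suc n)) - ?A) \<le> (?a * (?a - ?b) + (?a - ?b) * ?b) / 2"
      by (simp add: norm_scaleC)
    also have "\<dots> = x (Suc (Suc n)) - ?a"
      unfolding x_rec(2)[of "Suc n"] using x_rec(2)[of n]
      by (simp add: algebra_simps power2_eq_square diff_divide_distrib)
    finally show ?case .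
  qed
  obtain L where L: "X \<longlonglongrightarrow> L"
    using convergent_if_increments_bounded[OF \<open>convergent x\<close> X_step] by (auto simp: convergent_def)
  have X_mem: "X n \<in> cstar_gen E T" for n
    by (induction n) (auto simp: X_rec intro!: cstar_gen_zero cstar_gen_scale cstar_gen_add S cstar_gen_compose)
  then have L_mem: "L \<in> cstar_gen E T"
    using closed_sequentially[OF cstar_gen_closed _ L] by blast
  have L_corner: "L \<in> corner E" by (rule cstar_gen_corner[OF L_mem])
  have "(\<lambda>n. X (Suc n)) \<longlonglongrightarrow> complex_of_real (1/2) *\<^sub>C (S + L o\<^sub>C\<^sub>L L)"
    unfolding X_rec by (intro tendsto_intros L)
  from LIMSEQ_unique[OF this LIMSEQ_Suc[OF L]]
  have "L + L = complex_of_real (1/2) *\<^sub>C (S + L o\<^sub>C\<^sub>L L) + complex_of_real (1/2) *\<^sub>C (S + L o\<^sub>C\<^sub>L L)"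
    by simp
  \<comment> \<open>The fixed point equation is (E - L)^2 = E - S in disguise, and E - S is
    T/c.\<close>
  then have L_eq: "L + L = S + L o\<^sub>C\<^sub>L L"
    by (simp add: scaleC_add_left[symmetric])
  have X_sa: "selfadjoint (X n)" for n
    by (induction n) (use saS in \<open>auto simp: X_rec selfadjoint_iff cinner_scaleC_left
      cinner_scaleC_right cinner_add_left cinner_add_right\<close>)
  have saL: "selfadjoint L"
    unfolding selfadjoint_iff
  proof (intro allI)
    fix u v
    have "(\<lambda>n. cinner (X n *\<^sub>V u) v) \<longlonglongrightarrow> cinner (L *\<^sub>V u) v"
      "(\<lambda>n. cinner u (X n *\<^sub>V v)) \<longlonglongrightarrow> cinner u (L *\<^sub>V v)"
      by (intro tendsto_intros L)+
    then show "cinner (L *\<^sub>V u) v = cinner u (L *\<^sub>V v)"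
      unfolding selfadjointD[OF X_sa] by (rule LIMSEQ_unique)
  qed
  \<comment> \<open>This makes the form of E - L, and so that of R, nonnegative.\<close>
  have L1: "norm L \<le> 1"
    by (rule LIMSEQ_le_const2[OF tendsto_norm[OF L]]) (use X_norm x01 order_trans in blast)
  define R where "R = complex_of_real (sqrt c) *\<^sub>C (E - L)"
  have "R \<in> cstar_gen E T"
    unfolding R_def by (intro cstar_gen_scale cstar_gen_diff id_in_cstar_gen L_mem)
  moreover have "positive_op R"
  proof (rule positive_opI)
    show "selfadjoint R"
      using saE saL by (simp add: R_def selfadjoint_iff cinner_diff_left cinner_diff_right
          cinner_scaleC_left cinner_scaleC_right)
    fix u
    have "Re (cinner (L *\<^sub>V u) u) = Re (cinner (L *\<^sub>V E *\<^sub>V u) (E *\<^sub>V u))"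
      by (metis cornerD(3,4)[OF E L_corner] selfadjointD[OF saE])
    also have "\<dots> \<le> cmod (cinner (L *\<^sub>V E *\<^sub>V u) (E *\<^sub>V u))" by (rule complex_Re_le_cmod)
    also have "\<dots> \<le> norm (L *\<^sub>V E *\<^sub>V u) * norm (E *\<^sub>V u)" by (rule cinner_Cauchy_Schwarz)
    also have "\<dots> \<le> (1 * norm (E *\<^sub>V u)) * norm (E *\<^sub>V u)"
      by (intro mult_right_mono order_trans[OF norm_cblinfun] L1) simp_all
    finally show "0 \<le> Re (cinner (R *\<^sub>V u) u)"
      using c by (simp add: R_def cinner_scaleC_left cinner_diff_left cinner_orth_projection[OF E]
          power2_eq_square)
  qed
  moreover have "R o\<^sub>C\<^sub>L R = T"
  proof -
    have "(E - L) o\<^sub>C\<^sub>L (E - L) = E - (L + L) + L o\<^sub>C\<^sub>L L"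
      by (simp add: cblinfun_compose_linear cornerD[OF E L_corner] orth_projectionD[OF E])
    also have "\<dots> = complex_of_real (1/c) *\<^sub>C T" by (simp add: L_eq S_def)
    finally have sq: "(E - L) o\<^sub>C\<^sub>L (E - L) = complex_of_real (1/c) *\<^sub>C T" .
    have "R o\<^sub>C\<^sub>L R = complex_of_real (sqrt c * sqrt c) *\<^sub>C ((E - L) o\<^sub>C\<^sub>L (E - L))"
      by (simp only: R_def cblinfun_compose_linear(5,6) scaleC_scaleC of_real_mult)
    then show ?thesis unfolding sq scaleC_scaleC of_real_mult[symmetric] using c by simp
  qed
  ultimately show ?thesis by blast
qed

text \<open>For y = (R - R')x, commutation gives (R + R')y = (RR - R'R')x = 0. The two nonnegative
  forms then vanish at y, so both operators kill y, and the squared norm of y is the inner product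
  of (R - R')y with x.\<close>

lemma positive_sqrt_unique:
  fixes R R' :: "'b::chilbert_space \<Rightarrow>\<^sub>C\<^sub>L 'b"
  assumes R: "positive_op R" and R': "positive_op R'"
    and sq: "R o\<^sub>C\<^sub>L R = R' o\<^sub>C\<^sub>L R'" and comm: "R o\<^sub>C\<^sub>L R' = R' o\<^sub>C\<^sub>L R"
  shows "R = R'"
proof (rule cblinfun_eqI)
  fix x
  let ?y = "R *\<^sub>V x - R' *\<^sub>V x"
  have eq: "R *\<^sub>V R *\<^sub>V x = R' *\<^sub>V R' *\<^sub>V x" "R *\<^sub>V R' *\<^sub>V x = R' *\<^sub>V R *\<^sub>V x"
    using sq comm by (metis cblinfun_compose.rep_eq)+
  then have "R *\<^sub>V ?y + R' *\<^sub>V ?y = 0" by (simp add: cblinfun_diff)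
  then have "cinner (R *\<^sub>V ?y) ?y + cinner (R' *\<^sub>V ?y) ?y = 0"
    by (simp only: cinner_add_left[symmetric] cinner_zero_left)
  then have "Re (cinner (R *\<^sub>V ?y) ?y) = 0 \<and> Re (cinner (R' *\<^sub>V ?y) ?y) = 0"
    using R R' by (auto simp: positive_op_iff add_nonneg_eq_0_iff dest: arg_cong[of _ _ Re])
  then have y0: "R *\<^sub>V ?y = 0" "R' *\<^sub>V ?y = 0"
    using positive_op_eq_0 R R' by blast+
  have "cinner ?y ?y = cinner (R *\<^sub>V ?y - R' *\<^sub>V ?y) x"
    by (simp add: cinner_diff_left cinner_diff_right cblinfun_diff
        selfadjointD[OF selfadjoint_if_positive_op[OF R]]
        selfadjointD[OF selfadjoint_if_positive_op[OF R']])
  then show "R *\<^sub>V x = R' *\<^sub>V x" by (simp add: y0 cinner_self)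
qed

text \<open>The definition lets the root range over all of B(H), so a competitor R' must first be
  shown to live in the corner: it kills x - Ex because its square T does. It then commutes with T
  and E, hence with R, and uniqueness among commuting roots applies.\<close>

lemma pos_sqrt:
  assumes pos: "positive_op T"
  shows "pos_sqrt T \<in> cstar_gen E T" and "positive_op (pos_sqrt T)"
    and "pos_sqrt T o\<^sub>C\<^sub>L pos_sqrt T = T"
proof -
  obtain R where R: "R \<in> cstar_gen E T" "positive_op R" "R o\<^sub>C\<^sub>L R = T"
    using ex_positive_sqrt[OF pos] by blast
  have "pos_sqrt T = R"
    unfolding pos_sqrt_def
  proof (rule the_equality)
    fix R' assume R': "positive_op R' \<and> R' o\<^sub>C\<^sub>L R' = T"
    then have sa: "selfadjoint R'" by (simp add: selfadjoint_if_positive_op)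
    have "R' *\<^sub>V (x - E *\<^sub>V x) = 0" for x
    proof -
      have "cinner (R' *\<^sub>V (x - E *\<^sub>V x)) (R' *\<^sub>V (x - E *\<^sub>V x)) = cinner (T *\<^sub>V (x - E *\<^sub>V x)) (x - E *\<^sub>V x)"
        using R' selfadjointD[OF sa] by (metis cblinfun_compose.rep_eq)
      also have "\<dots> = 0" by (simp add: cblinfun_diff cornerD[OF E T])
      finally show ?thesis by (simp add: cinner_self)
    qed
    then have RE: "R' *\<^sub>V E *\<^sub>V x = R' *\<^sub>V x" for x by (simp add: cblinfun_diff)
    have ER: "E *\<^sub>V R' *\<^sub>V x = R' *\<^sub>V x" for x
      by (rule cinner_eqI)
        (simp add: selfadjointD[OF sa, symmetric] selfadjointD[OF orth_projectionD(2)[OF E], symmetric] RE)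
    have "R' o\<^sub>C\<^sub>L R = R o\<^sub>C\<^sub>L R'"
    proof (rule cstar_gen_commute[OF R(1)])
      show "R' o\<^sub>C\<^sub>L T = T o\<^sub>C\<^sub>L R'" using R' by (metis cblinfun_compose_assoc)
      show "R' o\<^sub>C\<^sub>L E = E o\<^sub>C\<^sub>L R'" by (rule cblinfun_eqI) (simp add: ER RE)
    qed
    then show "R' = R" using R R' positive_sqrt_unique by metis
  qed (use R in blast)
  then show "pos_sqrt T \<in> cstar_gen E T" "positive_op (pos_sqrt T)"
    "pos_sqrt T o\<^sub>C\<^sub>L pos_sqrt T = T"
    using R by auto
qed

text \<open>A rescaled Neumann series. With c = 1/(1 + t |T|), the operator G = E - c(E + tT)
  satisfies 0 \<le> G \<le> 1 - c as a form, so \<open>X \<mapsto> cE + GX\<close> contracts for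
  every t and not just for small t. A fixed point R of this map satisfies (E + tT)R = E.\<close>

lemma ex_corner_inverse:
  assumes pos: "positive_op T" and t: "0 \<le> t"
  shows "\<exists>R\<in>cstar_gen E T. R o\<^sub>C\<^sub>L (E + complex_of_real t *\<^sub>C T) = E
    \<and> (E + complex_of_real t *\<^sub>C T) o\<^sub>C\<^sub>L R = E"
proof -
  define c where "c = 1 / (1 + t * norm T)"
  have den: "0 < 1 + t * norm T" using t by (simp add: add_pos_nonneg)
  then have c: "0 < c" "c \<le> 1" using t by (auto simp: c_def)
  have ct: "c * t * norm T = 1 - c" using den by (simp add: c_def field_simps)
  define G where "G = E - complex_of_real c *\<^sub>C (E + complex_of_real t *\<^sub>C T)"
  have G: "G \<in> cstar_gen E T"
    unfolding G_def
    by (intro cstar_gen_diff cstar_gen_scale cstar_gen_add id_in_cstar_gen generator_in_cstar_gen)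
  have saG: "selfadjoint G"
    using orth_projectionD(2)[OF E] selfadjoint_if_positive_op[OF pos] unfolding selfadjoint_iff
    by (simp add: G_def cinner_diff_left cinner_diff_right cinner_add_left cinner_add_right
        cinner_scaleC_left cinner_scaleC_right)
  have G_form: "Re (cinner (G *\<^sub>V x) x)
      = (1 - c) * (norm (E *\<^sub>V x))\<^sup>2 - c * t * Re (cinner (T *\<^sub>V x) x)" for x
    by (simp add: G_def cinner_diff_left cinner_add_left cinner_scaleC_left
        cinner_orth_projection[OF E] algebra_simps)
  have "positive_op G"
  proof (rule positive_opI[OF saG])
    fix x
    have "c * t * Re (cinner (T *\<^sub>V x) x) \<le> c * t * (norm T * (norm (E *\<^sub>V x))\<^sup>2)"
      by (intro mult_left_mono cinner_positive_corner_le pos) (use c t in auto)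
    then show "0 \<le> Re (cinner (G *\<^sub>V x) x)" by (simp add: G_form ct[symmetric] mult.assoc)
  qed
  moreover have "Re (cinner (G *\<^sub>V x) x) \<le> (1 - c) * (norm x)\<^sup>2" for x
  proof -
    have "0 \<le> c * t * Re (cinner (T *\<^sub>V x) x)" using pos c t by (simp add: positive_op_iff)
    moreover have "(1 - c) * (norm (E *\<^sub>V x))\<^sup>2 \<le> (1 - c) * (norm x)\<^sup>2"
      using c by (intro mult_left_mono power_mono norm_orth_projection_le E) auto
    ultimately show ?thesis by (simp add: G_form)
  qed
  ultimately have norm_G: "norm G \<le> 1 - c" by (rule norm_positive_op_le) (use c in simp)
  define X where "X = rec_nat 0 (\<lambda>_ Y. complex_of_real c *\<^sub>C E + G o\<^sub>C\<^sub>L Y)"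
  have X_rec: "X 0 = 0" "X (Suc n) = complex_of_real c *\<^sub>C E + G o\<^sub>C\<^sub>L X n" for n
    by (simp_all add: X_def)
  define K where "K = norm (X (Suc 0))"
  \<comment> \<open>Partial sums of the geometric series with first term K and ratio 1 - c.\<close>
  define x where "x n = K / c * (1 - (1 - c) ^ n)" for n
  have "x \<longlonglongrightarrow> K / c * (1 - 0)"
    unfolding x_def using c by (intro tendsto_intros LIMSEQ_realpow_zero) auto
  then have "convergent x" by (rule convergentI)
  have X_step: "norm (X (Suc n) - X n) \<le> x (Suc n) - x n" for n
  proof -
    have "norm (X (Suc n) - X n) \<le> K * (1 - c) ^ n"
    proof (induction n)
      case (Suc n)
      have "X (Suc (Suc n)) - X (Suc n) = G o\<^sub>C\<^sub>L (X (Suc n) - X n)"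
        by (simp add: X_rec(2) cblinfun_compose_linear)
      then have "norm (X (Suc (Suc n)) - X (Suc n)) \<le> (1 - c) * (K * (1 - c) ^ n)"
        using norm_G Suc c by (simp only:) (intro order_trans[OF norm_cblinfun_compose] mult_mono, auto)
      then show ?case by (simp add: mult_ac)
    qed (simp add: K_def X_rec)
    also have "\<dots> = x (Suc n) - x n" using c by (simp add: x_def field_simps)
    finally show ?thesis .
  qed
  obtain R where R: "X \<longlonglongrightarrow> R"
    using convergent_if_increments_bounded[OF \<open>convergent x\<close> X_step] by (auto simp: convergent_def)
  have "X n \<in> cstar_gen E T" for n
    by (induction n) (auto simp: X_rec
        intro!: cstar_gen_zero cstar_gen_scale cstar_gen_add G id_in_cstar_gen cstar_gen_compose)
  then have R_mem: "R \<in> cstar_gen E T"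
    using closed_sequentially[OF cstar_gen_closed _ R] by blast
  note R_corner = cornerD[OF E cstar_gen_corner[OF R_mem]]
  have "(\<lambda>n. X (Suc n)) \<longlonglongrightarrow> complex_of_real c *\<^sub>C E + G o\<^sub>C\<^sub>L R"
    unfolding X_rec by (intro tendsto_intros R)
  from LIMSEQ_unique[OF LIMSEQ_Suc[OF R] this]
  have "R = complex_of_real c *\<^sub>C E + R
      - complex_of_real c *\<^sub>C ((E + complex_of_real t *\<^sub>C T) o\<^sub>C\<^sub>L R)"
    by (simp add: G_def cblinfun_compose_linear R_corner)
  then have "complex_of_real c *\<^sub>C ((E + complex_of_real t *\<^sub>C T) o\<^sub>C\<^sub>L R) = complex_of_real c *\<^sub>C E"
    by (simp add: algebra_simps)
  then have right: "(E + complex_of_real t *\<^sub>C T) o\<^sub>C\<^sub>L R = E"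
    using c by (simp add: complex_vector.scale_left_imp_eq)
  have "T o\<^sub>C\<^sub>L R = R o\<^sub>C\<^sub>L T"
    by (rule cstar_gen_commute[OF R_mem]) (simp_all add: cornerD[OF E T])
  then have "R o\<^sub>C\<^sub>L (E + complex_of_real t *\<^sub>C T) = E"
    using right by (simp add: cblinfun_compose_linear R_corner)
  then show ?thesis using R_mem right by blast
qed

lemma corner_inverse:
  assumes "positive_op T" and "0 \<le> t"
  defines "S \<equiv> E + complex_of_real t *\<^sub>C T"
  shows "corner_inverse E S \<in> cstar_gen E T" and "corner_inverse E S o\<^sub>C\<^sub>L S = E"
    and "S o\<^sub>C\<^sub>L corner_inverse E S = E"
proof -
  obtain R where R: "R \<in> cstar_gen E T" "R o\<^sub>C\<^sub>L S = E" "S o\<^sub>C\<^sub>L R = E"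
    unfolding S_def using ex_corner_inverse[OF assms(1,2)] by blast
  have RE: "E o\<^sub>C\<^sub>L R = R" using cornerD[OF E cstar_gen_corner[OF R(1)]] by simp
  have "corner_inverse E S = R"
    unfolding corner_inverse_def
  proof (rule the_equality)
    fix R' assume R': "R' \<in> corner E \<and> R' o\<^sub>C\<^sub>L S = E \<and> S o\<^sub>C\<^sub>L R' = E"
    then have "R' o\<^sub>C\<^sub>L E = R'" using cornerD[OF E] by blast
    then show "R' = R" using R' R(3) RE by (metis cblinfun_compose_assoc)
  qed (use R cstar_gen_corner in blast)
  then show "corner_inverse E S \<in> cstar_gen E T" "corner_inverse E S o\<^sub>C\<^sub>L S = E"
    "S o\<^sub>C\<^sub>L corner_inverse E S = E" using R by auto
qed

end

subsection \<open>Orthogonal projections\<close>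

text \<open>Midpoints stay in S and hence have norm at least d, so the parallelogram identity forces
  a minimising sequence to be Cauchy.\<close>

lemma ex_min_norm:
  fixes S :: "'a::chilbert_space set"
  assumes ne: "S \<noteq> {}" and cl: "closed S" and cv: "convex S"
  shows "\<exists>y\<in>S. \<forall>z\<in>S. norm y \<le> norm z"
proof -
  define d where "d = Inf (norm ` S)"
  have bdd: "bdd_below (norm ` S)" by (rule bdd_belowI[of _ 0]) auto
  have d_le: "d \<le> norm s" if "s \<in> S" for s
    unfolding d_def using bdd that by (simp add: cInf_lower)
  have d0: "0 \<le> d" unfolding d_def by (rule cInf_greatest) (use ne in auto)
  have "\<exists>s\<in>S. norm s < d + inverse (real (Suc n))" for n
    using cInf_lessD[of "norm ` S" "d + inverse (real (Suc n))"] ne unfolding d_def by auto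
  then obtain s where sS: "\<And>n. s n \<in> S" and s_less: "\<And>n. norm (s n) < d + inverse (real (Suc n))"
    by metis
  have lim: "(\<lambda>n. norm (s n)) \<longlonglongrightarrow> d"
  proof (rule tendsto_sandwich[of "\<lambda>_. d"])
    show "(\<lambda>n. d + inverse (real (Suc n))) \<longlonglongrightarrow> d"
      by (rule LIMSEQ_inverse_real_of_nat_add)
    show "\<forall>\<^sub>F n in sequentially. d \<le> norm (s n)"
      by (rule always_eventually) (use sS d_le in blast)
    show "\<forall>\<^sub>F n in sequentially. norm (s n) \<le> d + inverse (real (Suc n))"
      by (rule always_eventually) (use s_less less_imp_le in blast)
  qed (rule tendsto_const)
  have parallelogram: "(norm (s m - s n))\<^sup>2 \<le> 2 * ((norm (s m))\<^sup>2 - d\<^sup>2) + 2 * ((norm (s n))\<^sup>2 - d\<^sup>2)"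
    for m n
  proof -
    have "(1/2 :: real) *\<^sub>R s m + (1/2) *\<^sub>R s n \<in> S"
      by (rule convexD[OF cv sS sS]) auto
    from d_le[OF this] have "2 * d \<le> norm (s m + s n)"
      unfolding scaleR_add_right[symmetric] by simp
    then have "(2 * d)\<^sup>2 \<le> (norm (s m + s n))\<^sup>2" using d0 by (intro power_mono) auto
    moreover have "(norm (s m - s n))\<^sup>2 + (norm (s m + s n))\<^sup>2
        = 2 * (norm (s m))\<^sup>2 + 2 * (norm (s n))\<^sup>2"
      by (simp add: power2_norm_eq_inner inner_add_left inner_add_right inner_diff_left
          inner_diff_right inner_commute)
    ultimately show ?thesis by (simp add: power_mult_distrib)
  qed
  have "Cauchy s"
  proof (rule CauchyI)
    fix r :: real assume r: "0 < r"
    have "(\<lambda>n. 4 * ((norm (s n))\<^sup>2 - d\<^sup>2)) \<longlonglongrightarrow> 4 * (d\<^sup>2 - d\<^sup>2)"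
      by (intro tendsto_intros lim)
    then have "\<forall>\<^sub>F n in sequentially. 4 * ((norm (s n))\<^sup>2 - d\<^sup>2) < r\<^sup>2"
      using r by (intro order_tendstoD(2)) auto
    then obtain N where N: "\<And>n. n \<ge> N \<Longrightarrow> 4 * ((norm (s n))\<^sup>2 - d\<^sup>2) < r\<^sup>2"
      by (auto simp: eventually_sequentially)
    have "norm (s m - s n) < r" if "m \<ge> N" "n \<ge> N" for m n
    proof (rule power_less_imp_less_base[of _ 2])
      show "(norm (s m - s n))\<^sup>2 < r\<^sup>2"
        using parallelogram[of m n] N[OF that(1)] N[OF that(2)] by linarith
    qed (use r in simp)
    then show "\<exists>M. \<forall>m\<ge>M. \<forall>n\<ge>M. norm (s m - s n) < r" by blast
  qed
  then obtain y where y: "s \<longlonglongrightarrow> y"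
    using Cauchy_convergent_iff convergent_def by blast
  have "y \<in> S" using closed_sequentially[OF cl _ y] sS by blast
  moreover have "norm y = d" using LIMSEQ_unique[OF tendsto_norm[OF y] lim] .
  ultimately show ?thesis using d_le by blast
qed

text \<open>Minimality makes the increment of the squared norm a nonnegative form with constant term
  0, so its discriminant bound is 0.\<close>

lemma cinner_eq_0_if_norm_min:
  fixes y z :: "'a::chilbert_space"
  assumes "\<And>c. norm y \<le> norm (y - c *\<^sub>C z)"
  shows "cinner y z = 0"
proof -
  have "(cmod (cinner y z))\<^sup>2 \<le> (norm z)\<^sup>2 * 0"
  proof (rule hermitian_form_discriminant)
    fix c
    have "(norm y)\<^sup>2 \<le> (norm (y - c *\<^sub>C z))\<^sup>2" using assms by (rule power_mono) simp
    moreover have "(norm (y - c *\<^sub>C z))\<^sup>2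
        = (norm y)\<^sup>2 - 2 * Re (cnj c * cinner y z) + (norm z)\<^sup>2 * (cmod c)\<^sup>2"
      using norm_add_sq[of y "- (c *\<^sub>C z)"]
      by (simp add: cinner_minus_right cinner_scaleC_right norm_scaleC power_mult_distrib mult.commute)
    ultimately show "0 \<le> (norm z)\<^sup>2 * (cmod c)\<^sup>2 - 2 * Re (cnj c * cinner y z) + 0"
      by linarith
  qed simp
  then show ?thesis by simp
qed

lemma convex_subspace: "complex_vector.subspace M \<Longrightarrow> convex M"
  by (simp add: convex_def scaleR_scaleC complex_vector.subspace_add complex_vector.subspace_scale)

text \<open>The shortest vector y of the coset x - M is orthogonal to M, and p = x - y.\<close>

lemma ex_orthogonal_decomposition:
  fixes M :: "'a::chilbert_space set"
  assumes M: "complex_vector.subspace M" and cl: "closed M"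
  shows "\<exists>p\<in>M. \<forall>m\<in>M. cinner (x - p) m = 0"
proof -
  have im: "(\<lambda>m. x - m) ` M = {z. x - z \<in> M}"
    by (auto intro!: image_eqI[of _ "\<lambda>m. x - m"])
  obtain y where y: "x - y \<in> M" and min: "\<And>z. x - z \<in> M \<Longrightarrow> norm y \<le> norm z"
  proof -
    have "\<exists>y\<in>{z. x - z \<in> M}. \<forall>z\<in>{z. x - z \<in> M}. norm y \<le> norm z"
    proof (rule ex_min_norm)
      show "{z. x - z \<in> M} \<noteq> {}"
        using complex_vector.subspace_0[OF M] by (auto intro!: exI[of _ x])
      show "closed {z. x - z \<in> M}"
        using closed_vimage[OF cl, of "\<lambda>z. x - z"] by (simp add: vimage_def continuous_intros)
      have "convex ((\<lambda>m. x - m) ` M)"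
        using convex_translation[OF convex_negations[OF convex_subspace[OF M]], of x]
        by (simp add: image_image)
      then show "convex {z. x - z \<in> M}" by (simp only: im)
    qed
    then show ?thesis using that by blast
  qed
  have "cinner y m = 0" if "m \<in> M" for m
  proof (rule cinner_eq_0_if_norm_min, rule min)
    fix c
    have "(x - y) + c *\<^sub>C m \<in> M"
      by (intro complex_vector.subspace_add[OF M] complex_vector.subspace_scale[OF M] y that)
    then show "x - (y - c *\<^sub>C m) \<in> M" by (simp add: algebra_simps)
  qed
  then show ?thesis using y by (intro bexI[of _ "x - y"]) auto
qed

lemma ex_orth_projection_onto:
  fixes M :: "'a::chilbert_space set"
  assumes M: "complex_vector.subspace M" and cl: "closed M"
  shows "\<exists>P. orth_projection P \<and> (\<forall>x. P *\<^sub>V x \<in> M) \<and> (\<forall>x. \<forall>m\<in>M. cinner (x - P *\<^sub>V x) m = 0)"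
proof -
  obtain p where pM: "\<And>x. p x \<in> M" and orth: "\<And>x m. m \<in> M \<Longrightarrow> cinner (x - p x) m = 0"
    using ex_orthogonal_decomposition[OF M cl] by metis
  have unique: "p x = q" if q: "q \<in> M" "\<And>m. m \<in> M \<Longrightarrow> cinner (x - q) m = 0" for x q
  proof -
    have "p x - q \<in> M" by (intro complex_vector.subspace_diff[OF M] pM q)
    then have "cinner (x - q) (p x - q) - cinner (x - p x) (p x - q) = 0"
      by (simp add: orth q)
    then have "cinner (p x - q) (p x - q) = 0" by (simp add: cinner_diff_left)
    then show ?thesis by (simp add: cinner_self)
  qed
  have p_add: "p (x + y) = p x + p y" for x y
  proof (rule unique)
    fix m assume "m \<in> M"
    then have "cinner (x - p x) m + cinner (y - p y) m = 0" by (simp add: orth)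
    then show "cinner (x + y - (p x + p y)) m = 0"
      by (simp add: cinner_diff_left cinner_add_left algebra_simps)
  qed (intro complex_vector.subspace_add[OF M] pM)
  have p_scale: "p (c *\<^sub>C x) = c *\<^sub>C p x" for c x
  proof (rule unique)
    fix m assume "m \<in> M"
    then have "c * cinner (x - p x) m = 0" by (simp add: orth)
    then show "cinner (c *\<^sub>C x - c *\<^sub>C p x) m = 0"
      by (simp add: cinner_diff_left cinner_scaleC_left right_diff_distrib)
  qed (intro complex_vector.subspace_scale[OF M] pM)
  have p_norm: "norm (p x) \<le> norm x * 1" for x
  proof (rule power2_le_imp_le)
    show "(norm (p x))\<^sup>2 \<le> (norm x * 1)\<^sup>2"
      using norm_add_sq[of "x - p x" "p x"] orth[OF pM] by simp
  qed simp
  have "bounded_linear p"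
    by (rule bounded_linear_intro[where K = 1]) (use p_norm in \<open>simp_all add: p_add p_scale scaleR_scaleC\<close>)
  then have P: "CBlinfun p *\<^sub>V x = p x" for x by (simp add: CBlinfun_inverse p_scale)
  have "orth_projection (CBlinfun p)"
    unfolding orth_projection_def selfadjoint_iff
  proof (intro conjI allI cblinfun_eqI)
    show "(CBlinfun p o\<^sub>C\<^sub>L CBlinfun p) *\<^sub>V x = CBlinfun p *\<^sub>V x" for x
      using unique[of "p x" "p x"] pM by (simp add: P)
    fix x y
    have "cinner (p x) y = cinner (p x) (p y)"
      using orth[OF pM, of y x] cinner_commute[of "p x" "y - p y"] by (simp add: cinner_diff_right)
    moreover have "cinner x (p y) = cinner (p x) (p y)"
      using orth[OF pM, of x y] by (simp add: cinner_diff_left)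
    ultimately show "cinner (CBlinfun p *\<^sub>V x) y = cinner x (CBlinfun p *\<^sub>V y)" by (simp add: P)
  qed
  then show ?thesis using P pM orth by (intro exI[of _ "CBlinfun p"]) simp
qed

lemma ex_orthogonal_vector:
  fixes M :: "'a::chilbert_space set"
  assumes "complex_vector.subspace M" and "closed M" and "M \<noteq> UNIV"
  shows "\<exists>u. u \<noteq> 0 \<and> (\<forall>m\<in>M. cinner u m = 0)"
proof -
  obtain x where x: "x \<notin> M" using assms(3) by blast
  obtain p where "p \<in> M" "\<forall>m\<in>M. cinner (x - p) m = 0"
    using ex_orthogonal_decomposition[OF assms(1,2)] by blast
  then show ?thesis using x by (intro exI[of _ "x - p"]) auto
qed

subsection \<open>Isometric extension of the polar decomposition\<close>

text \<open>The graph of a partially defined linear isometry: a pair (0, v) in it forces v = 0, so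
  it is single valued in both directions. Graphs are ordered by inclusion, as Zorn's lemma wants,
  and swapping coordinates exchanges domain and range.\<close>

definition isometric_graph :: "('a::chilbert_space \<times> 'a) set \<Rightarrow> bool"
  where "isometric_graph G \<longleftrightarrow> complex_vector.subspace G \<and> (\<forall>p\<in>G. norm (fst p) = norm (snd p))"

lemma isometric_graph_subspace: "isometric_graph G \<Longrightarrow> complex_vector.subspace G"
  by (simp add: isometric_graph_def)

lemma isometric_graph_norm: "isometric_graph G \<Longrightarrow> (u, v) \<in> G \<Longrightarrow> norm u = norm v"
  unfolding isometric_graph_def by (metis fst_conv snd_conv)

lemma ex_maximal_isometric_graph:
  assumes G0: "isometric_graph G0"
  shows "\<exists>G. isometric_graph G \<and> G0 \<subseteq> G \<and> (\<forall>G'. isometric_graph G' \<longrightarrow> G \<subseteq> G' \<longrightarrow> G' = G)"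
proof -
  let ?A = "{G. isometric_graph G \<and> G0 \<subseteq> G}"
  have "\<exists>M\<in>?A. \<forall>X\<in>?A. M \<subseteq> X \<longrightarrow> X = M"
  proof (rule subset_Zorn_nonempty)
    show "?A \<noteq> {}" using G0 by blast
    fix \<C> assume ne: "\<C> \<noteq> {}" and ch: "subset.chain ?A \<C>"
    have mem: "isometric_graph G" "G0 \<subseteq> G" "complex_vector.subspace G" if "G \<in> \<C>" for G
      using ch that by (auto simp: subset_chain_def isometric_graph_def)
    obtain G1 where G1: "G1 \<in> \<C>" using ne by blast
    have "complex_vector.subspace (\<Union>\<C>)"
    proof (rule complex_vector.subspaceI)
      show "0 \<in> \<Union>\<C>" using complex_vector.subspace_0[OF mem(3)[OF G1]] G1 by blast
      show "c *\<^sub>C x \<in> \<Union>\<C>" if "x \<in> \<Union>\<C>" for c x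
      proof -
        obtain G where G: "G \<in> \<C>" "x \<in> G" using \<open>x \<in> \<Union>\<C>\<close> by blast
        show ?thesis using complex_vector.subspace_scale[OF mem(3)[OF G(1)] G(2)] G(1) by blast
      qed
      fix x y assume "x \<in> \<Union>\<C>" "y \<in> \<Union>\<C>"
      then obtain G G' where G: "G \<in> \<C>" "x \<in> G" "G' \<in> \<C>" "y \<in> G'" by blast
      then have "G \<subseteq> G' \<or> G' \<subseteq> G" using ch by (simp add: subset_chain_def)
      then obtain F where F: "F \<in> \<C>" "x \<in> F" "y \<in> F" using G by blast
      show "x + y \<in> \<Union>\<C>" using complex_vector.subspace_add[OF mem(3)[OF F(1)] F(2,3)] F(1) by blast
    qed
    then have "isometric_graph (\<Union>\<C>)"
      unfolding isometric_graph_def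
    proof (intro conjI ballI)
      fix p assume "p \<in> \<Union>\<C>"
      then obtain G where "G \<in> \<C>" "p \<in> G" by blast
      then show "norm (fst p) = norm (snd p)"
        using mem(1)[of G] by (simp add: isometric_graph_def)
    qed
    moreover have "G0 \<subseteq> \<Union>\<C>" using mem(2)[OF G1] G1 by blast
    ultimately show "\<Union>\<C> \<in> ?A" by blast
  qed
  then obtain G where "G \<in> ?A" and max: "\<forall>X\<in>?A. G \<subseteq> X \<longrightarrow> X = G" ..
  moreover have "X = G" if "isometric_graph X" "G \<subseteq> X" for X
    using max[rule_format, of X] that subset_trans[of G0 G X] \<open>G \<in> ?A\<close> by simp
  ultimately show ?thesis by (intro exI[of _ G] conjI allI impI) simp_all
qed

text \<open>Equality of norms is a closed condition; consequently a maximal graph is closed.\<close>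

lemma isometric_graph_closure:
  assumes "isometric_graph G" shows "isometric_graph (closure G)"
proof -
  have "closure G \<subseteq> {p. norm (fst p) = norm (snd p)}"
    using assms by (intro closure_minimal closed_Collect_eq continuous_intros)
      (auto simp: isometric_graph_def)
  then show ?thesis
    using assms by (auto simp: isometric_graph_def intro: closure_subspace)
qed

lemma isometric_graph_converse:
  assumes "isometric_graph G" shows "isometric_graph (prod.swap ` G)"
proof -
  have "complex_vector.subspace (prod.swap ` G)"
  proof (rule complex_vector.subspaceI)
    note G = isometric_graph_subspace[OF assms]
    show "0 \<in> prod.swap ` G"
      using complex_vector.subspace_0[OF G] by (intro image_eqI[of _ _ 0]) (simp add: prod_eq_iff)
    fix x y c assume "x \<in> prod.swap ` G"
    then obtain x' where x': "x' \<in> G" "x = prod.swap x'" by blast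
    show "c *\<^sub>C x \<in> prod.swap ` G"
      by (rule image_eqI[OF _ complex_vector.subspace_scale[OF G x'(1), of c]])
        (simp add: x' scaleC_prod_def prod_eq_iff)
    assume "y \<in> prod.swap ` G"
    then obtain y' where y': "y' \<in> G" "y = prod.swap y'" by blast
    show "x + y \<in> prod.swap ` G"
      by (rule image_eqI[OF _ complex_vector.subspace_add[OF G x'(1) y'(1)]])
        (simp add: x' y' prod_eq_iff)
  qed
  then show ?thesis using assms by (auto simp: isometric_graph_def)
qed

text \<open>Differences of pairs in G have coordinates of equal norm, so convergence of first
  coordinates makes the second coordinates Cauchy.\<close>

lemma isometric_graph_domain_closed:
  fixes G :: "('a::chilbert_space \<times> 'a) set"
  assumes G: "isometric_graph G" and cl: "closed G"
  shows "complex_vector.subspace (fst ` G)" and "closed (fst ` G)"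
proof -
  note sub = isometric_graph_subspace[OF G]
  show "complex_vector.subspace (fst ` G)"
  proof (rule complex_vector.subspaceI)
    show "0 \<in> fst ` G"
      using complex_vector.subspace_0[OF sub] by (intro image_eqI[of _ _ 0]) simp
    fix x y c assume "x \<in> fst ` G"
    then obtain x' where x': "x' \<in> G" "x = fst x'" by blast
    show "c *\<^sub>C x \<in> fst ` G"
      by (rule image_eqI[OF _ complex_vector.subspace_scale[OF sub x'(1), of c]])
        (simp add: x' scaleC_prod_def)
    assume "y \<in> fst ` G"
    then obtain y' where y': "y' \<in> G" "y = fst y'" by blast
    show "x + y \<in> fst ` G"
      by (rule image_eqI[OF _ complex_vector.subspace_add[OF sub x'(1) y'(1)]])
        (simp add: x' y')
  qed
  show "closed (fst ` G)"
    unfolding closed_sequential_limits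
  proof (intro allI impI, elim conjE)
    fix f l assume f: "\<forall>n. f n \<in> fst ` G" and l: "f \<longlonglongrightarrow> l"
    then have "\<exists>y. (f n, y) \<in> G" for n by force
    then obtain g where g: "\<And>n. (f n, g n) \<in> G" by metis
    have "norm (g m - g n) = norm (f m - f n)" for m n
      using isometric_graph_norm[OF G, of "f m - f n" "g m - g n"]
        complex_vector.subspace_diff[OF sub g[of m] g[of n]] by simp
    then have "Cauchy g"
      using LIMSEQ_imp_Cauchy[OF l] by (simp add: Cauchy_def dist_norm)
    then obtain k where "g \<longlonglongrightarrow> k" using Cauchy_convergent_iff convergent_def by blast
    then have "(\<lambda>n. (f n, g n)) \<longlonglongrightarrow> (l, k)" using l by (intro tendsto_intros)
    then have "(l, k) \<in> G" by (rule closed_sequentially[OF cl g])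
    then show "l \<in> fst ` G" by force
  qed
qed

lemma isometric_graph_total:
  fixes G :: "('a::chilbert_space \<times> 'a) set"
  assumes G: "isometric_graph G" and total: "fst ` G = UNIV"
  shows "\<exists>J. (\<forall>x. norm (J *\<^sub>V x) = norm x) \<and> (\<forall>(x, y)\<in>G. J *\<^sub>V x = y)"
proof -
  note sub = isometric_graph_subspace[OF G] and nrm = isometric_graph_norm[OF G]
  have "\<exists>y. (x, y) \<in> G" for x
  proof -
    have "x \<in> fst ` G" by (simp add: total)
    then show ?thesis by force
  qed
  then obtain j where j: "\<And>x. (x, j x) \<in> G" by metis
  have unique: "j x = y" if "(x, y) \<in> G" for x y
    using complex_vector.subspace_diff[OF sub j[of x] that] nrm[of 0 "j x - y"] by simp
  have j_add: "j (x + y) = j x + j y" for x y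
    using unique[of "x + y" "j x + j y"] complex_vector.subspace_add[OF sub j[of x] j[of y]] by simp
  have j_scale: "j (c *\<^sub>C x) = c *\<^sub>C j x" for c x
    using unique[of "c *\<^sub>C x" "c *\<^sub>C j x"] complex_vector.subspace_scale[OF sub j[of x], of c]
    by (simp add: scaleC_prod_def)
  have "bounded_linear j"
    by (rule bounded_linear_intro[where K = 1])
      (simp_all add: j_add j_scale scaleR_scaleC nrm[OF j, symmetric])
  then have "CBlinfun j *\<^sub>V x = j x" for x by (simp add: CBlinfun_inverse j_scale)
  then show ?thesis using unique nrm[OF j] by (intro exI[of _ "CBlinfun j"]) auto
qed

text \<open>A maximal isometric subspace of \<open>H \<times> H\<close> is total in one of the two coordinates, since
  otherwise a pair of vectors orthogonal to its two projections could be adjoined.\<close>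

lemma ex_isometry_extension:
  assumes G0: "isometric_graph G0"
  shows "\<exists>J. (\<forall>x. norm (J *\<^sub>V x) = norm x) \<and>
    ((\<forall>(x, y)\<in>G0. J *\<^sub>V x = y) \<or> (\<forall>(x, y)\<in>G0. J *\<^sub>V y = x))"
proof -
  obtain G where G: "isometric_graph G" and sup: "G0 \<subseteq> G"
    and max: "\<And>G'. isometric_graph G' \<Longrightarrow> G \<subseteq> G' \<Longrightarrow> G' = G"
    using ex_maximal_isometric_graph[OF G0] by blast
  note sub = isometric_graph_subspace[OF G]
  have cl: "closed G"
    using max[OF isometric_graph_closure[OF G] closure_subset] closed_closure[of G] by simp
  let ?G = "prod.swap ` G"
  have G': "isometric_graph ?G" by (rule isometric_graph_converse[OF G])
  have cl': "closed ?G"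
  proof -
    have "p \<in> ?G \<longleftrightarrow> prod.swap p \<in> G" for p by (metis imageE image_eqI swap_swap)
    then have "?G = prod.swap -` G" by blast
    then show ?thesis using closed_vimage[OF cl continuous_on_swap] by simp
  qed
  have "fst ` G = UNIV \<or> fst ` ?G = UNIV"
  proof (rule ccontr)
    assume none: "\<not> ?thesis"
    obtain u v where u: "u \<noteq> 0" "\<And>x y. (x, y) \<in> G \<Longrightarrow> cinner u x = 0"
      and v: "v \<noteq> 0" "\<And>x y. (x, y) \<in> G \<Longrightarrow> cinner v y = 0"
    proof -
      obtain u where u: "u \<noteq> 0" "\<forall>m\<in>fst ` G. cinner u m = 0"
        using ex_orthogonal_vector[OF isometric_graph_domain_closed[OF G cl]] none by blast
      obtain v where v: "v \<noteq> 0" "\<forall>m\<in>fst ` ?G. cinner v m = 0"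
        using ex_orthogonal_vector[OF isometric_graph_domain_closed[OF G' cl']] none by blast
      show thesis
      proof (rule that[OF u(1) _ v(1)])
        fix x y assume xy: "(x, y) \<in> G"
        show "cinner u x = 0" using bspec[OF u(2) image_eqI[OF _ xy, of x fst]] by simp
        have "y \<in> fst ` ?G" by (rule image_eqI[OF _ imageI[OF xy]]) simp
        then show "cinner v y = 0" using v(2) by blast
      qed
    qed
    \<comment> \<open>Rescaled so that both adjoined vectors have the same length.\<close>
    define v' where "v' = complex_of_real (norm u / norm v) *\<^sub>C v"
    have v': "norm v' = norm u" "\<And>x y. (x, y) \<in> G \<Longrightarrow> cinner v' y = 0"
      using v by (auto simp: v'_def norm_scaleC cinner_scaleC_left norm_divide)
    let ?H = "cspan (insert (u, v') G)"
    have "isometric_graph ?H"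
      unfolding isometric_graph_def
    proof (intro conjI ballI complex_vector.subspace_span)
      fix p assume "p \<in> ?H"
      then obtain k where k: "p - k *\<^sub>C (u, v') \<in> G"
        using sub by (auto simp: complex_vector.span_insert complex_vector.span_eq_iff[THEN iffD2])
      define x y where xy: "x = fst (p - k *\<^sub>C (u, v'))" "y = snd (p - k *\<^sub>C (u, v'))"
      have G_xy: "(x, y) \<in> G" using k unfolding xy by (simp only: prod.collapse)
      have p: "fst p = k *\<^sub>C u + x" "snd p = k *\<^sub>C v' + y"
        by (simp_all add: xy scaleC_prod_def)
      \<comment> \<open>Pythagoras in each coordinate: u is orthogonal to x, and v' is orthogonal to
        y.\<close>
      have "(norm (fst p))\<^sup>2 = (norm (snd p))\<^sup>2"
        using u(2)[OF G_xy] v'(2)[OF G_xy] v'(1) isometric_graph_norm[OF G G_xy]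
        by (simp add: p norm_add_sq cinner_scaleC_left norm_scaleC)
      then show "norm (fst p) = norm (snd p)" by simp
    qed
    then have "?H = G"
      by (rule max) (auto intro: complex_vector.span_base)
    \<comment> \<open>Membership makes u orthogonal to itself.\<close>
    then have "(u, v') \<in> G" using complex_vector.span_base[of "(u, v')"] by blast
    then have "cinner u u = 0" by (rule u)
    then show False using u by (simp add: cinner_self)
  qed
  then show ?thesis
  proof
    assume "fst ` G = UNIV"
    then obtain J where "\<forall>x. norm (J *\<^sub>V x) = norm x" "\<forall>(x, y)\<in>G. J *\<^sub>V x = y"
      using isometric_graph_total[OF G] by blast
    then show ?thesis using sup by (intro exI[of _ J]) force
  next
    assume "fst ` ?G = UNIV"
    then obtain J where "\<forall>x. norm (J *\<^sub>V x) = norm x" "\<forall>(x, y)\<in>?G. J *\<^sub>V x = y"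
      using isometric_graph_total[OF G'] by blast
    then show ?thesis using sup by (intro exI[of _ J]) force
  qed
qed

text \<open>Equal norms make \<open>P x \<mapsto> D x\<close> a well-defined isometry between the
  ranges. Both alternatives occur: for D the backward shift and P its modulus, no isometry J
  satisfies JP = D, but the forward shift satisfies JD = P.\<close>

lemma ex_polar_isometry:
  fixes D P :: "'a::chilbert_space \<Rightarrow>\<^sub>C\<^sub>L 'a"
  assumes "\<And>x. norm (P *\<^sub>V x) = norm (D *\<^sub>V x)"
  shows "\<exists>J. (\<forall>x. norm (J *\<^sub>V x) = norm x) \<and> (J o\<^sub>C\<^sub>L P = D \<or> J o\<^sub>C\<^sub>L D = P)"
proof -
  have "isometric_graph (range (\<lambda>x. (P *\<^sub>V x, D *\<^sub>V x)))"
    unfolding isometric_graph_def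
  proof (intro conjI complex_vector.subspaceI)
    show "0 \<in> range (\<lambda>x. (P *\<^sub>V x, D *\<^sub>V x))" by (rule image_eqI[of _ _ 0]) (auto simp: zero_prod_def)
    fix p q and c
    assume "p \<in> range (\<lambda>x. (P *\<^sub>V x, D *\<^sub>V x))"
    then obtain x where x: "p = (P *\<^sub>V x, D *\<^sub>V x)" by blast
    show "c *\<^sub>C p \<in> range (\<lambda>x. (P *\<^sub>V x, D *\<^sub>V x))"
      by (rule image_eqI[of _ _ "c *\<^sub>C x"]) (auto simp: x cblinfun_scaleC scaleC_prod_def)
    assume "q \<in> range (\<lambda>x. (P *\<^sub>V x, D *\<^sub>V x))"
    then obtain y where y: "q = (P *\<^sub>V y, D *\<^sub>V y)" by blast
    show "p + q \<in> range (\<lambda>x. (P *\<^sub>V x, D *\<^sub>V x))"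
      by (rule image_eqI[of _ _ "x + y"]) (auto simp: x y cblinfun_add)
  qed (auto simp: assms)
  from ex_isometry_extension[OF this] obtain J where
    J: "\<forall>x. norm (J *\<^sub>V x) = norm x"
    "(\<forall>x. J *\<^sub>V P *\<^sub>V x = D *\<^sub>V x) \<or> (\<forall>x. J *\<^sub>V D *\<^sub>V x = P *\<^sub>V x)"
    by auto
  then have "J o\<^sub>C\<^sub>L P = D \<or> J o\<^sub>C\<^sub>L D = P"
    by (auto intro: cblinfun_eqI)
  then show ?thesis using J by blast
qed

section \<open>Moments and resolvents\<close>

lemma cyclic_subspace_closed: "closed (cyclic_subspace E T x)"
  and cyclic_subspace_subspace: "complex_vector.subspace (cyclic_subspace E T x)"
  unfolding cyclic_subspace_def
  by (simp, intro closure_subspace complex_vector.subspace_span)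

lemma subspace_vimage_cblinfun:
  "complex_vector.subspace V \<Longrightarrow> complex_vector.subspace {x. X *\<^sub>V x \<in> V}"
  by (rule complex_vector.subspaceI) (simp_all add: cblinfun_add cblinfun_scaleC
      complex_vector.subspace_0 complex_vector.subspace_add complex_vector.subspace_scale)

lemma subspace_vimage_eval:
  "complex_vector.subspace V \<Longrightarrow> complex_vector.subspace {X. X *\<^sub>V x \<in> V}"
  by (rule complex_vector.subspaceI) (simp_all add:
      complex_vector.subspace_0 complex_vector.subspace_add complex_vector.subspace_scale)

lemma closed_vimage_cblinfun: "closed V \<Longrightarrow> closed {x. X *\<^sub>V x \<in> V}"
  using closed_vimage[of V "\<lambda>x. X *\<^sub>V x"]
  by (simp add: vimage_def continuous_intros)

lemma closed_vimage_eval: "closed V \<Longrightarrow> closed {X. X *\<^sub>V x \<in> V}"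
  using closed_vimage[of V "\<lambda>X. X *\<^sub>V x"]
  by (simp add: vimage_def continuous_intros)

lemma orth_complement_subspace:
  fixes X :: "'a::chilbert_space \<Rightarrow>\<^sub>C\<^sub>L 'a"
  shows "complex_vector.subspace {x. cinner (X *\<^sub>V x) y = 0}"
    and "closed {x. cinner (X *\<^sub>V x) y = 0}"
    and "complex_vector.subspace {y. cinner x y = 0}"
    and "closed {y. cinner x y = 0}"
proof -
  show "complex_vector.subspace {x. cinner (X *\<^sub>V x) y = 0}" "complex_vector.subspace {y. cinner x y = 0}"
    by (rule complex_vector.subspaceI; simp add: cblinfun_add cblinfun_scaleC cinner_add_left
        cinner_add_right cinner_scaleC_left cinner_scaleC_right)+
  show "closed {x. cinner (X *\<^sub>V x) y = 0}" "closed {y. cinner x y = 0}"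
    by (intro closed_Collect_eq continuous_intros)+
qed

section \<open>Cyclic subspaces\<close>

context
  fixes E T :: "'a::chilbert_space \<Rightarrow>\<^sub>C\<^sub>L 'a"
  assumes E: "orth_projection E" and T: "T \<in> corner E"
begin

lemma cyclic_subspace_subset:
  assumes "complex_vector.subspace V" and "closed V" and "\<And>n. corner_power E T n *\<^sub>V x \<in> V"
  shows "cyclic_subspace E T x \<subseteq> V"
  unfolding cyclic_subspace_def
proof (intro closure_minimal complex_vector.span_minimal assms)
  have "cstar_gen E T \<subseteq> {S. S *\<^sub>V x \<in> V}"
    by (intro cstar_gen_subset[OF E T] subspace_vimage_eval closed_vimage_eval) (simp_all add: assms)
  then show "(\<lambda>S. S *\<^sub>V x) ` cstar_gen E T \<subseteq> V" by blast
qed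

lemma cstar_gen_apply_in_cyclic_subspace:
  "S \<in> cstar_gen E T \<Longrightarrow> S *\<^sub>V x \<in> cyclic_subspace E T x"
  unfolding cyclic_subspace_def
  by (rule subsetD[OF closure_subset]) (blast intro: complex_vector.span_base)

lemma corner_power_apply_in_cyclic_subspace: "corner_power E T n *\<^sub>V x \<in> cyclic_subspace E T x"
  by (rule cstar_gen_apply_in_cyclic_subspace[OF corner_power_in_cstar_gen[OF E T]])

lemma base_in_cyclic_subspace: "E *\<^sub>V x \<in> cyclic_subspace E T x"
  using corner_power_apply_in_cyclic_subspace[of 0] by simp

section \<open>Resolvents of a positive operator, and the reflection built from moments\<close>

context
  assumes pos: "positive_op T"
begin

abbreviation (input) resolvent :: "real \<Rightarrow> 'a \<Rightarrow>\<^sub>C\<^sub>L 'a"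
  where "resolvent t \<equiv> corner_inverse E (E + complex_of_real t *\<^sub>C T)"

lemma resolvent_corner:
  assumes "0 \<le> t"
  shows "E *\<^sub>V resolvent t *\<^sub>V x = resolvent t *\<^sub>V x" and "resolvent t *\<^sub>V E *\<^sub>V x = resolvent t *\<^sub>V x"
    and "E o\<^sub>C\<^sub>L resolvent t = resolvent t"
  using cornerD[OF E cstar_gen_corner[OF E T corner_inverse(1)[OF E T pos assms]]] by blast+

lemma resolvent_eq:
  assumes "0 \<le> t"
  shows "resolvent t *\<^sub>V x + complex_of_real t *\<^sub>C T *\<^sub>V resolvent t *\<^sub>V x = E *\<^sub>V x"
    and "resolvent t + complex_of_real t *\<^sub>C (T o\<^sub>C\<^sub>L resolvent t) = E"
proof -
  show *: "resolvent t + complex_of_real t *\<^sub>C (T o\<^sub>C\<^sub>L resolvent t) = E"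
    using corner_inverse(3)[OF E T pos assms] resolvent_corner(3)[OF assms]
    by (simp add: cblinfun_compose_linear)
  show "resolvent t *\<^sub>V x + complex_of_real t *\<^sub>C T *\<^sub>V resolvent t *\<^sub>V x = E *\<^sub>V x"
    using arg_cong[OF *, of "\<lambda>X. X *\<^sub>V x"] by simp
qed

lemma resolvent_selfadjoint:
  assumes t: "0 \<le> t" shows "selfadjoint (resolvent t)"
  unfolding selfadjoint_iff
proof (intro allI)
  fix x y
  have sa: "cinner (T *\<^sub>V u) v = cinner u (T *\<^sub>V v)" for u v
    by (rule selfadjointD[OF selfadjoint_if_positive_op[OF pos]])
  have "cinner (resolvent t *\<^sub>V x) y = cinner (resolvent t *\<^sub>V x) (E *\<^sub>V y)"
    by (metis resolvent_corner(1)[OF t] selfadjointD[OF orth_projectionD(2)[OF E]])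
  also have "\<dots> = cinner (E *\<^sub>V x) (resolvent t *\<^sub>V y)"
    unfolding resolvent_eq(1)[OF t, symmetric]
    by (simp add: cinner_add_right cinner_add_left cinner_scaleC_left cinner_scaleC_right sa)
  also have "\<dots> = cinner x (resolvent t *\<^sub>V y)"
    by (metis resolvent_corner(1)[OF t] selfadjointD[OF orth_projectionD(2)[OF E]])
  finally show "cinner (resolvent t *\<^sub>V x) y = cinner x (resolvent t *\<^sub>V y)" .
qed

text \<open>Pair r + tTr = Ex with r, the image of x under the resolvent, and drop the nonnegative
  term containing T.\<close>

lemma resolvent_norm_le:
  assumes t: "0 \<le> t" shows "norm (resolvent t) \<le> 1"
proof (rule norm_cblinfun_le)
  fix x
  let ?r = "resolvent t *\<^sub>V x"
  have "0 \<le> t * Re (cinner (T *\<^sub>V ?r) ?r)" using t pos by (simp add: positive_op_iff)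
  then have "(norm ?r)\<^sup>2 \<le> Re (cinner (E *\<^sub>V x) ?r)"
    unfolding resolvent_eq(1)[OF t, symmetric]
    by (simp add: cinner_add_left cinner_scaleC_left cinner_self)
  also have "\<dots> = Re (cinner x ?r)"
    by (metis resolvent_corner(1)[OF t] selfadjointD[OF orth_projectionD(2)[OF E]])
  also have "\<dots> \<le> norm x * norm ?r"
    by (rule order_trans[OF complex_Re_le_cmod cinner_Cauchy_Schwarz])
  finally show "norm ?r \<le> 1 * norm x"
    by (cases "?r = 0") (simp_all add: power2_eq_square)
qed simp

lemma resolvent_tendsto: "(resolvent \<longlongrightarrow> E) (at_right 0)"
proof -
  have "((\<lambda>t. resolvent t - E) \<longlongrightarrow> 0) (at_right 0)"
  proof (rule Lim_null_comparison)
    show "((\<lambda>t. t * norm T) \<longlongrightarrow> 0) (at_right 0)"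
      by (rule tendsto_mult_left_zero) (rule tendsto_ident_at)
    show "\<forall>\<^sub>F t in at_right 0. norm (resolvent t - E) \<le> t * norm T"
      using eventually_at_right_less
    proof (rule eventually_mono)
      fix t :: real assume t: "0 < t"
      have "norm (E - resolvent t) = t * norm (T o\<^sub>C\<^sub>L resolvent t)"
        using t resolvent_eq(2)[of t] norm_scaleC[of "complex_of_real t" "T o\<^sub>C\<^sub>L resolvent t"]
        by (metis add_diff_cancel_left' norm_of_real abs_of_pos less_imp_le)
      also have "\<dots> \<le> t * (norm T * 1)"
        using t resolvent_norm_le[of t]
        by (intro mult_left_mono order_trans[OF norm_cblinfun_compose]) auto
      finally show "norm (resolvent t - E) \<le> t * norm T" by (simp add: norm_minus_commute)
    qed
  qed
  then show ?thesis by (simp add: LIM_zero_iff)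
qed

text \<open>Letting \<open>t\<close> tend to \<open>0\<close> in \<open>T\<^sup>n(I + tT)\<^sup>-\<^sup>1 = T\<^sup>n - t T\<^sup>n\<^sup>+\<^sup>1(I + tT)\<^sup>-\<^sup>1\<close> extracts the moments one
  after the other; conversely \<open>(I + tT)\<^sup>-\<^sup>1\<close> is a limit of polynomials in \<open>T\<close>.\<close>

lemma moments_vanish_iff:
  fixes g :: "('a \<Rightarrow>\<^sub>C\<^sub>L 'a) \<Rightarrow> complex"
  assumes add: "\<And>X Y. g (X + Y) = g X + g Y" and scale: "\<And>c X. g (c *\<^sub>C X) = c * g X"
    and cont: "continuous_on UNIV g"
  shows "(\<forall>n. g (corner_power E T n) = 0) \<longleftrightarrow> (\<forall>t>0. g (resolvent t) = 0)"
proof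
  assume *: "\<forall>n. g (corner_power E T n) = 0"
  have g0: "g 0 = 0" using scale[of 0 0] by simp
  have "cstar_gen E T \<subseteq> {X. g X = 0}"
    by (intro cstar_gen_subset[OF E T] complex_vector.subspaceI closed_Collect_eq
        continuous_intros cont) (use * in \<open>simp_all add: add scale g0\<close>)
  then show "\<forall>t>0. g (resolvent t) = 0"
    using corner_inverse(1)[OF E T pos, OF less_imp_le] by blast
next
  assume *: "\<forall>t>0. g (resolvent t) = 0"
  have lim: "g (corner_power E T n) = 0"
    if "\<forall>t>0. g (corner_power E T n o\<^sub>C\<^sub>L resolvent t) = 0" for n
  proof -
    have "((\<lambda>t. g (corner_power E T n o\<^sub>C\<^sub>L resolvent t)) \<longlongrightarrow> g (corner_power E T n o\<^sub>C\<^sub>L E)) (at_right 0)"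
      by (intro continuous_on_tendsto_compose[OF cont] tendsto_intros resolvent_tendsto) auto
    moreover have "\<forall>\<^sub>F t in at_right 0. g (corner_power E T n o\<^sub>C\<^sub>L resolvent t) = 0"
      using eventually_at_right_less by (rule eventually_mono) (use that in blast)
    ultimately have "((\<lambda>t::real. 0) \<longlongrightarrow> g (corner_power E T n o\<^sub>C\<^sub>L E)) (at_right 0)"
      by (rule Lim_transform_eventually)
    then show ?thesis
      by (simp add: tendsto_const_iff corner_power_corner[OF E T])
  qed
  have "\<forall>t>0. g (corner_power E T n o\<^sub>C\<^sub>L resolvent t) = 0" for n
  proof (induction n)
    case 0
    then show ?case using * by (simp add: resolvent_corner)
  next
    case (Suc n)
    show ?case
    proof (intro allI impI)
      fix t :: real assume t: "0 < t"
      have "corner_power E T n o\<^sub>C\<^sub>L T = T o\<^sub>C\<^sub>L corner_power E T n"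
        using corner_power_add[OF E T, of n "Suc 0"] by (simp add: cornerD[OF E T])
      then have "corner_power E T (Suc n) = corner_power E T n o\<^sub>C\<^sub>L T" by simp
      moreover have "corner_power E T n o\<^sub>C\<^sub>L (resolvent t + complex_of_real t *\<^sub>C (T o\<^sub>C\<^sub>L resolvent t))
          = corner_power E T n"
        using t by (simp only: resolvent_eq(2) corner_power_corner[OF E T])
      ultimately have "corner_power E T n = corner_power E T n o\<^sub>C\<^sub>L resolvent t
          + complex_of_real t *\<^sub>C (corner_power E T (Suc n) o\<^sub>C\<^sub>L resolvent t)"
        by (simp add: cblinfun_compose_linear cblinfun_compose_assoc)
      \<comment> \<open>Of the three terms, the left side vanishes by the limit and the first
        summand by induction; dividing by t leaves the claim.\<close>
      from arg_cong[OF this, of g]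
      show "g (corner_power E T (Suc n) o\<^sub>C\<^sub>L resolvent t) = 0"
        using t Suc lim[OF Suc] by (simp add: add scale)
    qed
  qed
  then show "\<forall>n. g (corner_power E T n) = 0" using lim by blast
qed

text \<open>\<open>U\<close> is the reflection that fixes \<open>x + y\<close> and negates the cyclic subspace of \<open>x - y\<close>; by the
  moment conditions the former is orthogonal to the latter.\<close>

lemma ex_reflection_exchanging:
  assumes x: "E *\<^sub>V x = x" and y: "E *\<^sub>V y = y"
    and moments: "\<And>n. cinner (corner_power E T n *\<^sub>V x) x = cinner (corner_power E T n *\<^sub>V y) y"
    and orth: "\<And>n. cinner (corner_power E T n *\<^sub>V y) x = 0"
  shows "\<exists>U. corner_unitary E U \<and> selfadjoint U \<and> y = U *\<^sub>V x \<and> U o\<^sub>C\<^sub>L T = T o\<^sub>C\<^sub>L U"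
proof -
  define M where "M = cyclic_subspace E T (x - y)"
  have sub: "complex_vector.subspace M" and cl: "closed M"
    unfolding M_def by (rule cyclic_subspace_subspace cyclic_subspace_closed)+
  obtain P where P: "orth_projection P" and PM: "\<And>u. P *\<^sub>V u \<in> M"
    and P_orth: "\<And>u m. m \<in> M \<Longrightarrow> cinner (u - P *\<^sub>V u) m = 0"
    using ex_orth_projection_onto[OF sub cl] by blast
  have saT: "selfadjoint T" and saE: "selfadjoint E" and saP: "selfadjoint P"
    using selfadjoint_if_positive_op[OF pos] orth_projectionD(2)[OF E] orth_projectionD(2)[OF P]
    by blast+
  have P_unique: "P *\<^sub>V u = m" if m: "m \<in> M" "\<And>k. k \<in> M \<Longrightarrow> cinner (u - m) k = 0" for u m
  proof -
    have k: "m - P *\<^sub>V u \<in> M" by (intro complex_vector.subspace_diff[OF sub] PM m)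
    have "cinner (u - P *\<^sub>V u) (m - P *\<^sub>V u) - cinner (u - m) (m - P *\<^sub>V u) = 0"
      by (simp add: m(2)[OF k] P_orth[OF k])
    then have "cinner (m - P *\<^sub>V u) (m - P *\<^sub>V u) = 0" by (simp add: cinner_diff_left)
    then show ?thesis by (simp add: cinner_self)
  qed
  have EM: "E *\<^sub>V m = m" if "m \<in> M" for m
  proof -
    have "M \<subseteq> {m. E *\<^sub>V m = m}"
      unfolding M_def
    proof (intro cyclic_subspace_subset closed_Collect_eq continuous_intros)
      show "corner_power E T n *\<^sub>V (x - y) \<in> {m. E *\<^sub>V m = m}" for n
        using arg_cong[OF corner_power_corner(1)[OF E T, of n], of "\<lambda>X. X *\<^sub>V (x - y)"] by simp
    qed (rule complex_vector.subspaceI; simp add: cblinfun_add cblinfun_scaleC)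
    then show ?thesis using that by blast
  qed
  have TM: "T *\<^sub>V m \<in> M" if "m \<in> M" for m
  proof -
    have "M \<subseteq> {m. T *\<^sub>V m \<in> M}"
      unfolding M_def
    proof (intro cyclic_subspace_subset subspace_vimage_cblinfun closed_vimage_cblinfun
        cyclic_subspace_subspace cyclic_subspace_closed)
      show "corner_power E T n *\<^sub>V (x - y) \<in> {m. T *\<^sub>V m \<in> cyclic_subspace E T (x - y)}" for n
        using corner_power_apply_in_cyclic_subspace[of "Suc n" "x - y"] by simp
    qed
    then show ?thesis using that by blast
  qed
  have plus_orth: "cinner (x + y) m = 0" if "m \<in> M" for m
  proof -
    have "M \<subseteq> {m. cinner (x + y) m = 0}"
      unfolding M_def
    proof (intro cyclic_subspace_subset orth_complement_subspace)
      fix n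
      note sa = selfadjointD[OF corner_power_selfadjoint[OF E T saT, of n]]
      have "cinner (corner_power E T n *\<^sub>V x) y = cnj (cinner (corner_power E T n *\<^sub>V y) x)"
        unfolding sa[of x y] by (rule cinner_commute)
      \<comment> \<open>The diagonal terms cancel because the moments agree, and both mixed terms
        vanish.\<close>
      then have "cinner (corner_power E T n *\<^sub>V (x + y)) (x - y) = 0"
        by (simp add: cblinfun_add cinner_add_left cinner_diff_right moments orth)
      then show "corner_power E T n *\<^sub>V (x - y) \<in> {m. cinner (x + y) m = 0}" by (simp add: sa)
    qed
    then show ?thesis using that by blast
  qed
  have EP: "E *\<^sub>V P *\<^sub>V u = P *\<^sub>V u" for u by (rule EM[OF PM])
  have PE: "P *\<^sub>V E *\<^sub>V u = P *\<^sub>V u" for u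
  proof (rule cinner_eqI)
    fix v
    show "cinner v (P *\<^sub>V E *\<^sub>V u) = cinner v (P *\<^sub>V u)"
      by (simp only: selfadjointD[OF saP, of v "E *\<^sub>V u", symmetric] EP
          selfadjointD[OF saE, of "P *\<^sub>V v" u, symmetric] selfadjointD[OF saP, of v u])
  qed
  \<comment> \<open>T maps M into itself and, being self-adjoint, also the orthogonal complement of
    M; so it commutes with the projection.\<close>
  have PT: "P *\<^sub>V T *\<^sub>V u = T *\<^sub>V P *\<^sub>V u" for u
  proof (rule P_unique)
    fix k assume "k \<in> M"
    then have "cinner (u - P *\<^sub>V u) (T *\<^sub>V k) = 0" by (intro P_orth TM)
    then show "cinner (T *\<^sub>V u - T *\<^sub>V P *\<^sub>V u) k = 0"
      by (simp add: cblinfun_diff[symmetric] selfadjointD[OF saT])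
  qed (intro TM PM)
  have "x - y \<in> M"
    using base_in_cyclic_subspace[of "x - y"] by (simp add: M_def cblinfun_diff x y)
  then have P_minus: "P *\<^sub>V (x - y) = x - y" by (intro P_unique) simp_all
  have P_plus: "P *\<^sub>V (x + y) = 0"
    by (intro P_unique complex_vector.subspace_0[OF sub]) (simp add: plus_orth)
  define U where "U = E - complex_of_real 2 *\<^sub>C P"
  have U: "U *\<^sub>V u = E *\<^sub>V u - (P *\<^sub>V u + P *\<^sub>V u)" for u
    by (simp add: U_def scaleC_add_left[of 1 1, simplified])
  have saU: "selfadjoint U"
    unfolding selfadjoint_iff using selfadjointD[OF saP] selfadjointD[OF saE]
    by (simp add: U cinner_diff_left cinner_diff_right cinner_add_left cinner_add_right)
  have UU: "U o\<^sub>C\<^sub>L U = E"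
    by (rule cblinfun_eqI) (simp add: U cblinfun_diff cblinfun_add PE EP
        orth_projectionD(3)[OF E] orth_projectionD(3)[OF P])
  have "U \<in> corner E"
    by (intro cornerI cblinfun_eqI)
      (simp_all add: U cblinfun_diff cblinfun_add PE EP orth_projectionD(3)[OF E])
  then have "corner_unitary E U"
    using saU UU by (simp add: corner_unitary_def selfadjoint_def)
  moreover have "U o\<^sub>C\<^sub>L T = T o\<^sub>C\<^sub>L U"
    by (rule cblinfun_eqI) (simp add: U PT cblinfun_diff cblinfun_add cornerD[OF E T])
  moreover have "y = U *\<^sub>V x"
  proof -
    \<comment> \<open>Splitting 2x as (x + y) + (x - y) gives 2Px = x - y, hence Ux = x - (x -
      y).\<close>
    have "P *\<^sub>V x + P *\<^sub>V x = P *\<^sub>V (x + y) + P *\<^sub>V (x - y)"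
      by (simp add: cblinfun_add cblinfun_diff)
    then have "P *\<^sub>V x + P *\<^sub>V x = x - y" by (simp only: P_plus P_minus add_0_left)
    then show ?thesis by (simp add: U x)
  qed
  ultimately show ?thesis using saU by blast
qed

end

end

section \<open>Block operators\<close>

lemma rank_one_projection_apply:
  assumes P: "orth_projection B" and one: "rank_one B"
    and e: "e \<in> range (cblinfun_apply B)" and norm: "norm e = 1"
  shows "B *\<^sub>V x = cinner x e *\<^sub>C e"
proof -
  obtain v where v: "range (cblinfun_apply B) = cspan {v}" using one by (auto simp: rank_one_def)
  obtain k where k: "e = k *\<^sub>C v" using e by (auto simp: v complex_vector.span_singleton)
  then have k0: "k \<noteq> 0" using norm by auto
  have "B *\<^sub>V x \<in> cspan {v}" using v by blast
  then obtain l where "B *\<^sub>V x = l *\<^sub>C v" by (auto simp: complex_vector.span_singleton)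
  then have c: "B *\<^sub>V x = (l / k) *\<^sub>C e" using k k0 by (simp add: scaleC_scaleC)
  have "B *\<^sub>V e = e" using e orth_projectionD(3)[OF P] by auto
  then have "cinner x e = cinner (B *\<^sub>V x) e" by (metis selfadjointD[OF orth_projectionD(2)[OF P]])
  also have "\<dots> = l / k" by (simp add: c cinner_scaleC_left cinner_self norm)
  finally show ?thesis using c by simp
qed

lemma norm_eq_if_attained:
  assumes "0 \<le> k" and "\<And>x. (norm (X *\<^sub>V x))\<^sup>2 \<le> k * (norm x)\<^sup>2"
    and "x \<noteq> 0" and "(norm (X *\<^sub>V x))\<^sup>2 = k * (norm x)\<^sup>2"
  shows "(norm X)\<^sup>2 = k"
proof (rule antisym)
  have "norm X \<le> sqrt k"
  proof (rule norm_cblinfun_le)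
    show "norm (X *\<^sub>V y) \<le> sqrt k * norm y" for y
    proof (rule power2_le_imp_le)
      show "(norm (X *\<^sub>V y))\<^sup>2 \<le> (sqrt k * norm y)\<^sup>2"
        using assms(1) assms(2)[of y] by (simp add: power_mult_distrib)
    qed (simp add: assms(1))
  qed (simp add: assms(1))
  then show "(norm X)\<^sup>2 \<le> k"
    using assms(1) power_mono[of "norm X" "sqrt k" 2] by simp
  have "(norm (X *\<^sub>V x))\<^sup>2 \<le> (norm X * norm x)\<^sup>2" by (intro power_mono norm_cblinfun) simp
  then show "k \<le> (norm X)\<^sup>2" using assms(3,4) by (simp add: power_mult_distrib)
qed

text \<open>By homogeneity the coefficient of y can be normalised to 1, leaving one complex
  parameter.\<close>

lemma pythagoras_orth_unit_iff:
  fixes x y :: "'a::complex_normed_vector"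
  assumes x: "norm x = 1" and y: "norm y = 1"
  shows "x \<bottom>\<^sub>P y \<longleftrightarrow> (\<forall>c. (norm (c *\<^sub>C x + y))\<^sup>2 = 1 + (cmod c)\<^sup>2)"
proof
  assume "x \<bottom>\<^sub>P y"
  then have "(norm (c *\<^sub>C x + 1 *\<^sub>C y))\<^sup>2 = (cmod c)\<^sup>2 * (norm x)\<^sup>2 + (cmod 1)\<^sup>2 * (norm y)\<^sup>2" for c
    unfolding pythagoras_orth_iff by blast
  then show "\<forall>c. (norm (c *\<^sub>C x + y))\<^sup>2 = 1 + (cmod c)\<^sup>2" by (simp add: assms)
next
  assume *: "\<forall>c. (norm (c *\<^sub>C x + y))\<^sup>2 = 1 + (cmod c)\<^sup>2"
  show "x \<bottom>\<^sub>P y"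
    unfolding pythagoras_orth_iff
  proof (intro allI)
    fix r s
    show "(norm (r *\<^sub>C x + s *\<^sub>C y))\<^sup>2 = (cmod r)\<^sup>2 * (norm x)\<^sup>2 + (cmod s)\<^sup>2 * (norm y)\<^sup>2"
    proof (cases "s = 0")
      case False
      then have "r *\<^sub>C x + s *\<^sub>C y = s *\<^sub>C ((r / s) *\<^sub>C x + y)"
        by (simp add: scaleC_add_right scaleC_scaleC)
      then have "(norm (r *\<^sub>C x + s *\<^sub>C y))\<^sup>2 = (cmod s)\<^sup>2 * (1 + (cmod (r / s))\<^sup>2)"
        using * by (simp only: norm_scaleC power_mult_distrib)
      then show ?thesis using False by (simp add: assms norm_divide power_divide distrib_left)
    qed (simp add: assms norm_scaleC power_mult_distrib)
  qed
qed

section \<open>The splitting of the space along a rank one projection\<close>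

locale rank_one_projection =
  fixes B :: "'h::chilbert_space \<Rightarrow>\<^sub>C\<^sub>L 'h" and e :: 'h
  assumes B_apply: "\<And>x. B *\<^sub>V x = cinner x e *\<^sub>C e" and norm_e: "norm e = 1"
begin

lemma cinner_e [simp]: "cinner e e = 1"
  by (simp add: cinner_self norm_e)

lemma ker_iff: "x \<in> ker B \<longleftrightarrow> cinner x e = 0"
  using norm_e by (auto simp: ker_def B_apply)

lemma norm_decomposition: "cinner z e = 0 \<Longrightarrow> (norm (\<alpha> *\<^sub>C e + z))\<^sup>2 = (cmod \<alpha>)\<^sup>2 + (norm z)\<^sup>2"
  using cinner_commute[of e z] by (simp add: norm_add_sq cinner_scaleC_left norm_scaleC norm_e)

lemma E_ident: "cinner x e = 0 \<Longrightarrow> ker_id B *\<^sub>V x = x"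
  by (simp add: B_apply)

lemma cinner_E_e [simp]: "cinner (ker_id B *\<^sub>V x) e = 0"
  by (simp add: B_apply cinner_diff_left cinner_scaleC_left)

lemma decomposition: "x = cinner x e *\<^sub>C e + ker_id B *\<^sub>V x"
  by (simp add: B_apply)

lemma norm_B: "norm B = 1"
proof -
  have "(norm B)\<^sup>2 = 1"
  proof (rule norm_eq_if_attained)
    show "(norm (B *\<^sub>V x))\<^sup>2 \<le> 1 * (norm x)\<^sup>2" for x
      using cinner_Cauchy_Schwarz[of x e]
      by (simp add: B_apply norm_scaleC norm_e power_mono)
    show "e \<noteq> 0" using norm_e by auto
  qed (simp_all add: B_apply norm_e)
  then show ?thesis using norm_ge_zero[of B] by (simp add: power2_eq_1_iff)
qed

lemma E_proj: "orth_projection (ker_id B)"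
  unfolding orth_projection_def selfadjoint_iff
proof (intro conjI allI cblinfun_eqI)
  show "(ker_id B o\<^sub>C\<^sub>L ker_id B) *\<^sub>V x = ker_id B *\<^sub>V x" for x
    by (simp add: B_apply cinner_diff_left cinner_scaleC_left)
  show "cinner (ker_id B *\<^sub>V x) z = cinner x (ker_id B *\<^sub>V z)" for x z
    by (simp add: B_apply cinner_diff_left cinner_diff_right cinner_scaleC_left cinner_scaleC_right)
      (metis cinner_commute)
qed

lemma corner_iff: "C \<in> corner (ker_id B) \<longleftrightarrow> C *\<^sub>V e = 0 \<and> (\<forall>x. cinner (C *\<^sub>V x) e = 0)"
proof
  assume C: "C \<in> corner (ker_id B)"
  have "ker_id B *\<^sub>V e = 0" by (simp add: B_apply)
  then have "C *\<^sub>V e = 0"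
    using cornerD(4)[OF E_proj C, of e] by (metis cblinfun_zero_right)
  moreover have "cinner (C *\<^sub>V x) e = 0" for x
    using arg_cong[OF cornerD(3)[OF E_proj C, of x], of "\<lambda>u. cinner u e"]
    by (simp add: B_apply cinner_diff_left cinner_scaleC_left)
  ultimately show "C *\<^sub>V e = 0 \<and> (\<forall>x. cinner (C *\<^sub>V x) e = 0)" by blast
next
  assume "C *\<^sub>V e = 0 \<and> (\<forall>x. cinner (C *\<^sub>V x) e = 0)"
  then show "C \<in> corner (ker_id B)"
    by (intro cornerI cblinfun_eqI) (simp_all add: B_apply cblinfun_diff cblinfun_scaleC)
qed

end

text \<open>Orthogonality to B and the relation between the norms of a and b are left open, so that
  all three claims of the theorem can be proved in this one setting.\<close>

locale block_operator = rank_one_projection B e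
  for B :: "'h::chilbert_space \<Rightarrow>\<^sub>C\<^sub>L 'h" and e :: 'h +
  fixes a b :: 'h and A C :: "'h \<Rightarrow>\<^sub>C\<^sub>L 'h"
  assumes form: "block_form B e A a b C" and C_pos: "positive_op C" and norm_A: "norm A = 1"
begin

abbreviation E where "E \<equiv> ker_id B"
abbreviation T where "T \<equiv> block_defect B a C"
abbreviation y where "y \<equiv> C *\<^sub>V b"
abbreviation R where "R \<equiv> resolvent E T"

lemma a_orth: "cinner a e = 0" and b_orth: "cinner b e = 0" and C_corner: "C \<in> corner E"
  and A_apply: "cinner z e = 0 \<Longrightarrow> A *\<^sub>V (\<alpha> *\<^sub>C e + z) = cinner z a *\<^sub>C e + (\<alpha> *\<^sub>C b + C *\<^sub>V z)"
  using form by (auto simp: block_form_def ker_iff)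

lemma C_selfadjoint: "cinner (C *\<^sub>V x) z = cinner x (C *\<^sub>V z)"
  by (rule selfadjointD[OF selfadjoint_if_positive_op[OF C_pos]])

lemma adj_C: "adj C = C"
  using selfadjoint_if_positive_op[OF C_pos] by (simp add: selfadjoint_def)

lemma C_orth: "cinner (C *\<^sub>V x) e = 0" and C_e: "C *\<^sub>V e = 0"
  using C_corner by (auto simp: corner_iff)

lemma T_apply: "T *\<^sub>V x = E *\<^sub>V x - cinner x a *\<^sub>C a - C *\<^sub>V C *\<^sub>V x"
  by (simp add: block_defect_def)

lemma T_selfadjoint: "selfadjoint T"
  unfolding selfadjoint_iff T_apply using selfadjointD[OF orth_projectionD(2)[OF E_proj]]
  by (simp add: cinner_diff_left cinner_diff_right cinner_scaleC_left cinner_scaleC_right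
      C_selfadjoint del: minus_cblinfun.rep_eq) (metis cinner_commute)

lemma T_corner: "T \<in> corner E"
proof (rule cornerI; rule cblinfun_eqI)
  fix x
  have "cinner (T *\<^sub>V x) e = 0"
    by (simp add: T_apply cinner_diff_left cinner_scaleC_left a_orth C_orth
        del: minus_cblinfun.rep_eq)
  then show "(E o\<^sub>C\<^sub>L T) *\<^sub>V x = T *\<^sub>V x" by (simp only: cblinfun_compose.rep_eq E_ident)
  have "cinner e a = 0" using a_orth cinner_commute[of e a] by simp
  then show "(T o\<^sub>C\<^sub>L E) *\<^sub>V x = T *\<^sub>V x"
    by (simp add: T_apply B_apply cblinfun_diff cblinfun_scaleC C_e cinner_diff_left cinner_scaleC_left)
qed

lemma T_form:
  assumes "cinner z e = 0"
  shows "Re (cinner (T *\<^sub>V z) z) = (norm z)\<^sup>2 - (cmod (cinner z a))\<^sup>2 - (norm (C *\<^sub>V z))\<^sup>2"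
proof -
  have "cinner a z = cnj (cinner z a)" by (rule cinner_commute)
  moreover have "(cmod (cinner z a))\<^sup>2 = Re (cinner z a) * Re (cinner z a) + Im (cinner z a) * Im (cinner z a)"
    unfolding cmod_power2 by (simp only: power2_eq_square)
  ultimately show ?thesis
    using assms unfolding T_apply E_ident[OF assms]
    by (simp add: cinner_diff_left cinner_scaleC_left C_selfadjoint cinner_self)
qed

lemma norm_A_apply:
  assumes "cinner z e = 0"
  shows "(norm (\<mu> *\<^sub>C A *\<^sub>V (\<alpha> *\<^sub>C e + z) + B *\<^sub>V (\<alpha> *\<^sub>C e + z)))\<^sup>2
    = (cmod (\<mu> * cinner z a + \<alpha>))\<^sup>2 + (cmod \<mu>)\<^sup>2 * (norm (\<alpha> *\<^sub>C b + C *\<^sub>V z))\<^sup>2"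
proof -
  have "\<mu> *\<^sub>C A *\<^sub>V (\<alpha> *\<^sub>C e + z) + B *\<^sub>V (\<alpha> *\<^sub>C e + z)
      = (\<mu> * cinner z a + \<alpha>) *\<^sub>C e + \<mu> *\<^sub>C (\<alpha> *\<^sub>C b + C *\<^sub>V z)"
    using assms by (simp add: A_apply B_apply cinner_add_left cinner_scaleC_left scaleC_add_right
        scaleC_add_left scaleC_scaleC)
  moreover have "cinner (\<mu> *\<^sub>C (\<alpha> *\<^sub>C b + C *\<^sub>V z)) e = 0"
    by (simp add: cinner_scaleC_left cinner_add_left b_orth C_orth)
  ultimately show ?thesis by (simp only: norm_decomposition norm_scaleC power_mult_distrib)
qed

text \<open>On the kernel of B the form of T at z is the squared norm of z minus that of Az, so
  positivity is contractivity of the second column.\<close>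

lemma T_pos: "positive_op T"
proof (rule positive_opI[OF T_selfadjoint])
  fix x
  let ?z = "E *\<^sub>V x"
  have "A *\<^sub>V ?z = cinner ?z a *\<^sub>C e + C *\<^sub>V ?z"
    using A_apply[OF cinner_E_e, of 0 x] by simp
  then have "(cmod (cinner ?z a))\<^sup>2 + (norm (C *\<^sub>V ?z))\<^sup>2 = (norm (A *\<^sub>V ?z))\<^sup>2"
    by (simp only: norm_decomposition[OF C_orth])
  also have "\<dots> \<le> (norm ?z)\<^sup>2"
    using norm_cblinfun[of A ?z] by (intro power_mono) (simp_all add: norm_A)
  finally have "0 \<le> Re (cinner (T *\<^sub>V ?z) ?z)" by (simp only: T_form[OF cinner_E_e])
  moreover have "cinner (T *\<^sub>V ?z) ?z = cinner (T *\<^sub>V x) x"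
    by (metis cornerD(3,4)[OF E_proj T_corner] selfadjointD[OF orth_projectionD(2)[OF E_proj]])
  ultimately show "0 \<le> Re (cinner (T *\<^sub>V x) x)" by simp
qed

lemmas R_corner = resolvent_corner[OF E_proj T_corner T_pos]
  and R_eq = resolvent_eq[OF E_proj T_corner T_pos]
  and R_selfadjoint = resolvent_selfadjoint[OF E_proj T_corner T_pos]
  and R_tendsto = resolvent_tendsto[OF E_proj T_corner T_pos]

lemma y_orth: "cinner y e = 0"
  by (rule C_orth)

section \<open>The norm of a pencil and its Schur complement\<close>

text \<open>The quadratic form of \<open>(1 + |\<mu>|\<^sup>2) I - (\<mu>A + B)\<^sup>*(\<mu>A + B)\<close>.\<close>

definition defect_form :: "complex \<Rightarrow> complex \<Rightarrow> 'h \<Rightarrow> real" where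
  "defect_form \<mu> \<alpha> z = (1 - (norm b)\<^sup>2) * (cmod (\<mu> * cnj \<alpha>))\<^sup>2
    - 2 * Re (\<mu> * cnj \<alpha> * cinner z (a + \<mu> *\<^sub>C y))
    + ((norm z)\<^sup>2 + (cmod \<mu>)\<^sup>2 * Re (cinner (T *\<^sub>V z) z))"

text \<open>After expanding the squares, the terms in z alone assemble into T, and the mixed terms
  into the pairing of z with a + \<mu>Cb.\<close>

lemma norm_pencil:
  assumes z: "cinner z e = 0"
  shows "(norm ((\<mu> *\<^sub>C A + B) *\<^sub>V (\<alpha> *\<^sub>C e + z)))\<^sup>2
    = (1 + (cmod \<mu>)\<^sup>2) * (norm (\<alpha> *\<^sub>C e + z))\<^sup>2 - defect_form \<mu> \<alpha> z"
proof -
  define k where "k = cinner z a"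
  define l where "l = cinner z y"
  have "Re (cinner (\<alpha> *\<^sub>C b) (C *\<^sub>V z)) = Re (cnj \<alpha> * l)"
  proof -
    have "cinner (\<alpha> *\<^sub>C b) (C *\<^sub>V z) = \<alpha> * cinner y z"
      by (simp add: cinner_scaleC_left C_selfadjoint)
    also have "cinner y z = cnj l" unfolding l_def by (rule cinner_commute)
    finally show ?thesis by simp
  qed
  then have "(norm (\<alpha> *\<^sub>C b + C *\<^sub>V z))\<^sup>2
      = (cmod \<alpha>)\<^sup>2 * (norm b)\<^sup>2 + 2 * Re (cnj \<alpha> * l) + (norm (C *\<^sub>V z))\<^sup>2"
    by (simp only: norm_add_sq norm_scaleC power_mult_distrib)
  then have lhs: "(norm ((\<mu> *\<^sub>C A + B) *\<^sub>V (\<alpha> *\<^sub>C e + z)))\<^sup>2 = (cmod (\<mu> * k + \<alpha>))\<^sup>2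
      + (cmod \<mu>)\<^sup>2 * ((cmod \<alpha>)\<^sup>2 * (norm b)\<^sup>2 + 2 * Re (cnj \<alpha> * l) + (norm (C *\<^sub>V z))\<^sup>2)"
    using norm_A_apply[OF z, of \<mu> \<alpha>] by (simp add: k_def)
  have v: "cinner z (a + \<mu> *\<^sub>C y) = k + cnj \<mu> * l"
    by (simp add: k_def l_def cinner_add_right cinner_scaleC_right)
  have T: "Re (cinner (T *\<^sub>V z) z) = (norm z)\<^sup>2 - (cmod k)\<^sup>2 - (norm (C *\<^sub>V z))\<^sup>2"
    unfolding k_def by (rule T_form[OF z])
  show ?thesis
    unfolding lhs defect_form_def v T norm_decomposition[OF z] norm_mult complex_mod_cnj
    by (simp add: cmod_power2 power_mult_distrib) (simp add: algebra_simps power2_eq_square)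
qed

text \<open>The Schur complement of the defect form is \<open>1 - \<parallel>b\<parallel>\<^sup>2\<close> minus this number.\<close>

definition schur :: "complex \<Rightarrow> complex" where
  "schur \<mu> = cinner (R ((cmod \<mu>)\<^sup>2) *\<^sub>V (a + \<mu> *\<^sub>C y)) (a + \<mu> *\<^sub>C y)"

text \<open>Put v = a + \<mu>Cb and r its image under the resolvent. Writing v = r + tTr in the
  second slot turns the inner product of r and v into the form of E + tT at r, which is visibly real
  and nonnegative.\<close>

lemma schur_eq:
  "schur \<mu> = complex_of_real ((norm (R ((cmod \<mu>)\<^sup>2) *\<^sub>V (a + \<mu> *\<^sub>C y)))\<^sup>2
    + (cmod \<mu>)\<^sup>2 * Re (cinner (T *\<^sub>V R ((cmod \<mu>)\<^sup>2) *\<^sub>V (a + \<mu> *\<^sub>C y)) (R ((cmod \<mu>)\<^sup>2) *\<^sub>V (a + \<mu> *\<^sub>C y))))"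
proof -
  let ?v = "a + \<mu> *\<^sub>C y" and ?t = "(cmod \<mu>)\<^sup>2"
  have "E *\<^sub>V ?v = ?v"
    by (rule E_ident) (simp add: cinner_add_left cinner_scaleC_left a_orth y_orth)
  then have "schur \<mu> = cinner (R ?t *\<^sub>V ?v) (R ?t *\<^sub>V ?v + complex_of_real ?t *\<^sub>C T *\<^sub>V R ?t *\<^sub>V ?v)"
    unfolding schur_def by (subst R_eq(1)) (simp_all only: zero_le_power2)
  also have "\<dots> = complex_of_real ((norm (R ?t *\<^sub>V ?v))\<^sup>2)
      + complex_of_real ?t * cinner (T *\<^sub>V R ?t *\<^sub>V ?v) (R ?t *\<^sub>V ?v)"
    by (simp only: cinner_add_right cinner_scaleC_right cinner_self complex_cnj_complex_of_real
        selfadjointD[OF T_selfadjoint])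
  finally show ?thesis
    by (subst (asm) cinner_positive_op[OF T_pos]) simp
qed

lemma schur_real: "schur \<mu> = complex_of_real (Re (schur \<mu>))" and schur_nonneg: "0 \<le> Re (schur \<mu>)"
proof -
  show "schur \<mu> = complex_of_real (Re (schur \<mu>))" unfolding schur_eq by simp
  show "0 \<le> Re (schur \<mu>)" unfolding schur_eq using T_pos by (simp add: positive_op_iff)
qed

text \<open>Cauchy-Schwarz for the positive operator S = E + tT at the vectors z and r, the solution
  of Sr = v: the mixed value is the pairing of z with v, and the value at r is the Schur
  number.\<close>

lemma schur_Cauchy_Schwarz:
  assumes z: "cinner z e = 0"
  shows "(cmod (cinner z (a + \<mu> *\<^sub>C y)))\<^sup>2
    \<le> Re (schur \<mu>) * ((norm z)\<^sup>2 + (cmod \<mu>)\<^sup>2 * Re (cinner (T *\<^sub>V z) z))"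
proof -
  let ?v = "a + \<mu> *\<^sub>C y" and ?t = "(cmod \<mu>)\<^sup>2"
  let ?S = "E + complex_of_real ?t *\<^sub>C T"
  have S_sa: "selfadjoint ?S"
    using selfadjointD[OF orth_projectionD(2)[OF E_proj]] selfadjointD[OF T_selfadjoint]
    unfolding selfadjoint_iff plus_cblinfun.rep_eq scaleC_cblinfun.rep_eq
    by (simp only: cinner_add_left cinner_add_right cinner_scaleC_left cinner_scaleC_right
        complex_cnj_complex_of_real) simp
  have "positive_op ?S"
  proof (rule positive_opI[OF S_sa])
    fix x
    show "0 \<le> Re (cinner (?S *\<^sub>V x) x)"
      unfolding plus_cblinfun.rep_eq scaleC_cblinfun.rep_eq cinner_add_left cinner_scaleC_left
        cinner_orth_projection[OF E_proj]
      using T_pos by (simp add: positive_op_iff)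
  qed
  then have "(cmod (cinner (?S *\<^sub>V z) (R ?t *\<^sub>V ?v)))\<^sup>2
      \<le> Re (cinner (?S *\<^sub>V z) z) * Re (cinner (?S *\<^sub>V R ?t *\<^sub>V ?v) (R ?t *\<^sub>V ?v))"
    by (rule positive_op_Cauchy_Schwarz)
  moreover have "?S *\<^sub>V R ?t *\<^sub>V ?v = ?v"
  proof -
    have "?S *\<^sub>V R ?t *\<^sub>V ?v = E *\<^sub>V ?v"
      using corner_inverse(3)[OF E_proj T_corner T_pos, of ?t] by (metis cblinfun_compose.rep_eq zero_le_power2)
    also have "\<dots> = ?v"
      by (rule E_ident) (simp add: cinner_add_left cinner_scaleC_left a_orth y_orth)
    finally show ?thesis .
  qed
  moreover have "Re (cinner ?v (R ?t *\<^sub>V ?v)) = Re (schur \<mu>)"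
    unfolding schur_def by (subst cinner_commute) simp
  moreover have "Re (cinner (?S *\<^sub>V z) z) = (norm z)\<^sup>2 + ?t * Re (cinner (T *\<^sub>V z) z)"
    unfolding plus_cblinfun.rep_eq scaleC_cblinfun.rep_eq E_ident[OF z]
    by (simp add: cinner_add_left cinner_scaleC_left cinner_self)
  ultimately show ?thesis
    using selfadjointD[OF S_sa, of z "R ?t *\<^sub>V ?v"] by (simp only: mult.commute)
qed

text \<open>The vector completing the square in the defect form.\<close>

lemma defect_form_at_resolvent:
  assumes "\<mu> \<noteq> 0"
  shows "defect_form \<mu> (1 / cnj \<mu>) (R ((cmod \<mu>)\<^sup>2) *\<^sub>V (a + \<mu> *\<^sub>C y))
    = (1 - (norm b)\<^sup>2) - Re (schur \<mu>)"
proof -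
  define w where "w = R ((cmod \<mu>)\<^sup>2) *\<^sub>V (a + \<mu> *\<^sub>C y)"
  have "cinner w (a + \<mu> *\<^sub>C y) = schur \<mu>" by (simp only: schur_def w_def)
  moreover have "(norm w)\<^sup>2 + (cmod \<mu>)\<^sup>2 * Re (cinner (T *\<^sub>V w) w) = Re (schur \<mu>)"
    by (simp only: schur_eq w_def Re_complex_of_real)
  \<comment> \<open>With \<alpha> = 1 / cnj \<mu> the factor \<mu> * cnj \<alpha> is 1, and the last
    two terms of the form add up to minus the Schur number.\<close>
  ultimately show ?thesis
    using assms unfolding w_def[symmetric] defect_form_def by simp
qed

lemma R_orth: "cinner (R ((cmod \<mu>)\<^sup>2) *\<^sub>V x) e = 0"
  using R_corner(1)[of "(cmod \<mu>)\<^sup>2" x] cinner_E_e by (metis zero_le_power2)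

lemma Re_mult_le: "2 * Re (w * c) \<le> 2 * (cmod w * cmod c)"
  using complex_Re_le_cmod[of "w * c"] by (simp add: norm_mult)

text \<open>The norm bound makes the defect form nonnegative, and its value at the completing vector
  gives one inequality. Were that strict, the form would dominate a positive multiple of the squared
  norm and the norm of the pencil would be smaller than assumed.\<close>

lemma schur_eq_if_norm_pencil:
  assumes \<mu>: "\<mu> \<noteq> 0" and norm: "(norm (\<mu> *\<^sub>C A + B))\<^sup>2 = 1 + (cmod \<mu>)\<^sup>2"
  shows "schur \<mu> = complex_of_real (1 - (norm b)\<^sup>2)"
proof -
  define \<beta> where "\<beta> = 1 - (norm b)\<^sup>2"
  define f where "f = Re (schur \<mu>)"
  have f0: "0 \<le> f" unfolding f_def by (rule schur_nonneg)
  have nonneg: "0 \<le> defect_form \<mu> \<alpha> z" if z: "cinner z e = 0" for \<alpha> z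
  proof -
    have "(norm ((\<mu> *\<^sub>C A + B) *\<^sub>V (\<alpha> *\<^sub>C e + z)))\<^sup>2 \<le> (norm (\<mu> *\<^sub>C A + B) * norm (\<alpha> *\<^sub>C e + z))\<^sup>2"
      by (intro power_mono norm_cblinfun) simp
    then show ?thesis unfolding norm_pencil[OF z] power_mult_distrib norm by simp
  qed
  have "f \<le> \<beta>"
    using nonneg[OF R_orth[of \<mu> "a + \<mu> *\<^sub>C y"], of "1 / cnj \<mu>"]
    unfolding defect_form_at_resolvent[OF \<mu>] by (simp add: f_def \<beta>_def)
  moreover have "\<not> f < \<beta>"
  proof
    assume lt: "f < \<beta>"
    \<comment> \<open>A weight strictly between f and \<beta>: the mixed term is split by the
      inequality of means with weight \<kappa>, which leaves a positive share of both
      squares.\<close>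
    define \<kappa> where "\<kappa> = (f + \<beta>) / 2"
    have \<kappa>: "f < \<kappa>" "\<kappa> < \<beta>" "0 < \<kappa>" using lt f0 by (auto simp: \<kappa>_def)
    \<comment> \<open>The smaller of the two shares left over, measured against |\<alpha>|^2 and the
      squared norm of z; it is at most 1, so the radicand below stays nonnegative.\<close>
    define \<delta> where "\<delta> = min ((\<beta> - \<kappa>) * (cmod \<mu>)\<^sup>2) (1 - f / \<kappa>)"
    have "0 \<le> f / \<kappa>" using \<kappa> f0 by simp
    then have \<delta>: "0 < \<delta>" "\<delta> \<le> 1" using \<kappa> \<mu> by (auto simp: \<delta>_def)
    have lower: "\<delta> * ((cmod \<alpha>)\<^sup>2 + (norm z)\<^sup>2) \<le> defect_form \<mu> \<alpha> z" if z: "cinner z e = 0" for \<alpha> z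
    proof -
      define p where "p = cmod (\<mu> * cnj \<alpha>)"
      define c where "c = cmod (cinner z (a + \<mu> *\<^sub>C y))"
      define N where "N = (norm z)\<^sup>2 + (cmod \<mu>)\<^sup>2 * Re (cinner (T *\<^sub>V z) z)"
      have N: "(norm z)\<^sup>2 \<le> N" using T_pos by (simp add: N_def positive_op_iff)
      have "c\<^sup>2 \<le> f * N" unfolding c_def f_def N_def by (rule schur_Cauchy_Schwarz[OF z])
      moreover have "2 * (p * c) * \<kappa> \<le> \<kappa>\<^sup>2 * p\<^sup>2 + c\<^sup>2"
        using sum_squares_bound[of "\<kappa> * p" c] by (simp add: power_mult_distrib mult_ac)
      ultimately have "2 * (p * c) * \<kappa> \<le> (\<kappa> * p\<^sup>2 + f / \<kappa> * N) * \<kappa>"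
        using \<kappa> by (simp add: power2_eq_square algebra_simps)
      then have "2 * (p * c) \<le> \<kappa> * p\<^sup>2 + f / \<kappa> * N" using \<kappa> by simp
      moreover have "defect_form \<mu> \<alpha> z \<ge> \<beta> * p\<^sup>2 - 2 * (p * c) + N"
        unfolding defect_form_def p_def c_def N_def \<beta>_def
        using Re_mult_le[of "\<mu> * cnj \<alpha>" "cinner z (a + \<mu> *\<^sub>C y)"] by linarith
      ultimately have "defect_form \<mu> \<alpha> z \<ge> (\<beta> - \<kappa>) * p\<^sup>2 + (1 - f / \<kappa>) * N"
        by (simp add: algebra_simps)
      moreover have "(1 - f / \<kappa>) * N \<ge> \<delta> * (norm z)\<^sup>2"
        using N \<delta> by (intro mult_mono) (auto simp: \<delta>_def intro: order_trans[OF zero_le_power2])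
      moreover have "(\<beta> - \<kappa>) * p\<^sup>2 \<ge> \<delta> * (cmod \<alpha>)\<^sup>2"
        by (simp add: p_def norm_mult power_mult_distrib mult.assoc[symmetric] mult_right_mono \<delta>_def)
      ultimately show ?thesis by (simp add: distrib_left)
    qed
    have sq: "(sqrt (1 + (cmod \<mu>)\<^sup>2 - \<delta>))\<^sup>2 = 1 + (cmod \<mu>)\<^sup>2 - \<delta>"
      using \<delta> zero_le_power2[of "cmod \<mu>"] by (intro real_sqrt_pow2) linarith
    have "norm (\<mu> *\<^sub>C A + B) \<le> sqrt (1 + (cmod \<mu>)\<^sup>2 - \<delta>)"
    proof (rule norm_cblinfun_le)
      show "0 \<le> sqrt (1 + (cmod \<mu>)\<^sup>2 - \<delta>)" using \<delta> by (simp add: add_increasing2)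
      fix x
      define \<alpha> where "\<alpha> = cinner x e"
      define z where "z = E *\<^sub>V x"
      have z: "cinner z e = 0" by (simp add: z_def del: minus_cblinfun.rep_eq)
      have x: "x = \<alpha> *\<^sub>C e + z" unfolding \<alpha>_def z_def by (rule decomposition)
      have "(norm ((\<mu> *\<^sub>C A + B) *\<^sub>V x))\<^sup>2 \<le> (1 + (cmod \<mu>)\<^sup>2) * (norm x)\<^sup>2 - \<delta> * (norm x)\<^sup>2"
        unfolding x norm_pencil[OF z] using lower[OF z, of \<alpha>] by (simp add: norm_decomposition[OF z])
      also have "\<dots> = (sqrt (1 + (cmod \<mu>)\<^sup>2 - \<delta>) * norm x)\<^sup>2"
        by (simp add: power_mult_distrib sq algebra_simps)
      finally show "norm ((\<mu> *\<^sub>C A + B) *\<^sub>V x) \<le> sqrt (1 + (cmod \<mu>)\<^sup>2 - \<delta>) * norm x"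
        using \<delta> by (elim power2_le_imp_le) (simp add: add_increasing2)
    qed
    then have "(norm (\<mu> *\<^sub>C A + B))\<^sup>2 \<le> (sqrt (1 + (cmod \<mu>)\<^sup>2 - \<delta>))\<^sup>2"
      by (rule power_mono) simp
    then show False using \<delta> norm by (simp add: add_increasing2)
  qed
  ultimately have "f = \<beta>" by simp
  then show ?thesis using schur_real[of \<mu>] by (simp add: f_def \<beta>_def)
qed

text \<open>Cauchy-Schwarz with the constant \<beta> makes the defect form nonnegative, and the
  completing vector is a zero of it, so the norm is attained there.\<close>

lemma norm_pencil_if_schur_eq:
  assumes \<mu>: "\<mu> \<noteq> 0" and schur: "schur \<mu> = complex_of_real (1 - (norm b)\<^sup>2)"
  shows "(norm (\<mu> *\<^sub>C A + B))\<^sup>2 = 1 + (cmod \<mu>)\<^sup>2"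
proof (rule norm_eq_if_attained)
  define \<beta> where "\<beta> = 1 - (norm b)\<^sup>2"
  have \<beta>: "Re (schur \<mu>) = \<beta>" by (simp add: schur \<beta>_def)
  have \<beta>0: "0 \<le> \<beta>" using schur_nonneg[of \<mu>] \<beta> by simp
  fix x
  define \<alpha> where "\<alpha> = cinner x e"
  define z where "z = E *\<^sub>V x"
  have z: "cinner z e = 0" by (simp add: z_def del: minus_cblinfun.rep_eq)
  have x: "x = \<alpha> *\<^sub>C e + z" unfolding \<alpha>_def z_def by (rule decomposition)
  define p where "p = cmod (\<mu> * cnj \<alpha>)"
  define c where "c = cmod (cinner z (a + \<mu> *\<^sub>C y))"
  define N where "N = (norm z)\<^sup>2 + (cmod \<mu>)\<^sup>2 * Re (cinner (T *\<^sub>V z) z)"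
  have N: "0 \<le> N" using T_pos by (simp add: N_def positive_op_iff)
  have "c\<^sup>2 \<le> \<beta> * N" unfolding c_def N_def \<beta>[symmetric] by (rule schur_Cauchy_Schwarz[OF z])
  then have "c \<le> sqrt (\<beta> * N)" by (rule real_le_rsqrt)
  then have "2 * (p * c) \<le> 2 * (p * (sqrt \<beta> * sqrt N))"
    by (simp add: real_sqrt_mult p_def mult_left_mono)
  also have "\<dots> \<le> \<beta> * p\<^sup>2 + N"
    using sum_squares_bound[of "sqrt \<beta> * p" "sqrt N"] \<beta>0 N
    by (simp add: power_mult_distrib mult_ac)
  finally have "0 \<le> defect_form \<mu> \<alpha> z"
    unfolding defect_form_def
    using Re_mult_le[of "\<mu> * cnj \<alpha>" "cinner z (a + \<mu> *\<^sub>C y)"]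
    by (simp add: p_def c_def N_def \<beta>_def)
  then show "(norm ((\<mu> *\<^sub>C A + B) *\<^sub>V x))\<^sup>2 \<le> (1 + (cmod \<mu>)\<^sup>2) * (norm x)\<^sup>2"
    unfolding x norm_pencil[OF z] by simp
next
  let ?w = "R ((cmod \<mu>)\<^sup>2) *\<^sub>V (a + \<mu> *\<^sub>C y)"
  let ?x = "(1 / cnj \<mu>) *\<^sub>C e + ?w"
  show "(norm ((\<mu> *\<^sub>C A + B) *\<^sub>V ?x))\<^sup>2 = (1 + (cmod \<mu>)\<^sup>2) * (norm ?x)\<^sup>2"
    unfolding norm_pencil[OF R_orth] defect_form_at_resolvent[OF \<mu>] by (simp add: schur)
  \<comment> \<open>The component along e is 1 / cnj \<mu>, which is not zero.\<close>
  have "(norm ?x)\<^sup>2 \<noteq> 0"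
    unfolding norm_decomposition[OF R_orth] using \<mu> by (simp add: sum_power2_eq_zero_iff)
  then show "?x \<noteq> 0" by auto
qed simp

lemma pythagoras_orth_iff_schur:
  "A \<bottom>\<^sub>P B \<longleftrightarrow> (\<forall>\<mu>. \<mu> \<noteq> 0 \<longrightarrow> schur \<mu> = complex_of_real (1 - (norm b)\<^sup>2))"
proof -
  have "(norm (0 *\<^sub>C A + B))\<^sup>2 = 1 + (cmod 0)\<^sup>2" by (simp add: norm_B)
  then show ?thesis
    unfolding pythagoras_orth_unit_iff[OF norm_A norm_B]
    using schur_eq_if_norm_pencil norm_pencil_if_schur_eq by metis
qed

section \<open>From the resolvent identity to the moment conditions\<close>

lemma schur_expand:
  "schur \<mu> = cinner (R ((cmod \<mu>)\<^sup>2) *\<^sub>V a) a + complex_of_real ((cmod \<mu>)\<^sup>2) * cinner (R ((cmod \<mu>)\<^sup>2) *\<^sub>V y) y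
    + (\<mu> * cinner (R ((cmod \<mu>)\<^sup>2) *\<^sub>V y) a + cnj (\<mu> * cinner (R ((cmod \<mu>)\<^sup>2) *\<^sub>V y) a))"
proof -
  have "cinner (R ((cmod \<mu>)\<^sup>2) *\<^sub>V a) y = cnj (cinner (R ((cmod \<mu>)\<^sup>2) *\<^sub>V y) a)"
    by (metis cinner_commute selfadjointD[OF R_selfadjoint] zero_le_power2)
  moreover have "complex_of_real ((cmod \<mu>)\<^sup>2) = \<mu> * cnj \<mu>" by (rule complex_norm_square)
  ultimately show ?thesis
    unfolding schur_def cblinfun_add cblinfun_scaleC cinner_add_left cinner_add_right
      cinner_scaleC_left cinner_scaleC_right by (simp add: algebra_simps)
qed

text \<open>Averaging over the phase of \<open>\<mu>\<close> separates the mixed terms.\<close>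

lemma schur_constant_iff:
  "(\<forall>\<mu>. \<mu> \<noteq> 0 \<longrightarrow> schur \<mu> = \<kappa>) \<longleftrightarrow>
    (\<forall>t>0. cinner (R t *\<^sub>V y) a = 0 \<and> cinner (R t *\<^sub>V a) a + complex_of_real t * cinner (R t *\<^sub>V y) y = \<kappa>)"
    (is "?L \<longleftrightarrow> ?Q")
proof
  assume L: ?L
  show ?Q
  proof (intro allI impI)
    fix t :: real assume t: "0 < t"
    define c where "c = cinner (R t *\<^sub>V y) a"
    define d where "d = cinner (R t *\<^sub>V a) a + complex_of_real t * cinner (R t *\<^sub>V y) y"
    have *: "d + (\<mu> * c + cnj (\<mu> * c)) = \<kappa>" if "cmod \<mu> = sqrt t" for \<mu>
    proof -
      have "(cmod \<mu>)\<^sup>2 = t" "\<mu> \<noteq> 0" using that t by auto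
      then show ?thesis using L schur_expand[of \<mu>] by (simp add: c_def d_def)
    qed
    have s: "sqrt t \<noteq> 0" using t by simp
    \<comment> \<open>Four phases suffice: opposite signs isolate c, the real phases its real part
      and the imaginary phases its imaginary part.\<close>
    have 1: "d + (complex_of_real (sqrt t) * c + cnj (complex_of_real (sqrt t) * c)) = \<kappa>"
      "d + (- complex_of_real (sqrt t) * c + cnj (- complex_of_real (sqrt t) * c)) = \<kappa>"
      "d + (\<i> * complex_of_real (sqrt t) * c + cnj (\<i> * complex_of_real (sqrt t) * c)) = \<kappa>"
      "d + (- \<i> * complex_of_real (sqrt t) * c + cnj (- \<i> * complex_of_real (sqrt t) * c)) = \<kappa>"
      by (rule *; use t in \<open>simp add: norm_mult\<close>)+
    have "Re d + 2 * (sqrt t * Re c) = Re \<kappa>" "Re d - 2 * (sqrt t * Re c) = Re \<kappa>"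
      "Re d + 2 * (sqrt t * Im c) = Re \<kappa>" "Re d - 2 * (sqrt t * Im c) = Re \<kappa>"
      using arg_cong[OF 1(1), of Re] arg_cong[OF 1(2), of Re] arg_cong[OF 1(3), of Re]
        arg_cong[OF 1(4), of Re] by (simp_all add: mult.commute)
    then have "sqrt t * Re c = 0" "sqrt t * Im c = 0" by linarith+
    then have c: "c = 0" using s by (simp add: complex_eq_iff)
    then have "d = \<kappa>" using 1(1) by simp
    then show "cinner (R t *\<^sub>V y) a = 0
        \<and> cinner (R t *\<^sub>V a) a + complex_of_real t * cinner (R t *\<^sub>V y) y = \<kappa>"
      using c by (simp add: c_def d_def)
  qed
next
  assume Q: ?Q
  show ?L
  proof (intro allI impI)
    fix \<mu> :: complex assume "\<mu> \<noteq> 0"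
    then have "0 < (cmod \<mu>)\<^sup>2" by simp
    note Q[rule_format, OF this]
    then show "schur \<mu> = \<kappa>"
      unfolding schur_expand by (simp only: mult_zero_right complex_cnj_zero add_0_right)
  qed
qed

lemma norm_a_if_schur_constant:
  assumes "\<forall>\<mu>. \<mu> \<noteq> 0 \<longrightarrow> schur \<mu> = complex_of_real \<kappa>"
  shows "(norm a)\<^sup>2 = \<kappa>"
proof -
  have "((\<lambda>t. cinner (R t *\<^sub>V a) a + complex_of_real t * cinner (R t *\<^sub>V y) y)
      \<longlongrightarrow> cinner (E *\<^sub>V a) a + complex_of_real 0 * cinner (E *\<^sub>V y) y) (at_right 0)"
    by (intro tendsto_intros R_tendsto)
  moreover have "\<forall>\<^sub>F t in at_right 0. cinner (R t *\<^sub>V a) a + complex_of_real t * cinner (R t *\<^sub>V y) y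
      = complex_of_real \<kappa>"
    using eventually_at_right_less
    by (rule eventually_mono) (use assms[unfolded schur_constant_iff] in blast)
  ultimately have "((\<lambda>t::real. complex_of_real \<kappa>)
      \<longlongrightarrow> cinner (E *\<^sub>V a) a + complex_of_real 0 * cinner (E *\<^sub>V y) y) (at_right 0)"
    by (rule Lim_transform_eventually)
  then have "complex_of_real \<kappa> = cinner (E *\<^sub>V a) a"
    by (simp add: tendsto_const_iff del: minus_cblinfun.rep_eq)
  also have "\<dots> = complex_of_real ((norm a)\<^sup>2)" by (simp only: E_ident[OF a_orth] cinner_self)
  finally show ?thesis by (metis of_real_eq_iff)
qed

definition moment_conditions :: bool where
  "moment_conditions \<longleftrightarrow> (\<forall>n. cinner (corner_power E T n *\<^sub>V y) a = 0) \<and>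
    (\<forall>n. cinner (corner_power E T n *\<^sub>V y) y = cinner (corner_power E T (n + 1) *\<^sub>V a) a)"

text \<open>Each family is the vanishing of one linear functional on all powers of T, hence on all
  resolvents. For the second family, the identity a = Ra + tTRa paired with a is subtracted from the
  resolvent condition and the difference divided by t.\<close>

lemma moment_conditions_iff:
  "moment_conditions \<longleftrightarrow> (\<forall>\<mu>. \<mu> \<noteq> 0 \<longrightarrow> schur \<mu> = complex_of_real ((norm a)\<^sup>2))"
proof -
  have 1: "(\<forall>n. cinner (corner_power E T n *\<^sub>V y) a = 0) \<longleftrightarrow> (\<forall>t>0. cinner (R t *\<^sub>V y) a = 0)"
    by (intro moments_vanish_iff[OF E_proj T_corner T_pos] continuous_intros)
      (simp_all add: cinner_add_left cinner_scaleC_left)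
  have 2: "(\<forall>n. cinner (corner_power E T n *\<^sub>V y) y - cinner (T *\<^sub>V corner_power E T n *\<^sub>V a) a = 0)
      \<longleftrightarrow> (\<forall>t>0. cinner (R t *\<^sub>V y) y - cinner (T *\<^sub>V R t *\<^sub>V a) a = 0)"
    by (intro moments_vanish_iff[OF E_proj T_corner T_pos] continuous_intros)
      (simp_all add: cinner_add_left cinner_scaleC_left cblinfun_add cblinfun_scaleC right_diff_distrib)
  have 3: "cinner (R t *\<^sub>V a) a + complex_of_real t * cinner (R t *\<^sub>V y) y = complex_of_real ((norm a)\<^sup>2)
      \<longleftrightarrow> cinner (R t *\<^sub>V y) y - cinner (T *\<^sub>V R t *\<^sub>V a) a = 0" if t: "0 < t" for t
  proof -
    have "R t *\<^sub>V a + complex_of_real t *\<^sub>C T *\<^sub>V R t *\<^sub>V a = a"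
      using R_eq(1)[of t a] t by (simp only: E_ident[OF a_orth] less_imp_le)
    then have "cinner (R t *\<^sub>V a) a + complex_of_real t * cinner (T *\<^sub>V R t *\<^sub>V a) a
        = complex_of_real ((norm a)\<^sup>2)"
      by (metis cinner_add_left cinner_scaleC_left cinner_self)
    then have "cinner (R t *\<^sub>V a) a + complex_of_real t * cinner (R t *\<^sub>V y) y = complex_of_real ((norm a)\<^sup>2)
        \<longleftrightarrow> complex_of_real t * cinner (R t *\<^sub>V y) y = complex_of_real t * cinner (T *\<^sub>V R t *\<^sub>V a) a"
      by (metis add_left_cancel)
    then show ?thesis using t by simp
  qed
  have "moment_conditions \<longleftrightarrow> (\<forall>n. cinner (corner_power E T n *\<^sub>V y) a = 0) \<and>
      (\<forall>n. cinner (corner_power E T n *\<^sub>V y) y - cinner (T *\<^sub>V corner_power E T n *\<^sub>V a) a = 0)"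
    by (simp only: moment_conditions_def Suc_eq_plus1[symmetric] corner_power_Suc
        cblinfun_compose.rep_eq right_minus_eq)
  also have "\<dots> \<longleftrightarrow> (\<forall>t>0. cinner (R t *\<^sub>V y) a = 0 \<and>
      cinner (R t *\<^sub>V a) a + complex_of_real t * cinner (R t *\<^sub>V y) y = complex_of_real ((norm a)\<^sup>2))"
    unfolding 1 2 using 3 by blast
  finally show ?thesis unfolding schur_constant_iff .
qed

lemma pythagoras_orth_iff_moments:
  "A \<bottom>\<^sub>P B \<longleftrightarrow> (norm a)\<^sup>2 + (norm b)\<^sup>2 = 1 \<and> moment_conditions"
proof -
  have "(norm a)\<^sup>2 = 1 - (norm b)\<^sup>2 \<longleftrightarrow> (norm a)\<^sup>2 + (norm b)\<^sup>2 = 1" by auto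
  then show ?thesis
    unfolding pythagoras_orth_iff_schur moment_conditions_iff
    using norm_a_if_schur_constant by metis
qed

text \<open>The identity in the theorem ranges over all parameters, while the moments are extracted
  from nonzero ones; at 0 it holds automatically.\<close>

lemma schur_0: "schur 0 = complex_of_real ((norm a)\<^sup>2)"
proof -
  have "R 0 *\<^sub>V a = a" using R_eq(1)[of 0 a] by (simp add: E_ident[OF a_orth] del: minus_cblinfun.rep_eq)
  then show ?thesis by (simp add: schur_def cinner_self)
qed

section \<open>Moment conditions and the self-adjoint unitary\<close>

lemmas sqrt_T = pos_sqrt[OF E_proj T_corner T_pos]

lemma sqrt_T_apply: "pos_sqrt T *\<^sub>V pos_sqrt T *\<^sub>V x = T *\<^sub>V x"
  using sqrt_T(3) by (metis cblinfun_compose.rep_eq)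

text \<open>The root commutes with the powers of T, so its two copies merge into one more factor T.
  This is the origin of the index shift between the two sides of the moment conditions.\<close>

lemma cinner_corner_power_sqrt:
  "cinner (corner_power E T n *\<^sub>V pos_sqrt T *\<^sub>V x) (pos_sqrt T *\<^sub>V x)
    = cinner (corner_power E T (n + 1) *\<^sub>V x) x"
proof -
  let ?S = "pos_sqrt T"
  have comm: "?S o\<^sub>C\<^sub>L corner_power E T n = corner_power E T n o\<^sub>C\<^sub>L ?S"
  proof (rule cstar_gen_commute[OF E_proj T_corner corner_power_in_cstar_gen[OF E_proj T_corner]])
    show "?S o\<^sub>C\<^sub>L T = T o\<^sub>C\<^sub>L ?S" using sqrt_T(3) by (metis cblinfun_compose_assoc)
    show "?S o\<^sub>C\<^sub>L E = E o\<^sub>C\<^sub>L ?S"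
      using cornerD(1,2)[OF E_proj cstar_gen_corner[OF E_proj T_corner sqrt_T(1)]] by simp
  qed
  have "cinner (corner_power E T n *\<^sub>V ?S *\<^sub>V x) (?S *\<^sub>V x) = cinner (?S *\<^sub>V corner_power E T n *\<^sub>V ?S *\<^sub>V x) x"
    by (rule selfadjointD[OF selfadjoint_if_positive_op[OF sqrt_T(2)], symmetric])
  also have "?S *\<^sub>V corner_power E T n *\<^sub>V ?S *\<^sub>V x = corner_power E T n *\<^sub>V T *\<^sub>V x"
    using comm by (metis cblinfun_compose.rep_eq sqrt_T_apply)
  also have "\<dots> = corner_power E T (n + 1) *\<^sub>V x"
    using corner_power_add[OF E_proj T_corner, of n "Suc 0"]
    by (metis Suc_eq_plus1 add_Suc_right add_0_right cblinfun_compose.rep_eq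
        corner_power_1[OF E_proj T_corner])
  finally show ?thesis .
qed

text \<open>U commutes with every power of T. Its orthogonality property then gives the first
  family, and UU = E gives the second.\<close>

lemma moment_conditions_if_block_conditions:
  assumes "block_conditions B a b C"
  shows "moment_conditions"
proof -
  let ?x = "pos_sqrt T *\<^sub>V a"
  obtain U where U: "corner_unitary E U" "selfadjoint U" and y: "y = U *\<^sub>V ?x"
    and UT: "U o\<^sub>C\<^sub>L T = T o\<^sub>C\<^sub>L U"
    and orth: "\<And>u v. u \<in> cyclic_subspace E T ?x \<Longrightarrow> v \<in> cyclic_subspace E T a \<Longrightarrow> cinner (U *\<^sub>V u) v = 0"
    using assms unfolding block_conditions_def Let_def by blast
  have UE: "U o\<^sub>C\<^sub>L E = U" "E o\<^sub>C\<^sub>L U = U" and UU: "U o\<^sub>C\<^sub>L U = E"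
    using U cornerD(1,2)[OF E_proj] by (auto simp: corner_unitary_def selfadjoint_def)
  have comm: "corner_power E T n *\<^sub>V U *\<^sub>V u = U *\<^sub>V corner_power E T n *\<^sub>V u" for n u
  proof -
    have "U o\<^sub>C\<^sub>L corner_power E T n = corner_power E T n o\<^sub>C\<^sub>L U"
      by (rule cstar_gen_commute[OF E_proj T_corner corner_power_in_cstar_gen[OF E_proj T_corner] UT])
        (simp only: UE)
    then show ?thesis by (metis cblinfun_compose.rep_eq)
  qed
  have "cinner (corner_power E T n *\<^sub>V y) a = 0" for n
    unfolding y comm
    using corner_power_apply_in_cyclic_subspace[OF E_proj T_corner]
      base_in_cyclic_subspace[OF E_proj T_corner, of a] by (intro orth) (simp_all only: E_ident[OF a_orth])
  moreover have "cinner (corner_power E T n *\<^sub>V y) y = cinner (corner_power E T (n + 1) *\<^sub>V a) a" for n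
  proof -
    have "cinner (corner_power E T n *\<^sub>V y) y = cinner (U *\<^sub>V U *\<^sub>V corner_power E T n *\<^sub>V ?x) ?x"
      unfolding y comm by (rule selfadjointD[OF U(2), symmetric])
    also have "U *\<^sub>V U *\<^sub>V corner_power E T n *\<^sub>V ?x = E *\<^sub>V corner_power E T n *\<^sub>V ?x"
      using UU by (metis cblinfun_compose.rep_eq)
    also have "\<dots> = corner_power E T n *\<^sub>V ?x"
      using corner_power_corner(1)[OF E_proj T_corner] by (metis cblinfun_compose.rep_eq)
    finally show ?thesis by (simp only: cinner_corner_power_sqrt)
  qed
  ultimately show ?thesis unfolding moment_conditions_def by blast
qed

lemma block_conditions_if_moment_conditions:
  assumes "moment_conditions" and "(norm a)\<^sup>2 + (norm b)\<^sup>2 = 1"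
  shows "block_conditions B a b C"
proof -
  let ?x = "pos_sqrt T *\<^sub>V a"
  have m1: "cinner (corner_power E T n *\<^sub>V y) a = 0"
    and m2: "cinner (corner_power E T n *\<^sub>V y) y = cinner (corner_power E T (n + 1) *\<^sub>V a) a" for n
    using assms(1) unfolding moment_conditions_def by blast+
  have orth_gen: "cinner (S *\<^sub>V y) a = 0" if "S \<in> cstar_gen E T" for S
  proof -
    have "cstar_gen E T \<subseteq> {S. cinner (S *\<^sub>V y) a = 0}"
      by (intro cstar_gen_subset[OF E_proj T_corner] complex_vector.subspaceI closed_Collect_eq
          continuous_intros) (simp_all add: m1 cinner_add_left cinner_scaleC_left)
    then show ?thesis using that by blast
  qed
  have x: "E *\<^sub>V ?x = ?x"
    by (rule cornerD(3)[OF E_proj cstar_gen_corner[OF E_proj T_corner sqrt_T(1)]])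
  have y: "E *\<^sub>V y = y" by (rule E_ident[OF y_orth])
  obtain U where U: "corner_unitary E U" "selfadjoint U" "y = U *\<^sub>V ?x" "U o\<^sub>C\<^sub>L T = T o\<^sub>C\<^sub>L U"
  proof -
    have "cinner (corner_power E T n *\<^sub>V ?x) ?x = cinner (corner_power E T n *\<^sub>V y) y" for n
      by (simp only: m2 cinner_corner_power_sqrt)
    \<comment> \<open>The root moves to the left, where its product with the power lies in C*(T),
      and such elements send y to vectors orthogonal to a.\<close>
    moreover have "cinner (corner_power E T n *\<^sub>V y) ?x = 0" for n
    proof -
      have "cinner (corner_power E T n *\<^sub>V y) ?x = cinner ((pos_sqrt T o\<^sub>C\<^sub>L corner_power E T n) *\<^sub>V y) a"
        unfolding cblinfun_compose.rep_eq
        by (rule selfadjointD[OF selfadjoint_if_positive_op[OF sqrt_T(2)], symmetric])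
      also have "\<dots> = 0"
        by (intro orth_gen cstar_gen_compose[OF E_proj T_corner] sqrt_T(1)
            corner_power_in_cstar_gen[OF E_proj T_corner])
      finally show ?thesis .
    qed
    ultimately show ?thesis
      using ex_reflection_exchanging[OF E_proj T_corner T_pos x y] that by blast
  qed
  have UE: "U o\<^sub>C\<^sub>L E = E o\<^sub>C\<^sub>L U"
    using U(1) cornerD(1,2)[OF E_proj, of U] by (simp only: corner_unitary_def)
  have comm: "U *\<^sub>V corner_power E T n *\<^sub>V u = corner_power E T n *\<^sub>V U *\<^sub>V u" for n u
  proof -
    have "U o\<^sub>C\<^sub>L corner_power E T n = corner_power E T n o\<^sub>C\<^sub>L U"
      by (rule cstar_gen_commute[OF E_proj T_corner corner_power_in_cstar_gen[OF E_proj T_corner] U(4) UE])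
    then show ?thesis by (metis cblinfun_compose.rep_eq)
  qed
  \<comment> \<open>On generators two powers merge into a single moment of index m + n, which
    vanishes.\<close>
  have 1: "cinner (corner_power E T n *\<^sub>V y) v = 0" if v: "v \<in> cyclic_subspace E T a" for n v
  proof -
    have "cyclic_subspace E T a \<subseteq> {v. cinner (corner_power E T n *\<^sub>V y) v = 0}"
    proof (intro cyclic_subspace_subset[OF E_proj T_corner] orth_complement_subspace)
      fix m
      have "cinner (corner_power E T n *\<^sub>V y) (corner_power E T m *\<^sub>V a)
          = cinner ((corner_power E T m o\<^sub>C\<^sub>L corner_power E T n) *\<^sub>V y) a"
        unfolding cblinfun_compose.rep_eq
        by (rule selfadjointD[OF corner_power_selfadjoint[OF E_proj T_corner T_selfadjoint], symmetric])
      then show "corner_power E T m *\<^sub>V a \<in> {v. cinner (corner_power E T n *\<^sub>V y) v = 0}"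
        by (simp only: corner_power_add[OF E_proj T_corner] m1 mem_Collect_eq)
    qed
    then show ?thesis using v by blast
  qed
  have "cinner (U *\<^sub>V u) v = 0"
    if "u \<in> cyclic_subspace E T ?x" "v \<in> cyclic_subspace E T a" for u v
  proof -
    have "cyclic_subspace E T ?x \<subseteq> {u. cinner (U *\<^sub>V u) v = 0}"
    proof (intro cyclic_subspace_subset[OF E_proj T_corner] orth_complement_subspace)
      show "corner_power E T n *\<^sub>V ?x \<in> {u. cinner (U *\<^sub>V u) v = 0}" for n
        using 1[OF that(2), of n] by (simp only: comm U(3)[symmetric] mem_Collect_eq)
    qed
    then show ?thesis using that(1) by blast
  qed
  then show ?thesis
    using U C_pos assms(2) unfolding block_conditions_def Let_def by blast
qed

end

section \<open>Reduction to a positive corner\<close>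

text \<open>The adjoint of J composed with J, minus the identity, has the zero form; it is therefore
  positive and kills every vector.\<close>

lemma isometry_cinner:
  fixes J :: "'a::chilbert_space \<Rightarrow>\<^sub>C\<^sub>L 'a"
  assumes "\<And>x. norm (J *\<^sub>V x) = norm x"
  shows "cinner (J *\<^sub>V x) (J *\<^sub>V z) = cinner x z" and "adj J *\<^sub>V J *\<^sub>V x = x"
proof -
  define X where "X = adj J o\<^sub>C\<^sub>L J - id_cblinfun"
  have X: "cinner (X *\<^sub>V u) v = cinner (J *\<^sub>V u) (J *\<^sub>V v) - cinner u v" for u v
  proof -
    have "cinner (adj J *\<^sub>V J *\<^sub>V u) v = cnj (cinner (J *\<^sub>V v) (J *\<^sub>V u))"
      unfolding cinner_adj[of J v] by (rule cinner_commute)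
    also have "\<dots> = cinner (J *\<^sub>V u) (J *\<^sub>V v)" by (rule cinner_commute[symmetric])
    finally show ?thesis by (simp add: X_def cinner_diff_left)
  qed
  have form: "cinner (X *\<^sub>V u) u = 0" for u by (simp add: X cinner_self assms)
  then have "positive_op X" by (simp add: positive_op_def)
  then have "X *\<^sub>V x = 0" for x by (rule positive_op_eq_0) (simp add: form)
  then show "cinner (J *\<^sub>V x) (J *\<^sub>V z) = cinner x z" "adj J *\<^sub>V J *\<^sub>V x = x"
    using X[of x z] by (simp_all add: X_def)
qed

section \<open>Isometries of the operator space\<close>

lemma linear_isometryI:
  assumes "\<And>x z. \<Phi> (x + z) = \<Phi> x + \<Phi> z" and "\<And>c x. \<Phi> (c *\<^sub>C x) = c *\<^sub>C \<Phi> x"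
    and "\<And>x. norm (\<Phi> x) = norm x"
  shows "linear_isometry \<Phi>"
  unfolding linear_isometry_def
  by (simp add: Vector_Spaces.linear_iff vector_space_scaleC assms)

lemma linear_isometry_compose_left:
  fixes J :: "'b::complex_normed_vector \<Rightarrow>\<^sub>C\<^sub>L 'c::complex_normed_vector"
  assumes "\<And>x. norm (J *\<^sub>V x) = norm x"
  shows "linear_isometry (\<lambda>X :: 'a::complex_normed_vector \<Rightarrow>\<^sub>C\<^sub>L 'b. J o\<^sub>C\<^sub>L X)"
proof (rule linear_isometryI)
  fix X :: "'a \<Rightarrow>\<^sub>C\<^sub>L 'b"
  show "norm (J o\<^sub>C\<^sub>L X) = norm X"
  proof (rule antisym; rule norm_cblinfun_le)
    show "norm ((J o\<^sub>C\<^sub>L X) *\<^sub>V x) \<le> norm X * norm x" for x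
      using norm_cblinfun[of X x] by (simp add: assms)
    show "norm (X *\<^sub>V x) \<le> norm (J o\<^sub>C\<^sub>L X) * norm x" for x
      using norm_cblinfun[of "J o\<^sub>C\<^sub>L X" x] by (simp add: assms)
  qed simp_all
qed (simp_all add: cblinfun_compose_linear)

lemma norm_adj_isometry_le:
  assumes "\<And>x. norm (J *\<^sub>V x) = norm x"
  shows "norm (adj J *\<^sub>V x) \<le> norm x"
proof -
  have "(norm (adj J *\<^sub>V x))\<^sup>2 = cmod (cinner (J *\<^sub>V adj J *\<^sub>V x) x)"
    unfolding cinner_adj cinner_self norm_of_real by simp
  also have "\<dots> \<le> norm (adj J *\<^sub>V x) * norm x"
    using cinner_Cauchy_Schwarz[of "J *\<^sub>V adj J *\<^sub>V x" x] by (simp add: assms)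
  finally show ?thesis by (cases "adj J *\<^sub>V x = 0") (simp_all add: power2_eq_square)
qed

text \<open>The adjoint of J is a contraction, which gives one inequality; it is also a left inverse
  of J, so X is recovered by composing with J, which gives the other.\<close>

lemma linear_isometry_compose_adj:
  fixes J :: "'a::chilbert_space \<Rightarrow>\<^sub>C\<^sub>L 'a"
  assumes J: "\<And>x. norm (J *\<^sub>V x) = norm x"
  shows "linear_isometry (\<lambda>X :: 'a \<Rightarrow>\<^sub>C\<^sub>L 'b::complex_normed_vector. X o\<^sub>C\<^sub>L adj J)"
proof (rule linear_isometryI)
  fix X :: "'a \<Rightarrow>\<^sub>C\<^sub>L 'b"
  show "norm (X o\<^sub>C\<^sub>L adj J) = norm X"
  proof (rule antisym; rule norm_cblinfun_le)
    show "norm ((X o\<^sub>C\<^sub>L adj J) *\<^sub>V x) \<le> norm X * norm x" for x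
      using order_trans[OF norm_cblinfun[of X "adj J *\<^sub>V x"]
          mult_left_mono[OF norm_adj_isometry_le[OF J, of x]]] by simp
    show "norm (X *\<^sub>V x) \<le> norm (X o\<^sub>C\<^sub>L adj J) * norm x" for x
      using norm_cblinfun[of "X o\<^sub>C\<^sub>L adj J" "J *\<^sub>V x"] by (simp add: isometry_cinner(2)[OF J] J)
  qed simp_all
qed (simp_all add: cblinfun_compose_linear)

lemma pythagoras_orth_linear_isometry:
  assumes "linear_isometry \<Phi>" and "\<Phi> y = y" and "x \<bottom>\<^sub>P y"
  shows "\<Phi> x \<bottom>\<^sub>P y"
proof -
  interpret Vector_Spaces.linear scaleC scaleC \<Phi>
    using assms(1) by (simp add: linear_isometry_def)
  have iso: "norm (\<Phi> u) = norm u" for u using assms(1) by (simp add: linear_isometry_def)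
  have "norm (r *\<^sub>C \<Phi> x + s *\<^sub>C y) = norm (r *\<^sub>C x + s *\<^sub>C y)" for r s
    using iso[of "r *\<^sub>C x + s *\<^sub>C y"] by (simp add: add scale assms(2))
  then show ?thesis using assms(3) by (simp add: pythagoras_orth_iff iso)
qed

section \<open>Bringing an orthogonal operator into the normal form\<close>

context rank_one_projection
begin

lemma block_operatorI:
  "block_form B e A a b C \<Longrightarrow> positive_op C \<Longrightarrow> norm A = 1 \<Longrightarrow> block_operator B e a b A C"
  by (simp add: block_operator_def block_operator_axioms_def rank_one_projection_axioms)

text \<open>For the diagonal entry s, the choice \<mu> = cnj s makes the diagonal entry of the
  pencil equal to 1 + |s|^2. This is at most the norm of the pencil, the square root of 1 + |s|^2,
  which forces s = 0.\<close>

lemma cinner_diag_eq_0: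
  assumes "norm A = 1" and orth: "A \<bottom>\<^sub>P B"
  shows "cinner (A *\<^sub>V e) e = 0"
proof -
  define s where "s = cinner (A *\<^sub>V e) e"
  have "cinner ((cnj s *\<^sub>C A + B) *\<^sub>V e) e = complex_of_real ((cmod s)\<^sup>2 + 1)"
    using complex_norm_square[of s]
    by (simp add: cinner_add_left cinner_scaleC_left B_apply s_def[symmetric] mult.commute)
  then have "(cmod s)\<^sup>2 + 1 = cmod (cinner ((cnj s *\<^sub>C A + B) *\<^sub>V e) e)"
    by (simp only: norm_of_real) simp
  also have "\<dots> \<le> norm ((cnj s *\<^sub>C A + B) *\<^sub>V e)"
    using cinner_Cauchy_Schwarz[of "(cnj s *\<^sub>C A + B) *\<^sub>V e" e] by (simp only: norm_e mult_1_right)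
  also have "\<dots> \<le> norm (cnj s *\<^sub>C A + B)"
    using norm_cblinfun[of "cnj s *\<^sub>C A + B" e] by (simp only: norm_e mult_1_right)
  finally have "((cmod s)\<^sup>2 + 1)\<^sup>2 \<le> (norm (cnj s *\<^sub>C A + B))\<^sup>2"
    by (rule power_mono) simp
  also have "\<dots> = 1 + (cmod s)\<^sup>2"
    using orth unfolding pythagoras_orth_unit_iff[OF assms(1) norm_B] by simp
  finally have "((cmod s)\<^sup>2)\<^sup>2 + (cmod s)\<^sup>2 \<le> 0" by (simp add: power2_sum)
  moreover have "0 \<le> ((cmod s)\<^sup>2)\<^sup>2" by simp
  ultimately have "(cmod s)\<^sup>2 \<le> 0" by linarith
  then show ?thesis by (simp add: s_def)
qed

lemma ex_block_form:
  assumes "cinner (A *\<^sub>V e) e = 0"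
  shows "\<exists>a b C. block_form B e A a b C"
proof -
  \<comment> \<open>Forced by the requirement that pairing z with a give the component of Az along
    e.\<close>
  define a where "a = ker_id B *\<^sub>V adj A *\<^sub>V e"
  define C where "C = ker_id B o\<^sub>C\<^sub>L A o\<^sub>C\<^sub>L ker_id B"
  have E: "ker_id B *\<^sub>V x = x - cinner x e *\<^sub>C e" for x by (simp add: B_apply)
  have "block_form B e A a (A *\<^sub>V e) C"
    unfolding block_form_def ker_iff
  proof (intro conjI allI ballI)
    show "cinner a e = 0"
      by (simp add: a_def E cinner_diff_left cinner_scaleC_left del: minus_cblinfun.rep_eq)
    show "cinner (A *\<^sub>V e) e = 0" by fact
    show "C \<in> corner (ker_id B)"
      by (simp add: corner_iff C_def E cinner_diff_left cinner_scaleC_left cinner_e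
          del: minus_cblinfun.rep_eq)
    fix \<alpha> z assume "z \<in> ker B"
    then have z: "cinner z e = 0" by (simp add: ker_iff)
    have "cinner z a = cinner (A *\<^sub>V z) e"
      using z by (simp add: a_def E cinner_diff_right cinner_scaleC_right cinner_adj
          del: minus_cblinfun.rep_eq)
    then show "A *\<^sub>V (\<alpha> *\<^sub>C e + z) = cinner z a *\<^sub>C e + (\<alpha> *\<^sub>C A *\<^sub>V e + C *\<^sub>V z)"
      using z by (simp add: C_def E cblinfun_add cblinfun_scaleC del: minus_cblinfun.rep_eq)
  qed
  then show ?thesis by blast
qed

text \<open>The isometry \<open>J\<close> in the proof fixes \<open>e\<close>, since both \<open>B + C\<close> and \<open>B + |C|\<close> do.\<close>

lemma ex_positive_corner:
  assumes form: "block_form B e A a b C"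
  shows "\<exists>\<Phi> :: ('h \<Rightarrow>\<^sub>C\<^sub>L 'h) \<Rightarrow> ('h \<Rightarrow>\<^sub>C\<^sub>L 'h). linear_isometry \<Phi> \<and> \<Phi> B = B \<and>
    (\<exists>a' b' C'. block_form B e (\<Phi> A) a' b' C' \<and> positive_op C')"
proof -
  have a: "cinner a e = 0" and b: "cinner b e = 0" and C: "C \<in> corner (ker_id B)"
    and A: "\<And>\<alpha> z. cinner z e = 0 \<Longrightarrow> A *\<^sub>V (\<alpha> *\<^sub>C e + z) = cinner z a *\<^sub>C e + (\<alpha> *\<^sub>C b + C *\<^sub>V z)"
    using form by (auto simp: block_form_def ker_iff)
  have Ce: "C *\<^sub>V e = 0" and C_orth: "cinner (C *\<^sub>V x) e = 0" for x using C by (auto simp: corner_iff)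
  define M where "M = adj C o\<^sub>C\<^sub>L C"
  have adj_C: "cinner (adj C *\<^sub>V u) v = cinner u (C *\<^sub>V v)" for u v
    by (metis cinner_adj cinner_commute)
  have M_form: "cinner (M *\<^sub>V u) v = cinner (C *\<^sub>V u) (C *\<^sub>V v)" for u v
    by (simp add: M_def adj_C)
  have "M \<in> corner (ker_id B)"
    unfolding corner_iff by (simp add: M_form Ce) (simp add: M_def Ce)
  moreover have "positive_op M"
    by (simp add: positive_op_def M_form cinner_self)
  ultimately have Q: "pos_sqrt M \<in> corner (ker_id B)" "positive_op (pos_sqrt M)"
    "pos_sqrt M o\<^sub>C\<^sub>L pos_sqrt M = M"
    using pos_sqrt[OF E_proj] cstar_gen_corner[OF E_proj] by blast+
  define Q where "Q = pos_sqrt M"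
  have Qe: "Q *\<^sub>V e = 0" and Q_orth: "cinner (Q *\<^sub>V x) e = 0" for x
    using Q(1) by (auto simp: corner_iff Q_def)
  have Q_norm: "(norm (Q *\<^sub>V x))\<^sup>2 = (norm (C *\<^sub>V x))\<^sup>2" for x
  proof -
    have "cinner (Q *\<^sub>V x) (Q *\<^sub>V x) = cinner (M *\<^sub>V x) x"
      using selfadjointD[OF selfadjoint_if_positive_op[OF Q(2)], of "Q *\<^sub>V x" x] Q(3)
      unfolding Q_def by (metis cblinfun_compose.rep_eq)
    then show ?thesis unfolding M_form cinner_self of_real_eq_iff .
  qed
  have "norm ((B + Q) *\<^sub>V x) = norm ((B + C) *\<^sub>V x)" for x
  proof -
    have "(norm ((B + Q) *\<^sub>V x))\<^sup>2 = (norm ((B + C) *\<^sub>V x))\<^sup>2"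
      by (simp add: B_apply norm_decomposition C_orth Q_orth Q_norm)
    then show ?thesis by simp
  qed
  then obtain J where J: "\<And>x. norm (J *\<^sub>V x) = norm x"
    and cases: "J o\<^sub>C\<^sub>L (B + Q) = B + C \<or> J o\<^sub>C\<^sub>L (B + C) = B + Q"
    using ex_polar_isometry[of "B + Q" "B + C"] by blast
  have "(B + Q) *\<^sub>V e = e" "(B + C) *\<^sub>V e = e" by (simp_all add: B_apply Qe Ce)
  then have Je: "J *\<^sub>V e = e" using cases by (metis cblinfun_compose.rep_eq)
  have JB: "J o\<^sub>C\<^sub>L B = B" by (rule cblinfun_eqI) (simp add: B_apply cblinfun_scaleC Je)
  \<comment> \<open>J therefore respects the splitting, and multiplying by it keeps the block
    shape.\<close>
  have J_orth: "cinner (J *\<^sub>V x) e = cinner x e" for x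
    using isometry_cinner(1)[OF J, of x e] by (simp add: Je)
  from cases show ?thesis
  proof
    \<comment> \<open>Left multiplication by J sends b to Jb and C to its modulus Q.\<close>
    assume "J o\<^sub>C\<^sub>L (B + C) = B + Q"
    then have JC: "J o\<^sub>C\<^sub>L C = Q" by (simp add: cblinfun_compose_linear JB)
    have "block_form B e (J o\<^sub>C\<^sub>L A) a (J *\<^sub>V b) Q"
      unfolding block_form_def ker_iff JC[symmetric]
    proof (intro conjI allI ballI)
      show "J o\<^sub>C\<^sub>L C \<in> corner (ker_id B)" unfolding JC Q_def by (rule Q(1))
      show "cinner a e = 0" "cinner (J *\<^sub>V b) e = 0" by (simp_all add: a b J_orth)
      show "(J o\<^sub>C\<^sub>L A) *\<^sub>V (\<alpha> *\<^sub>C e + z) = cinner z a *\<^sub>C e + (\<alpha> *\<^sub>C J *\<^sub>V b + (J o\<^sub>C\<^sub>L C) *\<^sub>V z)"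
        if "z \<in> ker B" for \<alpha> z
        using A[of z \<alpha>] that by (simp add: ker_iff cblinfun_add[of J] cblinfun_scaleC[of J] Je)
    qed
    then show ?thesis
      using linear_isometry_compose_left[OF J] JB Q(2) unfolding Q_def
      by (intro exI[of _ "\<lambda>X. J o\<^sub>C\<^sub>L X"]) blast
  next
    \<comment> \<open>Here C = JQ. Multiplying on the right by the adjoint of J turns C into a
      congruence of Q, which is positive.\<close>
    assume "J o\<^sub>C\<^sub>L (B + Q) = B + C"
    then have JQ: "J o\<^sub>C\<^sub>L Q = C" by (simp add: cblinfun_compose_linear JB)
    have adj_J: "cinner (adj J *\<^sub>V u) v = cinner u (J *\<^sub>V v)" for u v
      by (metis cinner_adj cinner_commute)
    have adj_Je: "adj J *\<^sub>V e = e" using isometry_cinner(2)[OF J, of e] by (simp add: Je)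
    have "block_form B e (A o\<^sub>C\<^sub>L adj J) (J *\<^sub>V a) b (C o\<^sub>C\<^sub>L adj J)"
      unfolding block_form_def ker_iff corner_iff
    proof (intro conjI allI ballI)
      show "(A o\<^sub>C\<^sub>L adj J) *\<^sub>V (\<alpha> *\<^sub>C e + z) = cinner z (J *\<^sub>V a) *\<^sub>C e + (\<alpha> *\<^sub>C b + (C o\<^sub>C\<^sub>L adj J) *\<^sub>V z)"
        if "z \<in> ker B" for \<alpha> z
        using A[of "adj J *\<^sub>V z" \<alpha>] that
        by (simp add: ker_iff adj_J Je cblinfun_add[of "adj J"] cblinfun_scaleC[of "adj J"] adj_Je)
    qed (simp_all add: J_orth a b adj_Je Ce C_orth)
    moreover have "positive_op (C o\<^sub>C\<^sub>L adj J)"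
      unfolding JQ[symmetric] positive_op_def
    proof
      fix x
      have "cinner ((J o\<^sub>C\<^sub>L Q o\<^sub>C\<^sub>L adj J) *\<^sub>V x) x = cinner (Q *\<^sub>V adj J *\<^sub>V x) (adj J *\<^sub>V x)"
        by (simp add: cinner_adj)
      then show "cinner ((J o\<^sub>C\<^sub>L Q o\<^sub>C\<^sub>L adj J) *\<^sub>V x) x \<in> \<real>\<^sub>\<ge>\<^sub>0"
        using Q(2) by (simp add: positive_op_def Q_def)
    qed
    moreover have "B o\<^sub>C\<^sub>L adj J = B"
      by (rule cblinfun_eqI) (simp add: B_apply adj_J Je)
    ultimately show ?thesis
      using linear_isometry_compose_adj[OF J]
      by (intro exI[of _ "\<lambda>X. X o\<^sub>C\<^sub>L adj J"]) blast
  qed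
qed

lemma ex_isometry_to_block_conditions:
  assumes A: "norm A = 1" and orth: "A \<bottom>\<^sub>P B"
  shows "\<exists>\<Phi> :: ('h \<Rightarrow>\<^sub>C\<^sub>L 'h) \<Rightarrow> ('h \<Rightarrow>\<^sub>C\<^sub>L 'h). linear_isometry \<Phi> \<and> \<Phi> B = B \<and>
    (\<exists>a b C. block_form B e (\<Phi> A) a b C \<and> block_conditions B a b C)"
proof -
  obtain a0 b0 C0 where "block_form B e A a0 b0 C0"
    using ex_block_form[OF cinner_diag_eq_0[OF A orth]] by blast
  from ex_positive_corner[OF this] obtain \<Phi> :: "('h \<Rightarrow>\<^sub>C\<^sub>L 'h) \<Rightarrow> ('h \<Rightarrow>\<^sub>C\<^sub>L 'h)" and a b C
    where \<Phi>: "linear_isometry \<Phi>" "\<Phi> B = B"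
      and form: "block_form B e (\<Phi> A) a b C" "positive_op C"
    by blast
  have "norm (\<Phi> A) = 1" using \<Phi>(1) A by (simp add: linear_isometry_def)
  then interpret block_operator B e a b "\<Phi> A" C by (rule block_operatorI[OF form])
  have "\<Phi> A \<bottom>\<^sub>P B" by (rule pythagoras_orth_linear_isometry[OF \<Phi> orth])
  then have "block_conditions B a b C"
    using block_conditions_if_moment_conditions unfolding pythagoras_orth_iff_moments by blast
  then show ?thesis using \<Phi> form(1) by blast
qed

end

theorem proposition6p1:
  fixes B :: "'h::chilbert_space \<Rightarrow>\<^sub>C\<^sub>L 'h" and e :: 'h
  assumes "orth_projection B" and "rank_one B"
    and "e \<in> range (cblinfun_apply B)" and "norm e = 1"
  shows
    "(\<forall>A a b C. norm A = 1 \<and> block_form B e A a b C \<and> block_conditions B a b C \<longrightarrow> A \<bottom>\<^sub>P B) \<and>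
     (\<forall>A. norm A = 1 \<and> A \<bottom>\<^sub>P B \<longrightarrow>
        (\<exists>\<Phi> :: ('h \<Rightarrow>\<^sub>C\<^sub>L 'h) \<Rightarrow> ('h \<Rightarrow>\<^sub>C\<^sub>L 'h). linear_isometry \<Phi> \<and> \<Phi> B = B \<and>
          (\<exists>a b C. block_form B e (\<Phi> A) a b C \<and> block_conditions B a b C))) \<and>
     (\<forall>A a b C. norm A = 1 \<and> block_form B e A a b C \<and>
          (norm a)\<^sup>2 + (norm b)\<^sup>2 = 1 \<and> positive_op C \<longrightarrow>
        (let E = ker_id B; T = block_defect B a C in
          ((\<forall>n. cinner (corner_power E T n *\<^sub>V adj C *\<^sub>V b) a = 0) \<and>
           (\<forall>n. cinner (C *\<^sub>V corner_power E T n *\<^sub>V adj C *\<^sub>V b) b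
              = cinner (corner_power E T (n + 1) *\<^sub>V a) a))
          \<longleftrightarrow>
          (\<forall>\<mu> :: complex.
            let w = corner_inverse E (E + complex_of_real ((cmod \<mu>)\<^sup>2) *\<^sub>C T)
                      *\<^sub>V (a + \<mu> *\<^sub>C adj C *\<^sub>V b)
            in cinner w a + cnj \<mu> * cinner (C *\<^sub>V w) b = complex_of_real ((norm a)\<^sup>2))))"
proof -
  interpret rank_one_projection B e
    by standard (rule rank_one_projection_apply[OF assms], rule assms(4))
  show ?thesis
  proof (intro conjI allI impI; (elim conjE)?)
    fix A a b C
    assume A: "norm A = 1" and form: "block_form B e A a b C" and cond: "block_conditions B a b C"
    have C: "positive_op C" and ab: "(norm a)\<^sup>2 + (norm b)\<^sup>2 = 1"
      using cond by (simp_all add: block_conditions_def)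
    interpret block_operator B e a b A C by (rule block_operatorI[OF form C A])
    show "A \<bottom>\<^sub>P B"
      using ab moment_conditions_if_block_conditions[OF cond] by (simp add: pythagoras_orth_iff_moments)
  next
    fix A assume "norm A = 1" "A \<bottom>\<^sub>P B"
    then show "\<exists>\<Phi> :: ('h \<Rightarrow>\<^sub>C\<^sub>L 'h) \<Rightarrow> ('h \<Rightarrow>\<^sub>C\<^sub>L 'h). linear_isometry \<Phi> \<and> \<Phi> B = B \<and>
          (\<exists>a b C. block_form B e (\<Phi> A) a b C \<and> block_conditions B a b C)"
      by (rule ex_isometry_to_block_conditions)
  next
    fix A a b C
    assume A: "norm A = 1" and form: "block_form B e A a b C" and C: "positive_op C"
    interpret block_operator B e a b A C by (rule block_operatorI[OF form C A])
    \<comment> \<open>Moving C across the inner product identifies the Schur number with the left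
      side of the resolvent identity in the statement.\<close>
    have "schur \<mu> = cinner (R ((cmod \<mu>)\<^sup>2) *\<^sub>V (a + \<mu> *\<^sub>C y)) a
        + cnj \<mu> * cinner (C *\<^sub>V R ((cmod \<mu>)\<^sup>2) *\<^sub>V (a + \<mu> *\<^sub>C y)) b" for \<mu>
      by (simp only: schur_def cinner_add_right cinner_scaleC_right C_selfadjoint)
    moreover have "(\<forall>\<mu>. schur \<mu> = complex_of_real ((norm a)\<^sup>2)) \<longleftrightarrow> moment_conditions"
      unfolding moment_conditions_iff using schur_0 by metis
    ultimately show "let E = ker_id B; T = block_defect B a C in
          ((\<forall>n. cinner (corner_power E T n *\<^sub>V adj C *\<^sub>V b) a = 0) \<and>
           (\<forall>n. cinner (C *\<^sub>V corner_power E T n *\<^sub>V adj C *\<^sub>V b) b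
              = cinner (corner_power E T (n + 1) *\<^sub>V a) a))
          \<longleftrightarrow>
          (\<forall>\<mu> :: complex.
            let w = corner_inverse E (E + complex_of_real ((cmod \<mu>)\<^sup>2) *\<^sub>C T)
                      *\<^sub>V (a + \<mu> *\<^sub>C adj C *\<^sub>V b)
            in cinner w a + cnj \<mu> * cinner (C *\<^sub>V w) b = complex_of_real ((norm a)\<^sup>2))"
      unfolding Let_def moment_conditions_def adj_C by (simp only: C_selfadjoint)
  qed
qed

end
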